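(* Let $F\hookrightarrow(M,g)\to N$ be a Riemannian submersion with totally geodesic fibers, with corresponding splitting $TM=\mathcal{V}\oplus H$ into vertical and horizontal distributions. Suppose that $M$ admits a complex structure $J$ compatible with $g$ and preserving $\mathcal{V}$ and $H$ such that $(M,g,J)$ is a Kähler manifold. Define a Riemannian metric $\hat g$ on $M$ for which $\mathcal{V}$ and $H$ are orthogonal by $$\hat g(X,Y)=\tfrac12g(X,Y)\ \text{ for } X,Y\in\mathcal{V},\qquad \hat g(X,Y)=g(X,Y)\ \text{ for } X,Y\in H,$$ and a $\hat g$-compatible almost complex structure $\hat J$ by $\hat J_{|\mathcal{V}}=-J$, $\hat J_{|H}=J$. Then the manifold $(M,\hat g,\hat J)$ is nearly Kähler. The distributions $\mathcal{V}$ and $H$ are parallel with respect to the canonical Hermitian connection of $(M,\hat g,\hat J)$, which thus has reduced holonomy.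
   Context: A nearly Kähler manifold is an almost Hermitian manifold $(M,g,J)$ such that $(\nabla_XJ)X=0$ for every vector field $X$, where $\nabla$ is the Levi-Civita connection of $g$. Its canonical Hermitian connection is $\overline{\nabla}_XY=\nabla_XY+\frac12(\nabla_XJ)JY$. "Reduced holonomy" means that the holonomy representation on the tangent space is reducible (base and fibers are understood to have positive dimension). *)

theory Defs
  imports "HOL-Analysis.Analysis" "HOL-Library.Function_Algebras" "HOL-Library.FuncSet"
begin

section \<open>Pointwise vector space structure on functions\<close>

instantiation "fun" :: (type, real_vector) real_vector
begin

definition scaleR_fun :: "real \<Rightarrow> ('a \<Rightarrow> 'b) \<Rightarrow> 'a \<Rightarrow> 'b"
  where "scaleR_fun r f = (\<lambda>x. r *\<^sub>R f x)"

instance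
  by standard (auto simp: scaleR_fun_def plus_fun_def scaleR_add_right scaleR_add_left)

end

section \<open>Smooth manifolds\<close>

text \<open>
  The second argument of \<open>differentiable_of_order\<close> is meant to be an open set; directional
  derivatives of all orders exist and are continuous, i.e. the function is of class \<open>C\<^sup>k\<close>.
\<close>

primrec differentiable_of_order ::
    "nat \<Rightarrow> 'a::real_normed_vector set \<Rightarrow> ('a \<Rightarrow> 'b::real_normed_vector) \<Rightarrow> bool"
  where
    "differentiable_of_order 0 S f \<longleftrightarrow> continuous_on S f"
  | "differentiable_of_order (Suc k) S f \<longleftrightarrow>
       (\<forall>x\<in>S. f differentiable (at x)) \<and>
       (\<forall>v. differentiable_of_order k S (\<lambda>x. frechet_derivative f (at x) v))"

definition smooth_on :: "'a::real_normed_vector set \<Rightarrow> ('a \<Rightarrow> 'b::real_normed_vector) \<Rightarrow> bool"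
  where "smooth_on S f \<longleftrightarrow> (\<forall>k. differentiable_of_order k S f)"

record ('m, 'e) chart =
  cdom :: "'m set"
  cmap :: "'m \<Rightarrow> 'e"

definition cinv :: "('m, 'e) chart \<Rightarrow> 'e \<Rightarrow> 'm"
  where "cinv c = inv_into (cdom c) (cmap c)"

record ('m, 'e) manifold =
  topo :: "'m topology"
  atlas :: "('m, 'e) chart set"

abbreviation points :: "('m, 'e) manifold \<Rightarrow> 'm set"
  where "points M \<equiv> topspace (topo M)"

definition transition :: "('m, 'e) chart \<Rightarrow> ('m, 'e) chart \<Rightarrow> 'e \<Rightarrow> 'e"
  where "transition c c' = cmap c' \<circ> cinv c"

definition compatible_chart :: "('m, 'e::euclidean_space) manifold \<Rightarrow> ('m, 'e) chart \<Rightarrow> bool"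
  where
    "compatible_chart M c \<longleftrightarrow>
       openin (topo M) (cdom c) \<and> open (cmap c ` cdom c) \<and>
       homeomorphic_map (subtopology (topo M) (cdom c)) (top_of_set (cmap c ` cdom c)) (cmap c) \<and>
       (\<forall>c'\<in>atlas M. smooth_on (cmap c ` (cdom c \<inter> cdom c')) (transition c c') \<and>
                      smooth_on (cmap c' ` (cdom c \<inter> cdom c')) (transition c' c))"

definition smooth_manifold :: "('m, 'e::euclidean_space) manifold \<Rightarrow> bool"
  where
    "smooth_manifold M \<longleftrightarrow>
       Hausdorff_space (topo M) \<and> second_countable (topo M) \<and>
       (\<Union>c\<in>atlas M. cdom c) = points M \<and> (\<forall>c\<in>atlas M. compatible_chart M c)"

definition charts_at :: "('m, 'e) manifold \<Rightarrow> 'm \<Rightarrow> ('m, 'e) chart set"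
  where "charts_at M p = {c \<in> atlas M. p \<in> cdom c}"

definition chart_at :: "('m, 'e) manifold \<Rightarrow> 'm \<Rightarrow> ('m, 'e) chart"
  where "chart_at M p = (SOME c. c \<in> charts_at M p)"

definition smooth_fun :: "('m, 'e::euclidean_space) manifold \<Rightarrow> 'm set \<Rightarrow> ('m \<Rightarrow> real) \<Rightarrow> bool"
  where
    "smooth_fun M U f \<longleftrightarrow>
       (\<forall>c\<in>atlas M. smooth_on (cmap c ` (U \<inter> cdom c)) (\<lambda>x. f (cinv c x)))"

definition smooth_map ::
    "('m, 'e::euclidean_space) manifold \<Rightarrow> ('n, 'f::euclidean_space) manifold \<Rightarrow> ('m \<Rightarrow> 'n) \<Rightarrow> bool"
  where
    "smooth_map M N f \<longleftrightarrow>
       continuous_map (topo M) (topo N) f \<and>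
       (\<forall>c\<in>atlas M. \<forall>d\<in>atlas N.
          smooth_on (cmap c ` {p \<in> cdom c. f p \<in> cdom d}) (\<lambda>x. cmap d (f (cinv c x))))"

section \<open>Tangent vectors and vector fields\<close>

text \<open>
  A tangent vector at \<open>p\<close> is the family of its coordinate vectors in the charts around \<open>p\<close>,
  related by the derivatives of the transition maps, and extended by \<open>0\<close> to all other charts so
  that the linear operations on tangent vectors are the pointwise ones.
\<close>

type_synonym ('m, 'e) tangent = "('m, 'e) chart \<Rightarrow> 'e"
type_synonym ('m, 'e) vfield = "'m \<Rightarrow> ('m, 'e) tangent"
type_synonym ('m, 'e) endo = "'m \<Rightarrow> ('m, 'e) tangent \<Rightarrow> ('m, 'e) tangent"
type_synonym ('m, 'e) bilin = "'m \<Rightarrow> ('m, 'e) tangent \<Rightarrow> ('m, 'e) tangent \<Rightarrow> real"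
type_synonym ('m, 'e) distribution = "'m \<Rightarrow> ('m, 'e) tangent set"

definition tangent_space :: "('m, 'e::euclidean_space) manifold \<Rightarrow> ('m, 'e) distribution"
  where
    "tangent_space M p =
       {v. (\<forall>c\<in>charts_at M p. \<forall>c'\<in>charts_at M p.
              v c' = frechet_derivative (transition c c') (at (cmap c p)) (v c)) \<and>
           (\<forall>c. c \<notin> charts_at M p \<longrightarrow> v c = 0)}"

text \<open>
  \<open>vfields M U\<close> consists of the smooth vector fields on the open set \<open>U\<close>; their values outside
  \<open>U\<close> are irrelevant. As usual, vector fields may be defined on open subsets only.
\<close>

definition vfields :: "('m, 'e::euclidean_space) manifold \<Rightarrow> 'm set \<Rightarrow> ('m, 'e) vfield set"
  where
    "vfields M U =
       {X. (\<forall>p\<in>U. X p \<in> tangent_space M p) \<and>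
           (\<forall>c\<in>atlas M. smooth_on (cmap c ` (U \<inter> cdom c)) (\<lambda>x. X (cinv c x) c))}"

definition deriv_along ::
    "('m, 'e::euclidean_space) manifold \<Rightarrow> ('m \<Rightarrow> real) \<Rightarrow> 'm \<Rightarrow> ('m, 'e) tangent \<Rightarrow> real"
  where
    "deriv_along M f p v =
       (let c = chart_at M p
        in frechet_derivative (\<lambda>x. f (cinv c x)) (at (cmap c p)) (v c))"

definition differential ::
    "('m, 'e::euclidean_space) manifold \<Rightarrow> ('n, 'f::euclidean_space) manifold \<Rightarrow> ('m \<Rightarrow> 'n)
       \<Rightarrow> 'm \<Rightarrow> ('m, 'e) tangent \<Rightarrow> ('n, 'f) tangent"
  where
    "differential M N f p v =
       (\<lambda>d. if d \<in> charts_at N (f p)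
            then let c = chart_at M p
                 in frechet_derivative (\<lambda>x. cmap d (f (cinv c x))) (at (cmap c p)) (v c)
            else 0)"

definition bracket ::
    "('m, 'e::euclidean_space) manifold \<Rightarrow> ('m, 'e) vfield \<Rightarrow> ('m, 'e) vfield \<Rightarrow> ('m, 'e) vfield"
  where
    "bracket M X Y p =
       (\<lambda>c. if c \<in> charts_at M p
            then frechet_derivative (\<lambda>x. Y (cinv c x) c) (at (cmap c p)) (X p c)
               - frechet_derivative (\<lambda>x. X (cinv c x) c) (at (cmap c p)) (Y p c)
            else 0)"

text \<open>The field on the domain of \<open>c\<close> whose coordinate vector in the chart \<open>c\<close> is constantly \<open>u\<close>.\<close>

definition coord_field ::
    "('m, 'e::euclidean_space) manifold \<Rightarrow> ('m, 'e) chart \<Rightarrow> 'e \<Rightarrow> ('m, 'e) vfield"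
  where
    "coord_field M c u p =
       (\<lambda>c'. if c' \<in> charts_at M p
             then frechet_derivative (transition c c') (at (cmap c p)) u else 0)"

section \<open>Riemannian metrics and endomorphism fields\<close>

definition riemannian_metric :: "('m, 'e::euclidean_space) manifold \<Rightarrow> ('m, 'e) bilin \<Rightarrow> bool"
  where
    "riemannian_metric M g \<longleftrightarrow>
       (\<forall>p\<in>points M. \<forall>u\<in>tangent_space M p. \<forall>v\<in>tangent_space M p.
          g p u v = g p v u \<and>
          (\<forall>w\<in>tangent_space M p. \<forall>a b. g p (a *\<^sub>R u + b *\<^sub>R v) w = a * g p u w + b * g p v w) \<and>
          (u \<noteq> 0 \<longrightarrow> g p u u > 0)) \<and>
       (\<forall>U. openin (topo M) U \<longrightarrow>
          (\<forall>X\<in>vfields M U. \<forall>Y\<in>vfields M U. smooth_fun M U (\<lambda>p. g p (X p) (Y p))))"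

definition apply_endo :: "('m, 'e) endo \<Rightarrow> ('m, 'e) vfield \<Rightarrow> ('m, 'e) vfield"
  where "apply_endo J X = (\<lambda>p. J p (X p))"

definition endo_field :: "('m, 'e::euclidean_space) manifold \<Rightarrow> ('m, 'e) endo \<Rightarrow> bool"
  where
    "endo_field M J \<longleftrightarrow>
       (\<forall>p\<in>points M. \<forall>u\<in>tangent_space M p. \<forall>v\<in>tangent_space M p.
          J p u \<in> tangent_space M p \<and>
          (\<forall>a b. J p (a *\<^sub>R u + b *\<^sub>R v) = a *\<^sub>R J p u + b *\<^sub>R J p v)) \<and>
       (\<forall>U. openin (topo M) U \<longrightarrow> (\<forall>X\<in>vfields M U. apply_endo J X \<in> vfields M U))"

definition almost_complex :: "('m, 'e::euclidean_space) manifold \<Rightarrow> ('m, 'e) endo \<Rightarrow> bool"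
  where
    "almost_complex M J \<longleftrightarrow>
       endo_field M J \<and> (\<forall>p\<in>points M. \<forall>v\<in>tangent_space M p. J p (J p v) = - v)"

definition coord_vector ::
    "('m, 'e::euclidean_space) manifold \<Rightarrow> ('m, 'e) chart \<Rightarrow> 'm \<Rightarrow> ('m, 'e) tangent \<Rightarrow> 'e"
  where
    "coord_vector M c p v =
       (let c' = chart_at M p in frechet_derivative (transition c' c) (at (cmap c' p)) (v c'))"

text \<open>
  \<open>J\<close> comes from a holomorphic atlas: around every point there is a chart, not necessarily in the
  given atlas, taking \<open>J\<close> to a constant complex structure \<open>I\<close> on the coordinate space, i.e. to
  multiplication by the imaginary unit under an identification of that space with a complex
  coordinate space.
\<close>

definition complex_structure :: "('m, 'e::euclidean_space) manifold \<Rightarrow> ('m, 'e) endo \<Rightarrow> bool"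
  where
    "complex_structure M J \<longleftrightarrow>
       almost_complex M J \<and>
       (\<forall>p\<in>points M. \<exists>c I. compatible_chart M c \<and> p \<in> cdom c \<and> linear I \<and> (\<forall>x. I (I x) = - x) \<and>
          (\<forall>q\<in>cdom c. \<forall>v\<in>tangent_space M q. coord_vector M c q (J q v) = I (coord_vector M c q v)))"

definition almost_hermitian ::
    "('m, 'e::euclidean_space) manifold \<Rightarrow> ('m, 'e) bilin \<Rightarrow> ('m, 'e) endo \<Rightarrow> bool"
  where
    "almost_hermitian M g J \<longleftrightarrow>
       smooth_manifold M \<and> riemannian_metric M g \<and> almost_complex M J \<and>
       (\<forall>p\<in>points M. \<forall>u\<in>tangent_space M p. \<forall>v\<in>tangent_space M p. g p (J p u) (J p v) = g p u v)"

section \<open>Connections\<close>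

text \<open>
  \<open>D X Y\<close> is the covariant derivative of \<open>Y\<close> in the direction \<open>X\<close>. Since \<open>vfields M U\<close> ignores
  the values outside \<open>U\<close>, the last clause says that \<open>(D X Y) p\<close> depends only on the germs
  of \<open>X\<close> and \<open>Y\<close> at \<open>p\<close>.
\<close>

type_synonym ('m, 'e) connection = "('m, 'e) vfield \<Rightarrow> ('m, 'e) vfield \<Rightarrow> ('m, 'e) vfield"

definition affine_connection ::
    "('m, 'e::euclidean_space) manifold \<Rightarrow> ('m, 'e) connection \<Rightarrow> bool"
  where
    "affine_connection M D \<longleftrightarrow>
       (\<forall>U. openin (topo M) U \<longrightarrow>
          (\<forall>X\<in>vfields M U. \<forall>Y\<in>vfields M U.
             D X Y \<in> vfields M U \<and>
             (\<forall>Z\<in>vfields M U. \<forall>p\<in>U.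
                D (X + Z) Y p = D X Y p + D Z Y p \<and> D X (Y + Z) p = D X Y p + D X Z p) \<and>
             (\<forall>f. smooth_fun M U f \<longrightarrow> (\<forall>p\<in>U.
                D (\<lambda>q. f q *\<^sub>R X q) Y p = f p *\<^sub>R D X Y p \<and>
                D X (\<lambda>q. f q *\<^sub>R Y q) p = deriv_along M f p (X p) *\<^sub>R Y p + f p *\<^sub>R D X Y p)) \<and>
             (\<forall>X'\<in>vfields M U. \<forall>Y'\<in>vfields M U.
                (\<forall>p\<in>U. X p = X' p \<and> Y p = Y' p) \<longrightarrow> (\<forall>p\<in>U. D X Y p = D X' Y' p))))"

definition levi_civita ::
    "('m, 'e::euclidean_space) manifold \<Rightarrow> ('m, 'e) bilin \<Rightarrow> ('m, 'e) connection \<Rightarrow> bool"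
  where
    "levi_civita M g D \<longleftrightarrow>
       affine_connection M D \<and>
       (\<forall>U. openin (topo M) U \<longrightarrow>
          (\<forall>X\<in>vfields M U. \<forall>Y\<in>vfields M U. \<forall>p\<in>U.
             D X Y p - D Y X p = bracket M X Y p \<and>
             (\<forall>Z\<in>vfields M U.
                deriv_along M (\<lambda>q. g q (Y q) (Z q)) p (X p) = g p (D X Y p) (Z p) + g p (Y p) (D X Z p))))"

definition cov_endo ::
    "('m, 'e) connection \<Rightarrow> ('m, 'e::euclidean_space) endo \<Rightarrow> ('m, 'e) vfield \<Rightarrow> ('m, 'e) vfield
       \<Rightarrow> ('m, 'e) vfield"
  where "cov_endo D J X Y = D X (apply_endo J Y) - apply_endo J (D X Y)"

definition kaehler ::
    "('m, 'e::euclidean_space) manifold \<Rightarrow> ('m, 'e) bilin \<Rightarrow> ('m, 'e) endo \<Rightarrow> bool"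
  where
    "kaehler M g J \<longleftrightarrow>
       almost_hermitian M g J \<and> complex_structure M J \<and>
       (\<exists>D. levi_civita M g D \<and>
          (\<forall>U. openin (topo M) U \<longrightarrow>
             (\<forall>X\<in>vfields M U. \<forall>Y\<in>vfields M U. \<forall>p\<in>U. cov_endo D J X Y p = 0)))"

definition nearly_kaehler ::
    "('m, 'e::euclidean_space) manifold \<Rightarrow> ('m, 'e) bilin \<Rightarrow> ('m, 'e) endo \<Rightarrow> bool"
  where
    "nearly_kaehler M g J \<longleftrightarrow>
       almost_hermitian M g J \<and>
       (\<exists>D. levi_civita M g D \<and>
          (\<forall>U. openin (topo M) U \<longrightarrow> (\<forall>X\<in>vfields M U. \<forall>p\<in>U. cov_endo D J X X p = 0)))"

definition canonical_hermitian_connection ::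
    "('m, 'e) connection \<Rightarrow> ('m, 'e::euclidean_space) endo \<Rightarrow> ('m, 'e) connection"
  where
    "canonical_hermitian_connection D J X Y = D X Y + (1/2) *\<^sub>R cov_endo D J X (apply_endo J Y)"

definition parallel_distribution ::
    "('m, 'e::euclidean_space) manifold \<Rightarrow> ('m, 'e) connection \<Rightarrow> ('m, 'e) distribution \<Rightarrow> bool"
  where
    "parallel_distribution M D E \<longleftrightarrow>
       (\<forall>U. openin (topo M) U \<longrightarrow>
          (\<forall>X\<in>vfields M U. \<forall>Y\<in>vfields M U.
             (\<forall>p\<in>U. Y p \<in> E p) \<longrightarrow> (\<forall>p\<in>U. D X Y p \<in> E p)))"

section \<open>Parallel transport and holonomy\<close>

definition christoffel ::
    "('m, 'e::euclidean_space) manifold \<Rightarrow> ('m, 'e) connection \<Rightarrow> ('m, 'e) chart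
       \<Rightarrow> 'm \<Rightarrow> 'e \<Rightarrow> 'e \<Rightarrow> 'e"
  where "christoffel M D c p u w = D (coord_field M c u) (coord_field M c w) p c"

definition C1_arc ::
    "('m, 'e::euclidean_space) manifold \<Rightarrow> (real \<Rightarrow> 'm) \<Rightarrow> real \<Rightarrow> real \<Rightarrow> bool"
  where
    "C1_arc M \<gamma> a b \<longleftrightarrow>
       continuous_map (top_of_set {a..b}) (topo M) \<gamma> \<and>
       (\<forall>c\<in>atlas M. \<exists>\<gamma>'. continuous_on {t\<in>{a..b}. \<gamma> t \<in> cdom c} \<gamma>' \<and>
          (\<forall>t\<in>{a..b}. \<gamma> t \<in> cdom c \<longrightarrow>
             ((\<lambda>t. cmap c (\<gamma> t)) has_vector_derivative \<gamma>' t) (at t within {a..b})))"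

definition piecewise_C1_path :: "('m, 'e::euclidean_space) manifold \<Rightarrow> (real \<Rightarrow> 'm) \<Rightarrow> bool"
  where
    "piecewise_C1_path M \<gamma> \<longleftrightarrow>
       (\<exists>ts. ts \<noteq> [] \<and> sorted_wrt (<) ts \<and> hd ts = 0 \<and> last ts = 1 \<and>
          (\<forall>i. Suc i < length ts \<longrightarrow> C1_arc M \<gamma> (ts ! i) (ts ! Suc i)))"

text \<open>
  The coordinate equation \<open>s' + \<Gamma>(\<gamma>', s) = 0\<close>, required on every subinterval on which \<open>\<gamma>\<close> is
  continuously differentiable; at the break points of \<open>\<gamma>\<close> it holds with one-sided derivatives.
\<close>

definition parallel_along ::
    "('m, 'e::euclidean_space) manifold \<Rightarrow> ('m, 'e) connection \<Rightarrow> (real \<Rightarrow> 'm)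
       \<Rightarrow> (real \<Rightarrow> ('m, 'e) tangent) \<Rightarrow> bool"
  where
    "parallel_along M D \<gamma> s \<longleftrightarrow>
       (\<forall>t\<in>{0..1}. s t \<in> tangent_space M (\<gamma> t)) \<and>
       (\<forall>a b. 0 \<le> a \<and> a < b \<and> b \<le> 1 \<and> C1_arc M \<gamma> a b \<longrightarrow>
          (\<forall>t\<in>{a..b}. \<forall>c\<in>charts_at M (\<gamma> t).
             ((\<lambda>t. s t c) has_vector_derivative
                - christoffel M D c (\<gamma> t)
                    (vector_derivative (\<lambda>t. cmap c (\<gamma> t)) (at t within {a..b})) (s t c))
               (at t within {a..b})))"

definition holonomy ::
    "('m, 'e::euclidean_space) manifold \<Rightarrow> ('m, 'e) connection \<Rightarrow> 'm
       \<Rightarrow> (('m, 'e) tangent \<Rightarrow> ('m, 'e) tangent) set"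
  where
    "holonomy M D p =
       {\<tau> \<in> tangent_space M p \<rightarrow>\<^sub>E tangent_space M p.
          \<exists>\<gamma>. piecewise_C1_path M \<gamma> \<and> \<gamma> 0 = p \<and> \<gamma> 1 = p \<and>
            (\<forall>v\<in>tangent_space M p. \<exists>s. parallel_along M D \<gamma> s \<and> s 0 = v \<and> s 1 = \<tau> v)}"

definition reduced_holonomy ::
    "('m, 'e::euclidean_space) manifold \<Rightarrow> ('m, 'e) connection \<Rightarrow> bool"
  where
    "reduced_holonomy M D \<longleftrightarrow>
       (\<forall>p\<in>points M. \<exists>W. subspace W \<and> W \<noteq> {0} \<and> W \<subset> tangent_space M p \<and>
          (\<forall>\<tau>\<in>holonomy M D p. \<tau> ` W \<subseteq> W))"

section \<open>Riemannian submersions\<close>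

definition vertical ::
    "('m, 'e::euclidean_space) manifold \<Rightarrow> ('n, 'f::euclidean_space) manifold \<Rightarrow> ('m \<Rightarrow> 'n)
       \<Rightarrow> ('m, 'e) distribution"
  where "vertical M N \<pi> p = {v \<in> tangent_space M p. differential M N \<pi> p v = 0}"

definition horizontal ::
    "('m, 'e::euclidean_space) manifold \<Rightarrow> ('m, 'e) bilin \<Rightarrow> ('n, 'f::euclidean_space) manifold
       \<Rightarrow> ('m \<Rightarrow> 'n) \<Rightarrow> ('m, 'e) distribution"
  where
    "horizontal M g N \<pi> p = {v \<in> tangent_space M p. \<forall>w\<in>vertical M N \<pi> p. g p v w = 0}"

definition riemannian_submersion ::
    "('m, 'e::euclidean_space) manifold \<Rightarrow> ('m, 'e) bilin
       \<Rightarrow> ('n, 'f::euclidean_space) manifold \<Rightarrow> ('n, 'f) bilin \<Rightarrow> ('m \<Rightarrow> 'n) \<Rightarrow> bool"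
  where
    "riemannian_submersion M g N h \<pi> \<longleftrightarrow>
       smooth_manifold M \<and> riemannian_metric M g \<and> smooth_manifold N \<and> riemannian_metric N h \<and>
       smooth_map M N \<pi> \<and> \<pi> ` points M = points N \<and>
       (\<forall>p\<in>points M.
          differential M N \<pi> p ` tangent_space M p = tangent_space N (\<pi> p) \<and>
          (\<forall>u\<in>horizontal M g N \<pi> p. \<forall>v\<in>horizontal M g N \<pi> p.
             h (\<pi> p) (differential M N \<pi> p u) (differential M N \<pi> p v) = g p u v))"

text \<open>
  The second fundamental form of each fiber \<open>F\<close> vanishes; the tangent space of \<open>F\<close> at \<open>p\<close> is
  \<open>vertical M N \<pi> p\<close>.
\<close>

definition totally_geodesic_fibers ::
    "('m, 'e::euclidean_space) manifold \<Rightarrow> ('m, 'e) bilin \<Rightarrow> ('n, 'f::euclidean_space) manifold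
       \<Rightarrow> ('m \<Rightarrow> 'n) \<Rightarrow> bool"
  where
    "totally_geodesic_fibers M g N \<pi> \<longleftrightarrow>
       (\<exists>D. levi_civita M g D \<and>
          (\<forall>b\<in>points N. let F = {p \<in> points M. \<pi> p = b} in
             \<forall>U. openin (topo M) U \<longrightarrow>
               (\<forall>X\<in>vfields M U. \<forall>Y\<in>vfields M U.
                  (\<forall>p\<in>U \<inter> F. X p \<in> vertical M N \<pi> p \<and> Y p \<in> vertical M N \<pi> p) \<longrightarrow>
                  (\<forall>p\<in>U \<inter> F. D X Y p \<in> vertical M N \<pi> p))))"

definition preserves ::
    "('m, 'e) manifold \<Rightarrow> ('m, 'e) endo \<Rightarrow> ('m, 'e) distribution \<Rightarrow> bool"
  where "preserves M J E \<longleftrightarrow> (\<forall>p\<in>points M. J p ` E p \<subseteq> E p)"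

definition vert_part ::
    "('m, 'e::euclidean_space) manifold \<Rightarrow> ('m, 'e) bilin \<Rightarrow> ('n, 'f::euclidean_space) manifold
       \<Rightarrow> ('m \<Rightarrow> 'n) \<Rightarrow> ('m, 'e) endo"
  where
    "vert_part M g N \<pi> p v = (THE w. w \<in> vertical M N \<pi> p \<and> v - w \<in> horizontal M g N \<pi> p)"

definition hor_part ::
    "('m, 'e::euclidean_space) manifold \<Rightarrow> ('m, 'e) bilin \<Rightarrow> ('n, 'f::euclidean_space) manifold
       \<Rightarrow> ('m \<Rightarrow> 'n) \<Rightarrow> ('m, 'e) endo"
  where "hor_part M g N \<pi> p v = v - vert_part M g N \<pi> p v"

definition hat_metric ::
    "('m, 'e::euclidean_space) manifold \<Rightarrow> ('m, 'e) bilin \<Rightarrow> ('n, 'f::euclidean_space) manifold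
       \<Rightarrow> ('m \<Rightarrow> 'n) \<Rightarrow> ('m, 'e) bilin"
  where
    "hat_metric M g N \<pi> p u v =
       (1/2) * g p (vert_part M g N \<pi> p u) (vert_part M g N \<pi> p v)
       + g p (hor_part M g N \<pi> p u) (hor_part M g N \<pi> p v)"

definition hat_structure ::
    "('m, 'e::euclidean_space) manifold \<Rightarrow> ('m, 'e) bilin \<Rightarrow> ('m, 'e) endo
       \<Rightarrow> ('n, 'f::euclidean_space) manifold \<Rightarrow> ('m \<Rightarrow> 'n) \<Rightarrow> ('m, 'e) endo"
  where
    "hat_structure M g J N \<pi> p v =
       - J p (vert_part M g N \<pi> p v) + J p (hor_part M g N \<pi> p v)"

end

theory Submission
  imports Defs
begin

text \<open>
  Write \<open>V\<close> and \<open>H\<close> for the projections onto the vertical and horizontal distributions and put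
  \<open>A(X, Y) = H (D\<^sub>X (V Y))\<close>, where \<open>D\<close> is the Levi-Civita connection of \<open>g\<close>. Then \<open>A\<close> is tensorial,
  and it only depends on the horizontal part of \<open>X\<close> since the fibers are totally geodesic. The form
  \<open>\<pi>\<^sup>*h = g(H \<cdot>, H \<cdot>)\<close> is invariant under vertical fields, so \<open>g(A(X, Y), Z)\<close> is skew in \<open>X\<close> and \<open>Z\<close>;
  as \<open>DJ = 0\<close>, this also gives \<open>A(J X, Y) = - J A(X, Y)\<close> and \<open>A(X, J Y) = J A(X, Y)\<close>.
  It follows that the Levi-Civita connection of the rescaled metric sends \<open>(X, Y)\<close> to
  \<open>D\<^sub>X Y - (A(X, Y) + A(Y, X)) / 2\<close>, that the covariant derivative of the new structure is
  \<open>J (2 V (D\<^sub>X (H Y)) + A(Y, X) - A(X, Y))\<close>, which vanishes for \<open>X = Y\<close>, and that the canonical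
  Hermitian connection is \<open>V (D\<^sub>X (V Y)) + H (D\<^sub>X (H Y))\<close>. The latter preserves both distributions and
  the degenerate form \<open>\<pi>\<^sup>*h\<close>, whose kernel is the vertical distribution, so that parallel transport
  preserves vertical vectors.
\<close>

section \<open>Calculus of smooth functions\<close>

text \<open>The constant 1/2 is forced. If the metric on \<open>V\<close> is scaled by
  \<open>t\<close>, subtracting \<open>c (A(X, Y) + A(Y, X))\<close> keeps the connection
  torsion-free for every \<open>c\<close>, and compatibility with the rescaled metric holds for
  \<open>c = 1 - t\<close>. The covariant derivative of the new structure is then
  \<open>J (2 V (D_X (H Y)) + (2 c - 2) A(X, Y) + 2 c A(Y, X))\<close>. At \<open>X = Y\<close> the
  first term vanishes by skewness and what is left is \<open>(4 c - 2) J A(X, X)\<close>, which is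
  zero for \<open>c = 1/2\<close>. Two obstacles shape the rest. The projections are defined
  pointwise, so their smoothness is a theorem: the horizontal part of a field solves a linear system
  whose matrix is the metric in a chart, and the calculus below is built to treat such systems.
  Moreover connections act on local fields, not on single vectors. Wherever nondegeneracy of the
  metric is used for a connection, the test vector is therefore the defect itself, which is already
  a field, so that no vector has to be extended.\<close>

lemma has_derivative_cong_open:
  assumes "open S" "x \<in> S" "\<And>y. y \<in> S \<Longrightarrow> f y = g y"
  shows "(f has_derivative F) (at x) \<longleftrightarrow> (g has_derivative F) (at x)"
proof
  show "(g has_derivative F) (at x)" if "(f has_derivative F) (at x)"
    using that assms by (rule has_derivative_transform_within_open)
  show "(f has_derivative F) (at x)" if "(g has_derivative F) (at x)"
    using that assms(1,2) by (rule has_derivative_transform_within_open) (simp add: assms(3))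
qed

lemma frechet_derivative_cong_open:
  assumes "open S" "x \<in> S" "\<And>y. y \<in> S \<Longrightarrow> f y = g y"
  shows "frechet_derivative f (at x) = frechet_derivative g (at x)"
  using has_derivative_cong_open[OF assms] by (simp add: frechet_derivative_def)

lemma differentiable_cong_open:
  assumes "open S" "x \<in> S" "\<And>y. y \<in> S \<Longrightarrow> f y = g y"
  shows "f differentiable (at x) \<longleftrightarrow> g differentiable (at x)"
  using has_derivative_cong_open[OF assms] by (simp add: differentiable_def)

lemma differentiable_of_order_cong:
  assumes "open S" "\<And>x. x \<in> S \<Longrightarrow> f x = g x"
  shows "differentiable_of_order k S f \<longleftrightarrow> differentiable_of_order k S g"
  using assms(2)
proof (induction k arbitrary: f g)
  case 0
  then show ?case by (simp cong: continuous_on_cong)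
next
  case (Suc k)
  have "frechet_derivative f (at x) v = frechet_derivative g (at x) v" if "x \<in> S" for x v
    using frechet_derivative_cong_open[OF assms(1) that Suc.prems] by simp
  then have "differentiable_of_order k S (\<lambda>x. frechet_derivative f (at x) v) \<longleftrightarrow>
        differentiable_of_order k S (\<lambda>x. frechet_derivative g (at x) v)" for v
    by (rule Suc.IH)
  moreover have "f differentiable (at x) \<longleftrightarrow> g differentiable (at x)" if "x \<in> S" for x
    using differentiable_cong_open[OF assms(1) that Suc.prems] .
  ultimately show ?case by simp
qed

text \<open>The recursive clause does not mention continuity of \<open>f\<close>. It is recovered at
  the bottom from differentiability, and the directional derivatives lose one order by
  induction.\<close>

lemma differentiable_of_order_SucD:
  "differentiable_of_order (Suc k) S f \<Longrightarrow> differentiable_of_order k S f"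
proof (induction k arbitrary: f)
  case 0
  then show ?case
    by (auto intro!: continuous_at_imp_continuous_on differentiable_imp_continuous_within)
next
  case (Suc k)
  then show ?case
    using differentiable_of_order.simps(2) by metis
qed

lemma differentiable_of_order_subset:
  "differentiable_of_order k S f \<Longrightarrow> T \<subseteq> S \<Longrightarrow> differentiable_of_order k T f"
  by (induction k arbitrary: f) (auto intro: continuous_on_subset)

lemma differentiable_of_order_local:
  assumes "\<And>x. x \<in> S \<Longrightarrow> \<exists>T. open T \<and> x \<in> T \<and> differentiable_of_order k T f"
  shows "differentiable_of_order k S f"
  using assms
proof (induction k arbitrary: f)
  case 0
  have "continuous (at x) f" if "x \<in> S" for x
    using 0[OF that] by (auto simp: continuous_on_eq_continuous_at)
  then show ?case
    by (simp add: continuous_at_imp_continuous_on)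
next
  case (Suc k)
  have "differentiable_of_order k S (\<lambda>x. frechet_derivative f (at x) v)" for v
    using Suc.prems by (intro Suc.IH) (metis differentiable_of_order.simps(2))
  then show ?case using Suc.prems by auto
qed

lemma differentiable_of_order_const: "differentiable_of_order k S (\<lambda>x. c)"
  by (induction k arbitrary: c) auto

lemma differentiable_of_order_add:
  assumes "open S" "differentiable_of_order k S f" "differentiable_of_order k S g"
  shows "differentiable_of_order k S (\<lambda>x. f x + g x)"
  using assms(2,3)
proof (induction k arbitrary: f g)
  case 0
  then show ?case by (simp add: continuous_on_add)
next
  case (Suc k)
  have "frechet_derivative (\<lambda>x. f x + g x) (at x) v
      = frechet_derivative f (at x) v + frechet_derivative g (at x) v" if "x \<in> S" for x v
  proof -
    have "f differentiable at x" "g differentiable at x"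
      using Suc.prems that by auto
    then have "((\<lambda>x. f x + g x) has_derivative
       (\<lambda>v. frechet_derivative f (at x) v + frechet_derivative g (at x) v)) (at x)"
      by (intro has_derivative_add) (simp_all add: frechet_derivative_works)
    then show ?thesis by (metis frechet_derivative_at)
  qed
  then have "differentiable_of_order k S (\<lambda>x. frechet_derivative (\<lambda>x. f x + g x) (at x) v)" for v
    using Suc.IH[of "\<lambda>x. frechet_derivative f (at x) v" "\<lambda>x. frechet_derivative g (at x) v"] Suc.prems
    by (subst differentiable_of_order_cong[OF assms(1)]) auto
  then show ?case using Suc.prems by (auto intro: differentiable_add)
qed

text \<open>The Leibniz rule leaves one factor undifferentiated, so the induction hypothesis needs
  that factor at the lower order \<open>k\<close>. One proof covers scaling and inner
  products.\<close>

lemma (in bounded_bilinear) differentiable_of_order: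
  assumes "open S" "differentiable_of_order k S f" "differentiable_of_order k S g"
  shows "differentiable_of_order k S (\<lambda>x. prod (f x) (g x))"
  using assms(2,3)
proof (induction k arbitrary: f g)
  case 0
  then show ?case by (simp add: continuous_on)
next
  case (Suc k)
  have D: "((\<lambda>x. prod (f x) (g x)) has_derivative
       (\<lambda>v. prod (f x) (frechet_derivative g (at x) v) + prod (frechet_derivative f (at x) v) (g x))) (at x)"
    if "x \<in> S" for x
    using Suc.prems that by (intro FDERIV) (auto simp: frechet_derivative_works)
  have fg: "differentiable_of_order k S f" "differentiable_of_order k S g"
    using Suc.prems by (metis differentiable_of_order_SucD)+
  have "differentiable_of_order k S (\<lambda>x. frechet_derivative (\<lambda>x. prod (f x) (g x)) (at x) v)" for v
  proof (subst differentiable_of_order_cong[OF assms(1)])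
    show "frechet_derivative (\<lambda>x. prod (f x) (g x)) (at x) v =
      prod (f x) (frechet_derivative g (at x) v) + prod (frechet_derivative f (at x) v) (g x)"
      if "x \<in> S" for x
      using frechet_derivative_at[OF D[OF that]] by metis
    show "differentiable_of_order k S (\<lambda>x. prod (f x) (frechet_derivative g (at x) v)
        + prod (frechet_derivative f (at x) v) (g x))"
      using Suc.prems fg by (intro differentiable_of_order_add assms(1) Suc.IH) auto
  qed
  then show ?case
    using D by (auto simp: differentiable_def)
qed

lemma differentiable_of_order_sum:
  assumes "open S" "\<And>i. i \<in> I \<Longrightarrow> differentiable_of_order k S (f i)"
  shows "differentiable_of_order k S (\<lambda>x. \<Sum>i\<in>I. f i x)"
  using assms(2)
  by (induction I rule: infinite_finite_induct)
     (auto intro: differentiable_of_order_const differentiable_of_order_add assms(1))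

text \<open>Smoothness only speaks of derivatives in fixed directions. Wherever a direction depends
  on the point, this expansion reduces it to the basis directions.\<close>

lemma linear_eq_sum_Basis:
  fixes L :: "'a::euclidean_space \<Rightarrow> 'b::real_vector"
  assumes "linear L"
  shows "L v = (\<Sum>b\<in>Basis. (v \<bullet> b) *\<^sub>R L b)"
  by (metis (no_types, lifting) assms euclidean_representation linear_cmul linear_sum sum.cong)

text \<open>The chain rule replaces \<open>g\<close> by its derivatives in basis directions while
  \<open>f\<close> stays the inner map; hence the induction generalises over \<open>g\<close>
  only.\<close>

lemma differentiable_of_order_compose:
  fixes f :: "'a::real_normed_vector \<Rightarrow> 'b::euclidean_space" and g :: "'b \<Rightarrow> 'c::real_normed_vector"
  assumes "open S" "open T" "f ` S \<subseteq> T"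
    and "differentiable_of_order k S f" "differentiable_of_order k T g"
  shows "differentiable_of_order k S (\<lambda>x. g (f x))"
  using assms(4,5)
proof (induction k arbitrary: g)
  case 0
  then show ?case using continuous_on_compose2[OF _ _ assms(3)] by auto
next
  case (Suc k)
  have fd: "f differentiable at x" and gd: "g differentiable at (f x)" if "x \<in> S" for x
    using Suc.prems that assms(3) by auto
  have D: "((\<lambda>x. g (f x)) has_derivative
      (\<lambda>v. frechet_derivative g (at (f x)) (frechet_derivative f (at x) v))) (at x)" if "x \<in> S" for x
    using fd[OF that] gd[OF that] by (metis frechet_derivative_works has_derivative_compose)
  have f: "differentiable_of_order k S f"
    using Suc.prems by (metis differentiable_of_order_SucD)
  have "differentiable_of_order k S (\<lambda>x. frechet_derivative (\<lambda>x. g (f x)) (at x) v)" for v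
  proof (subst differentiable_of_order_cong[OF assms(1)])
    show "frechet_derivative (\<lambda>x. g (f x)) (at x) v = (\<Sum>b\<in>Basis.
        (frechet_derivative f (at x) v \<bullet> b) *\<^sub>R frechet_derivative g (at (f x)) b)" if "x \<in> S" for x
      using frechet_derivative_at[OF D[OF that]]
        linear_eq_sum_Basis[OF linear_frechet_derivative[OF gd[OF that]]] by metis
    show "differentiable_of_order k S (\<lambda>x. \<Sum>b\<in>Basis.
        (frechet_derivative f (at x) v \<bullet> b) *\<^sub>R frechet_derivative g (at (f x)) b)"
      using Suc.prems f
      by (intro differentiable_of_order_sum assms(1)
          bounded_bilinear.differentiable_of_order[OF bounded_bilinear_scaleR]
          bounded_bilinear.differentiable_of_order[OF bounded_bilinear_inner] Suc.IH)
        (auto simp: differentiable_of_order_const)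
  qed
  then show ?case
    using D by (auto simp: differentiable_def)
qed

lemma smooth_on_imp_differentiable: "smooth_on S f \<Longrightarrow> x \<in> S \<Longrightarrow> f differentiable (at x)"
  unfolding smooth_on_def by (metis differentiable_of_order.simps(2))

lemma smooth_on_imp_continuous_on: "smooth_on S f \<Longrightarrow> continuous_on S f"
  unfolding smooth_on_def by (metis differentiable_of_order.simps(1))

lemma smooth_on_imp_has_derivative:
  "smooth_on S f \<Longrightarrow> x \<in> S \<Longrightarrow> (f has_derivative frechet_derivative f (at x)) (at x)"
  using smooth_on_imp_differentiable frechet_derivative_works by blast

lemma smooth_on_directional_derivative:
  "smooth_on S f \<Longrightarrow> smooth_on S (\<lambda>x. frechet_derivative f (at x) v)"
  unfolding smooth_on_def by (metis differentiable_of_order.simps(2))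

lemma smooth_on_cong:
  "open S \<Longrightarrow> (\<And>x. x \<in> S \<Longrightarrow> f x = g x) \<Longrightarrow> smooth_on S f \<longleftrightarrow> smooth_on S g"
  unfolding smooth_on_def using differentiable_of_order_cong by blast

lemma smooth_on_transform:
  "open S \<Longrightarrow> smooth_on S f \<Longrightarrow> (\<And>x. x \<in> S \<Longrightarrow> f x = g x) \<Longrightarrow> smooth_on S g"
  using smooth_on_cong[of S f g] by simp

lemma smooth_on_subset: "smooth_on S f \<Longrightarrow> T \<subseteq> S \<Longrightarrow> smooth_on T f"
  unfolding smooth_on_def using differentiable_of_order_subset by blast

lemma smooth_on_local:
  "(\<And>x. x \<in> S \<Longrightarrow> \<exists>T. open T \<and> x \<in> T \<and> smooth_on T f) \<Longrightarrow> smooth_on S f"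
  unfolding smooth_on_def using differentiable_of_order_local by meson

lemma smooth_on_const [intro]: "smooth_on S (\<lambda>x. c)"
  unfolding smooth_on_def by (simp add: differentiable_of_order_const)

lemma smooth_on_add:
  "open S \<Longrightarrow> smooth_on S f \<Longrightarrow> smooth_on S g \<Longrightarrow> smooth_on S (\<lambda>x. f x + g x)"
  unfolding smooth_on_def by (auto intro: differentiable_of_order_add)

lemma smooth_on_scaleR:
  "open S \<Longrightarrow> smooth_on S f \<Longrightarrow> smooth_on S g \<Longrightarrow> smooth_on S (\<lambda>x. f x *\<^sub>R g x)"
  unfolding smooth_on_def
  by (auto intro: bounded_bilinear.differentiable_of_order[OF bounded_bilinear_scaleR])

lemma smooth_on_mult:
  fixes f g :: "'a::real_normed_vector \<Rightarrow> real"
  shows "open S \<Longrightarrow> smooth_on S f \<Longrightarrow> smooth_on S g \<Longrightarrow> smooth_on S (\<lambda>x. f x * g x)"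
  using smooth_on_scaleR[of S f g] by simp

lemma smooth_on_inner:
  "open S \<Longrightarrow> smooth_on S f \<Longrightarrow> smooth_on S g \<Longrightarrow> smooth_on S (\<lambda>x. f x \<bullet> g x)"
  unfolding smooth_on_def
  by (auto intro: bounded_bilinear.differentiable_of_order[OF bounded_bilinear_inner])

lemma smooth_on_sum:
  "open S \<Longrightarrow> (\<And>i. i \<in> I \<Longrightarrow> smooth_on S (f i)) \<Longrightarrow> smooth_on S (\<lambda>x. \<Sum>i\<in>I. f i x)"
  unfolding smooth_on_def by (auto intro: differentiable_of_order_sum)

lemma smooth_on_compose:
  fixes f :: "'a::real_normed_vector \<Rightarrow> 'b::euclidean_space" and g :: "'b \<Rightarrow> 'c::real_normed_vector"
  assumes "open S" "open T" "f ` S \<subseteq> T" "smooth_on S f" "smooth_on T g"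
  shows "smooth_on S (\<lambda>x. g (f x))"
  using assms unfolding smooth_on_def by (auto intro: differentiable_of_order_compose)

section \<open>Linear and bilinear maps depending smoothly on a point\<close>

lemma smooth_on_bilinear_family:
  fixes G :: "'a::real_normed_vector \<Rightarrow> 'e::euclidean_space \<Rightarrow> 'e \<Rightarrow> real"
  assumes "open S" "\<And>x. x \<in> S \<Longrightarrow> bilinear (G x)"
    and "\<And>a b. smooth_on S (\<lambda>x. G x a b)" "smooth_on S u" "smooth_on S v"
  shows "smooth_on S (\<lambda>x. G x (u x) (v x))"
proof (subst smooth_on_cong[OF assms(1)])
  show "G x (u x) (v x) = (\<Sum>a\<in>Basis. \<Sum>b\<in>Basis. (u x \<bullet> a) * (v x \<bullet> b) * G x a b)" if "x \<in> S" for x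
  proof -
    have l: "linear (\<lambda>a. G x a w)" "linear (G x w)" for w
      using assms(2)[OF that] by (auto simp: bilinear_def)
    have "G x (u x) (v x) = (\<Sum>a\<in>Basis. (u x \<bullet> a) *\<^sub>R G x a (v x))"
      using linear_eq_sum_Basis[OF l(1)] .
    also have "\<dots> = (\<Sum>a\<in>Basis. (u x \<bullet> a) *\<^sub>R (\<Sum>b\<in>Basis. (v x \<bullet> b) *\<^sub>R G x a b))"
      by (subst linear_eq_sum_Basis[OF l(2)]) simp
    finally show ?thesis by (simp add: sum_distrib_left mult.assoc)
  qed
  show "smooth_on S (\<lambda>x. \<Sum>a\<in>Basis. \<Sum>b\<in>Basis. (u x \<bullet> a) * (v x \<bullet> b) * G x a b)"
    using assms by (intro smooth_on_sum smooth_on_mult smooth_on_inner) auto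
qed

lemma smooth_on_linear_family:
  fixes L :: "'a::real_normed_vector \<Rightarrow> 'e::euclidean_space \<Rightarrow> 'b::real_normed_vector"
  assumes "open S" "\<And>x. x \<in> S \<Longrightarrow> linear (L x)" "\<And>a. smooth_on S (\<lambda>x. L x a)" "smooth_on S u"
  shows "smooth_on S (\<lambda>x. L x (u x))"
proof (subst smooth_on_cong[OF assms(1)])
  show "L x (u x) = (\<Sum>a\<in>Basis. (u x \<bullet> a) *\<^sub>R L x a)" if "x \<in> S" for x
    using linear_eq_sum_Basis[OF assms(2)[OF that]] .
  show "smooth_on S (\<lambda>x. \<Sum>a\<in>Basis. (u x \<bullet> a) *\<^sub>R L x a)"
    using assms by (intro smooth_on_sum smooth_on_scaleR smooth_on_inner) auto
qed

lemma smooth_on_frechet_derivative: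
  fixes f :: "'a::euclidean_space \<Rightarrow> 'b::real_normed_vector"
  assumes "open S" "smooth_on S f" "smooth_on S u"
  shows "smooth_on S (\<lambda>x. frechet_derivative f (at x) (u x))"
proof (rule smooth_on_linear_family[OF assms(1) _ _ assms(3)])
  show "linear (frechet_derivative f (at x))" if "x \<in> S" for x
    using smooth_on_imp_differentiable[OF assms(2) that] by (rule linear_frechet_derivative)
  show "smooth_on S (\<lambda>x. frechet_derivative f (at x) a)" for a
    using assms(2) by (rule smooth_on_directional_derivative)
qed

text \<open>A product rule in which the operator is known to be differentiable only on each fixed
  vector; expanding \<open>u\<close> in the basis makes that enough. Derivatives are taken within
  \<open>T\<close>, so that curves on closed intervals are covered.\<close>

lemma has_derivative_linear_family:
  fixes L :: "'a::real_normed_vector \<Rightarrow> 'e::euclidean_space \<Rightarrow> 'b::real_normed_vector"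
  assumes "open S" "\<And>x. x \<in> S \<Longrightarrow> linear (L x)"
    and "\<And>a. ((\<lambda>x. L x a) has_derivative L' a) (at (\<phi> t))"
    and "(\<phi> has_derivative \<phi>') (at t within T)" "(u has_derivative u') (at t within T)"
    and "\<phi> t \<in> S" "t \<in> T"
  shows "((\<lambda>s. L (\<phi> s) (u s)) has_derivative (\<lambda>h. L' (u t) (\<phi>' h) + L (\<phi> t) (u' h))) (at t within T)"
proof -
  have "((\<lambda>s. \<Sum>b\<in>Basis. (u s \<bullet> b) *\<^sub>R L (\<phi> s) b) has_derivative
      (\<lambda>h. \<Sum>b\<in>Basis. (u t \<bullet> b) *\<^sub>R L' b (\<phi>' h) + (u' h \<bullet> b) *\<^sub>R L (\<phi> t) b)) (at t within T)"
    by (intro has_derivative_sum has_derivative_scaleR has_derivative_inner_left assms(5)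
        has_derivative_compose[OF assms(4) assms(3)])
  moreover have "(\<lambda>h. \<Sum>b\<in>Basis. (u t \<bullet> b) *\<^sub>R L' b (\<phi>' h) + (u' h \<bullet> b) *\<^sub>R L (\<phi> t) b)
      = (\<lambda>h. L' (u t) (\<phi>' h) + L (\<phi> t) (u' h))"
  proof
    fix h
    \<comment> \<open>Nothing is assumed about the dependence of \<open>L' a\<close> on
      \<open>a\<close>; the expansion of \<open>L' (u t)\<close> in the basis follows from
      uniqueness of derivatives.\<close>
    have "((\<lambda>x. \<Sum>b\<in>Basis. (u t \<bullet> b) *\<^sub>R L x b) has_derivative
        (\<lambda>k. \<Sum>b\<in>Basis. (u t \<bullet> b) *\<^sub>R L' b k)) (at (\<phi> t))"
      by (intro has_derivative_sum has_derivative_scaleR_right assms(3))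
    then have "((\<lambda>x. L x (u t)) has_derivative (\<lambda>k. \<Sum>b\<in>Basis. (u t \<bullet> b) *\<^sub>R L' b k)) (at (\<phi> t))"
      by (rule has_derivative_transform_within_open[OF _ assms(1,6)])
        (simp add: linear_eq_sum_Basis[OF assms(2), symmetric])
    then have "L' (u t) = (\<lambda>k. \<Sum>b\<in>Basis. (u t \<bullet> b) *\<^sub>R L' b k)"
      using assms(3) has_derivative_unique by blast
    then show "(\<Sum>b\<in>Basis. (u t \<bullet> b) *\<^sub>R L' b (\<phi>' h) + (u' h \<bullet> b) *\<^sub>R L (\<phi> t) b)
      = L' (u t) (\<phi>' h) + L (\<phi> t) (u' h)"
      using linear_eq_sum_Basis[OF assms(2)[OF assms(6)], of "u' h"]
      by (simp add: sum.distrib)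
  qed
  ultimately have D: "((\<lambda>s. \<Sum>b\<in>Basis. (u s \<bullet> b) *\<^sub>R L (\<phi> s) b) has_derivative
      (\<lambda>h. L' (u t) (\<phi>' h) + L (\<phi> t) (u' h))) (at t within T)" by simp
  \<comment> \<open>The expansion is valid only where \<open>L\<close> is linear, and
    \<open>\<phi> s \<in> S\<close> is guaranteed only near \<open>t\<close>.\<close>
  have "(\<phi> \<longlongrightarrow> \<phi> t) (at t within T)"
    using has_derivative_continuous[OF assms(4)] by (simp add: continuous_within)
  then have "eventually (\<lambda>s. \<phi> s \<in> S) (at t within T)"
    using assms(1,6) by (rule topological_tendstoD)
  then have "eventually (\<lambda>s. (\<Sum>b\<in>Basis. (u s \<bullet> b) *\<^sub>R L (\<phi> s) b) = L (\<phi> s) (u s)) (at t within T)"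
    by (rule eventually_mono) (simp add: linear_eq_sum_Basis[OF assms(2), symmetric])
  then show ?thesis
    by (rule has_derivative_transform_eventually[OF D])
      (simp_all add: linear_eq_sum_Basis[OF assms(2)[OF assms(6)], symmetric] assms(7))
qed

lemma has_derivative_bilinear_family:
  fixes G :: "'a::real_normed_vector \<Rightarrow> 'e::euclidean_space \<Rightarrow> 'e \<Rightarrow> real"
  assumes "open S" "\<And>x. x \<in> S \<Longrightarrow> bilinear (G x)"
    and "\<And>a b. ((\<lambda>x. G x a b) has_derivative G' a b) (at (\<phi> t))"
    and "(\<phi> has_derivative \<phi>') (at t within T)" "(u has_derivative u') (at t within T)"
    and "(v has_derivative v') (at t within T)" "\<phi> t \<in> S" "t \<in> T"
  shows "((\<lambda>s. G (\<phi> s) (u s) (v s)) has_derivative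
     (\<lambda>h. G' (u t) (v t) (\<phi>' h) + G (\<phi> t) (u' h) (v t) + G (\<phi> t) (u t) (v' h))) (at t within T)"
proof -
  have l: "linear (\<lambda>a. G x a w)" "linear (G x w)" if "x \<in> S" for x w
    using assms(2)[OF that] by (auto simp: bilinear_def)
  \<comment> \<open>Freezing the basis vector in the first slot reduces this to the linear case twice.\<close>
  have D: "((\<lambda>s. G (\<phi> s) a (v s)) has_derivative (\<lambda>h. G' a (v t) (\<phi>' h) + G (\<phi> t) a (v' h))) (at t within T)" for a
    by (rule has_derivative_linear_family[OF assms(1), where L = "\<lambda>x. G x a"])
       (use l assms in auto)
  have "((\<lambda>s. \<Sum>a\<in>Basis. (u s \<bullet> a) *\<^sub>R G (\<phi> s) a (v s)) has_derivative
      (\<lambda>h. \<Sum>a\<in>Basis. (u t \<bullet> a) *\<^sub>R (G' a (v t) (\<phi>' h) + G (\<phi> t) a (v' h))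
          + (u' h \<bullet> a) *\<^sub>R G (\<phi> t) a (v t))) (at t within T)"
    by (intro has_derivative_sum has_derivative_scaleR has_derivative_inner_left assms(5) D)
  moreover have "(\<lambda>h. \<Sum>a\<in>Basis. (u t \<bullet> a) *\<^sub>R (G' a (v t) (\<phi>' h) + G (\<phi> t) a (v' h))
          + (u' h \<bullet> a) *\<^sub>R G (\<phi> t) a (v t))
     = (\<lambda>h. G' (u t) (v t) (\<phi>' h) + G (\<phi> t) (u' h) (v t) + G (\<phi> t) (u t) (v' h))"
  proof
    fix h
    have "((\<lambda>x. \<Sum>b\<in>Basis. (u t \<bullet> b) *\<^sub>R G x b (v t)) has_derivative
        (\<lambda>k. \<Sum>b\<in>Basis. (u t \<bullet> b) *\<^sub>R G' b (v t) k)) (at (\<phi> t))"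
      by (intro has_derivative_sum has_derivative_scaleR_right assms(3))
    then have "((\<lambda>x. G x (u t) (v t)) has_derivative (\<lambda>k. \<Sum>b\<in>Basis. (u t \<bullet> b) *\<^sub>R G' b (v t) k)) (at (\<phi> t))"
      by (rule has_derivative_transform_within_open[OF _ assms(1,7)])
        (simp add: linear_eq_sum_Basis[OF l(1), symmetric] del: real_scaleR_def)
    then have "G' (u t) (v t) = (\<lambda>k. \<Sum>b\<in>Basis. (u t \<bullet> b) *\<^sub>R G' b (v t) k)"
      using assms(3) has_derivative_unique by blast
    then show "(\<Sum>a\<in>Basis. (u t \<bullet> a) *\<^sub>R (G' a (v t) (\<phi>' h) + G (\<phi> t) a (v' h))
          + (u' h \<bullet> a) *\<^sub>R G (\<phi> t) a (v t))
      = G' (u t) (v t) (\<phi>' h) + G (\<phi> t) (u' h) (v t) + G (\<phi> t) (u t) (v' h)"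
      using linear_eq_sum_Basis[OF l(1)[OF assms(7)], of "u' h" "v t"]
        linear_eq_sum_Basis[OF l(1)[OF assms(7)], of "u t" "v' h"]
      by (simp add: sum.distrib distrib_left)
  qed
  ultimately have D: "((\<lambda>s. \<Sum>a\<in>Basis. (u s \<bullet> a) *\<^sub>R G (\<phi> s) a (v s)) has_derivative
      (\<lambda>h. G' (u t) (v t) (\<phi>' h) + G (\<phi> t) (u' h) (v t) + G (\<phi> t) (u t) (v' h))) (at t within T)"
    by simp
  have "(\<phi> \<longlongrightarrow> \<phi> t) (at t within T)"
    using has_derivative_continuous[OF assms(4)] by (simp add: continuous_within)
  then have "eventually (\<lambda>s. \<phi> s \<in> S) (at t within T)"
    using assms(1,7) by (rule topological_tendstoD)
  then have "eventually (\<lambda>s. (\<Sum>a\<in>Basis. (u s \<bullet> a) *\<^sub>R G (\<phi> s) a (v s)) = G (\<phi> s) (u s) (v s)) (at t within T)"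
    by (rule eventually_mono) (simp add: linear_eq_sum_Basis[OF l(1), symmetric] del: real_scaleR_def)
  then show ?thesis
    by (rule has_derivative_transform_eventually[OF D])
      (simp_all add: linear_eq_sum_Basis[OF l(1)[OF assms(7)], symmetric] assms(8) del: real_scaleR_def)
qed

section \<open>Linear systems with smooth coefficients\<close>

lemma injective_linear_lower_bound:
  fixes A :: "'e::euclidean_space \<Rightarrow> 'e"
  assumes "linear A" "\<And>u. A u = 0 \<Longrightarrow> u = 0"
  shows "\<exists>m>0. \<forall>u. m * norm u \<le> norm (A u)"
  using linear_inj_bounded_below_pos[OF assms(1)] linear_injective_0[OF assms(1)] assms(2) by metis

text \<open>Injectivity gives \<open>A x0\<close> a lower bound \<open>m\<close>. Near
  \<open>x0\<close> the perturbation of \<open>A\<close> is below \<open>m / 2\<close>, so the term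
  containing the unknown \<open>y x - y x0\<close> is absorbed by the left-hand side; this is the
  origin of the factor \<open>2 / m\<close>.\<close>

lemma linear_system_solution_continuous:
  fixes A :: "'a::euclidean_space \<Rightarrow> 'e::euclidean_space \<Rightarrow> 'e"
  assumes S: "open S" and lin: "\<And>x. x \<in> S \<Longrightarrow> linear (A x)"
    and inj: "\<And>x u. x \<in> S \<Longrightarrow> A x u = 0 \<Longrightarrow> u = 0"
    and cA: "\<And>u. continuous_on S (\<lambda>x. A x u)" and cb: "continuous_on S b"
    and eq: "\<And>x. x \<in> S \<Longrightarrow> A x (y x) = b x" and x0: "x0 \<in> S"
  shows "isCont y x0"
proof -
  obtain m where m: "m > 0" "\<And>u. m * norm u \<le> norm (A x0 u)"
    using injective_linear_lower_bound[OF lin[OF x0] inj[OF x0]] by blast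
  \<comment> \<open>Dominates the operator norm of \<open>A x - A x0\<close>, and tends to 0 because
    it is a finite sum over the basis.\<close>
  define \<epsilon> where "\<epsilon> x = (\<Sum>i\<in>Basis. norm (A x i - A x0 i))" for x
  have tA: "((\<lambda>x. A x u) \<longlongrightarrow> A x0 u) (at x0)" for u
    using cA S x0 by (metis continuous_on_eq_continuous_at isContD)
  have tb: "(b \<longlongrightarrow> b x0) (at x0)"
    using cb S x0 by (metis continuous_on_eq_continuous_at isContD)
  have "(\<epsilon> \<longlongrightarrow> (\<Sum>i\<in>Basis. norm (A x0 i - A x0 i))) (at x0)"
    unfolding \<epsilon>_def by (intro tendsto_sum tendsto_norm tendsto_diff tA tendsto_const)
  then have te: "(\<epsilon> \<longlongrightarrow> 0) (at x0)" by simp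
  have e: "norm (A x u - A x0 u) \<le> \<epsilon> x * norm u" if "x \<in> S" for x u
  proof -
    have "linear (\<lambda>u. A x u - A x0 u)"
      using lin that x0 by (intro linear_compose_sub) auto
    then have "A x u - A x0 u = (\<Sum>i\<in>Basis. (u \<bullet> i) *\<^sub>R (A x i - A x0 i))"
      using linear_eq_sum_Basis by blast
    also have "norm \<dots> \<le> (\<Sum>i\<in>Basis. norm u * norm (A x i - A x0 i))"
      by (intro sum_norm_le) (simp add: Basis_le_norm mult_right_mono)
    finally show ?thesis by (simp add: \<epsilon>_def sum_distrib_left mult.commute)
  qed
  have evS: "eventually (\<lambda>x. x \<in> S) (at x0)"
    using S x0 by (rule eventually_at_in_open')
  have eve: "eventually (\<lambda>x. \<epsilon> x < m / 2) (at x0)"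
    using te m by (intro order_tendstoD(2)) auto
  have bound: "eventually (\<lambda>x. norm (y x - y x0) \<le>
      (norm (b x - b x0) + \<epsilon> x * norm (y x0)) * (2 / m)) (at x0)"
    using evS eve
  proof eventually_elim
    case (elim x)
    have l: "linear (A x)" "linear (A x0)" using lin elim x0 by auto
    have "A x0 (y x - y x0) = (b x - b x0) - (A x (y x - y x0) - A x0 (y x - y x0))
        - (A x (y x0) - A x0 (y x0))"
      using eq elim x0 by (simp add: linear_diff[OF l(1)] linear_diff[OF l(2)])
    then have "norm (A x0 (y x - y x0)) \<le> norm (b x - b x0)
        + norm (A x (y x - y x0) - A x0 (y x - y x0)) + norm (A x (y x0) - A x0 (y x0))"
      using order_trans[OF norm_triangle_ineq4 add_right_mono[OF norm_triangle_ineq4]] by metis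
    also have "\<dots> \<le> norm (b x - b x0) + (m / 2) * norm (y x - y x0) + \<epsilon> x * norm (y x0)"
      using order_trans[OF e mult_right_mono[of "\<epsilon> x" "m / 2" "norm (y x - y x0)"]] e elim
      by (intro add_mono) auto
    finally have "m * norm (y x - y x0) \<le>
        norm (b x - b x0) + (m / 2) * norm (y x - y x0) + \<epsilon> x * norm (y x0)"
      using m(2) order_trans by blast
    then show ?case using m(1) by (simp add: field_simps)
  qed
  have "((\<lambda>x. (norm (b x - b x0) + \<epsilon> x * norm (y x0)) * (2 / m)) \<longlongrightarrow>
     (norm (b x0 - b x0) + 0 * norm (y x0)) * (2 / m)) (at x0)"
    by (intro tendsto_mult tendsto_add tendsto_norm tendsto_diff tb te tendsto_const)
  then have "((\<lambda>x. (norm (b x - b x0) + \<epsilon> x * norm (y x0)) * (2 / m)) \<longlongrightarrow> 0) (at x0)"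
    by simp
  then have "((\<lambda>x. y x - y x0) \<longlongrightarrow> 0) (at x0)"
    using bound by (rule Lim_null_comparison[rotated])
  then show ?thesis by (simp add: isCont_def LIM_zero_iff)
qed

text \<open>Because \<open>f\<close> vanishes at \<open>x0\<close>, the product needs only
  continuity of \<open>c\<close> there. This breaks a circularity: \<open>c\<close> will be a
  coordinate of a solution whose differentiability is still in question.\<close>

lemma has_derivative_scaleR_continuous:
  fixes f :: "'a::real_normed_vector \<Rightarrow> 'b::real_normed_vector" and c :: "'a \<Rightarrow> real"
  assumes "(f has_derivative f') (at x0)" "f x0 = 0" "isCont c x0"
  shows "((\<lambda>x. c x *\<^sub>R f x) has_derivative (\<lambda>h. c x0 *\<^sub>R f' h)) (at x0)"
proof -
  have bl: "bounded_linear f'" using assms(1) by (rule has_derivative_bounded_linear)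
  obtain K where K: "K > 0" "\<And>h. norm (f' h) \<le> norm h * K"
    using bounded_linear.pos_bounded[OF bl] by blast
  define q where "q h = norm (f (x0 + h) - f x0 - f' h) / norm h" for h
  have q: "(q \<longlongrightarrow> 0) (at 0)"
    using assms(1) unfolding has_derivative_at q_def by blast
  have c: "((\<lambda>h. c (x0 + h)) \<longlongrightarrow> c x0) (at 0)"
    using assms(3) by (simp add: isCont_iff)
  have "((\<lambda>h. \<bar>c (x0 + h)\<bar> * q h + \<bar>c (x0 + h) - c x0\<bar> * K) \<longlongrightarrow> \<bar>c x0\<bar> * 0 + \<bar>c x0 - c x0\<bar> * K) (at 0)"
    by (intro tendsto_intros c q)
  then have t: "((\<lambda>h. \<bar>c (x0 + h)\<bar> * q h + \<bar>c (x0 + h) - c x0\<bar> * K) \<longlongrightarrow> 0) (at 0)"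
    by simp
  have "norm (norm (c (x0 + h) *\<^sub>R f (x0 + h) - c x0 *\<^sub>R f x0 - c x0 *\<^sub>R f' h) / norm h)
      \<le> \<bar>c (x0 + h)\<bar> * q h + \<bar>c (x0 + h) - c x0\<bar> * K" if "h \<noteq> 0" for h
  proof -
    have "c (x0 + h) *\<^sub>R f (x0 + h) - c x0 *\<^sub>R f x0 - c x0 *\<^sub>R f' h
        = c (x0 + h) *\<^sub>R (f (x0 + h) - f x0 - f' h) + (c (x0 + h) - c x0) *\<^sub>R f' h"
      using assms(2) by (simp add: algebra_simps)
    also have "norm \<dots> \<le> \<bar>c (x0 + h)\<bar> * norm (f (x0 + h) - f x0 - f' h)
        + \<bar>c (x0 + h) - c x0\<bar> * (norm h * K)"
      by (intro norm_triangle_le add_mono) (auto intro: mult_left_mono K)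
    finally show ?thesis
      using that by (simp add: q_def divide_simps) (simp add: algebra_simps)
  qed
  then have "eventually (\<lambda>h. norm (norm (c (x0 + h) *\<^sub>R f (x0 + h) - c x0 *\<^sub>R f x0 - c x0 *\<^sub>R f' h) / norm h)
      \<le> \<bar>c (x0 + h)\<bar> * q h + \<bar>c (x0 + h) - c x0\<bar> * K) (at 0)"
    by (simp add: eventually_at_filter)
  then have "((\<lambda>h. norm (c (x0 + h) *\<^sub>R f (x0 + h) - c x0 *\<^sub>R f x0 - c x0 *\<^sub>R f' h) / norm h) \<longlongrightarrow> 0) (at 0)"
    using t by (rule Lim_null_comparison)
  then show ?thesis
    using bl by (auto simp: has_derivative_at intro: bounded_linear_const_scaleR)
qed

lemma linear_system_solution_derivative:
  fixes A :: "'a::euclidean_space \<Rightarrow> 'e::euclidean_space \<Rightarrow> 'e"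
  assumes S: "open S" and lin: "\<And>x. x \<in> S \<Longrightarrow> linear (A x)"
    and inj: "\<And>x u. x \<in> S \<Longrightarrow> A x u = 0 \<Longrightarrow> u = 0"
    and dA: "\<And>x u. x \<in> S \<Longrightarrow> (\<lambda>x. A x u) differentiable (at x)"
    and db: "\<And>x. x \<in> S \<Longrightarrow> b differentiable (at x)"
    and eq: "\<And>x. x \<in> S \<Longrightarrow> A x (y x) = b x" and x0: "x0 \<in> S"
  shows "y differentiable (at x0)"
    and "A x0 (frechet_derivative y (at x0) v) = frechet_derivative b (at x0) v
           - (\<Sum>i\<in>Basis. (y x0 \<bullet> i) *\<^sub>R frechet_derivative (\<lambda>x. A x i) (at x0) v)"
proof -
  let ?A' = "\<lambda>i. frechet_derivative (\<lambda>x. A x i) (at x0)" and ?b' = "frechet_derivative b (at x0)"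
  have y: "isCont y x0"
    using S lin inj _ _ eq x0
    by (rule linear_system_solution_continuous)
       (use dA db in \<open>auto intro!: continuous_at_imp_continuous_on differentiable_imp_continuous_within\<close>)
  have "inj (A x0)" using linear_injective_0[OF lin[OF x0]] inj[OF x0] by blast
  then obtain R where R: "linear R" "\<And>u. R (A x0 u) = u" "\<And>u. A x0 (R u) = u"
    using linear_injective_isomorphism[OF lin[OF x0]] by blast
  define z where "z x = R (b x - (\<Sum>i\<in>Basis. (y x \<bullet> i) *\<^sub>R (A x i - A x0 i)))" for x
  have yz: "z x = y x" if "x \<in> S" for x
  proof -
    have "linear (\<lambda>u. A x u - A x0 u)"
      using lin that x0 by (intro linear_compose_sub) auto
    then have "(\<Sum>i\<in>Basis. (y x \<bullet> i) *\<^sub>R (A x i - A x0 i)) = A x (y x) - A x0 (y x)"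
      using linear_eq_sum_Basis by metis
    then show ?thesis using R eq[OF that] by (simp add: z_def)
  qed
  have dAi: "((\<lambda>x. A x i - A x0 i) has_derivative ?A' i) (at x0)" for i
    using has_derivative_diff[OF dA[OF x0, unfolded frechet_derivative_works] has_derivative_const]
    by simp
  have "(z has_derivative (\<lambda>h. R (?b' h - (\<Sum>i\<in>Basis. (y x0 \<bullet> i) *\<^sub>R ?A' i h)))) (at x0)"
    unfolding z_def using db[OF x0] y
    by (intro bounded_linear.has_derivative[of R] has_derivative_diff has_derivative_sum
        has_derivative_scaleR_continuous[OF dAi])
       (auto simp: frechet_derivative_works intro: linear_conv_bounded_linear[THEN iffD1] R(1))
  then have D: "(y has_derivative (\<lambda>h. R (?b' h - (\<Sum>i\<in>Basis. (y x0 \<bullet> i) *\<^sub>R ?A' i h)))) (at x0)"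
    by (rule has_derivative_transform_within_open[OF _ S x0]) (rule yz)
  then show "y differentiable (at x0)" by (auto simp: differentiable_def)
  show "A x0 (frechet_derivative y (at x0) v) = ?b' v - (\<Sum>i\<in>Basis. (y x0 \<bullet> i) *\<^sub>R ?A' i v)"
    using R(3) by (simp flip: frechet_derivative_at[OF D])
qed

text \<open>Differentiating the system gives the same operator \<open>A\<close> applied to the
  derivative of \<open>y\<close>, with a right-hand side in which \<open>y\<close> occurs
  undifferentiated. Hence the induction runs over all \<open>y\<close> and \<open>b\<close> and
  gains one order per step.\<close>

lemma smooth_on_linear_system_solution:
  fixes A :: "'a::euclidean_space \<Rightarrow> 'e::euclidean_space \<Rightarrow> 'e"
  assumes S: "open S" and lin: "\<And>x. x \<in> S \<Longrightarrow> linear (A x)"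
    and inj: "\<And>x u. x \<in> S \<Longrightarrow> A x u = 0 \<Longrightarrow> u = 0"
    and A: "\<And>u. smooth_on S (\<lambda>x. A x u)" and b: "smooth_on S b"
    and eq: "\<And>x. x \<in> S \<Longrightarrow> A x (y x) = b x"
  shows "smooth_on S y"
proof -
  have "differentiable_of_order k S y" if "differentiable_of_order k S b"
    "\<And>x. x \<in> S \<Longrightarrow> A x (y x) = b x" for k y b
    using that
  proof (induction k arbitrary: y b)
    case 0
    have b: "continuous_on S b" using 0 by simp
    have "continuous (at x) y" if "x \<in> S" for x
      by (rule linear_system_solution_continuous[where A = A and S = S and b = b])
         (use S lin inj smooth_on_imp_continuous_on[OF A] b 0 that in blast)+
    then show ?case by (simp add: continuous_at_imp_continuous_on)
  next
    case (Suc k)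
    have db: "b differentiable (at x)" if "x \<in> S" for x using Suc.prems that by simp
    note * = S lin inj smooth_on_imp_differentiable[OF A] db Suc.prems(2)
    have y: "differentiable_of_order k S y"
      using Suc.IH[of b y] Suc.prems differentiable_of_order_SucD by blast
    have "differentiable_of_order k S (\<lambda>x. frechet_derivative y (at x) v)" for v
    proof (rule Suc.IH)
      show "A x (frechet_derivative y (at x) v) = frechet_derivative b (at x) v
           + (\<Sum>i\<in>Basis. (-1) *\<^sub>R ((y x \<bullet> i) *\<^sub>R frechet_derivative (\<lambda>x. A x i) (at x) v))"
        if "x \<in> S" for x
        using linear_system_solution_derivative(2)[OF * that] by (simp add: sum_negf)
      have "differentiable_of_order k S (\<lambda>x. frechet_derivative (\<lambda>x. A x i) (at x) v)" for i
        using smooth_on_directional_derivative[OF A] by (simp add: smooth_on_def)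
      then show "differentiable_of_order k S (\<lambda>x. frechet_derivative b (at x) v
           + (\<Sum>i\<in>Basis. (-1) *\<^sub>R ((y x \<bullet> i) *\<^sub>R frechet_derivative (\<lambda>x. A x i) (at x) v)))"
        using Suc.prems(1) y
        by (intro differentiable_of_order_add differentiable_of_order_sum S
            bounded_bilinear.differentiable_of_order[OF bounded_bilinear_scaleR]
            bounded_bilinear.differentiable_of_order[OF bounded_bilinear_inner])
          (auto simp: differentiable_of_order_const)
    qed
    moreover have "y differentiable (at x)" if "x \<in> S" for x
      by (rule linear_system_solution_derivative(1)[where A = A and S = S and b = b])
         (use * that in blast)+
    ultimately show ?case by simp
  qed
  then show ?thesis using b eq unfolding smooth_on_def by blast
qed

section \<open>Symmetry of second derivatives\<close>

text \<open>The mean value theorem is used twice: in the direction \<open>u\<close> for the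
  difference of two translates of \<open>f\<close>, then in the direction \<open>v\<close> for the
  directional derivative that appears.\<close>

lemma second_difference_mean_value:
  fixes f :: "'a::real_normed_vector \<Rightarrow> real"
  assumes f: "smooth_on S f" and t: "t > 0"
    and sub: "\<And>a b. 0 \<le> a \<Longrightarrow> a \<le> t \<Longrightarrow> 0 \<le> b \<Longrightarrow> b \<le> t \<Longrightarrow> x + a *\<^sub>R u + b *\<^sub>R v \<in> S"
  shows "\<exists>a b. 0 < a \<and> a < t \<and> 0 < b \<and> b < t \<and>
    f (x + t *\<^sub>R u + t *\<^sub>R v) - f (x + t *\<^sub>R u) - (f (x + t *\<^sub>R v) - f x) =
    t * (t * frechet_derivative (\<lambda>y. frechet_derivative f (at y) u) (at (x + a *\<^sub>R u + b *\<^sub>R v)) v)"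
proof -
  let ?Du = "\<lambda>y. frechet_derivative f (at y) u"
  let ?D = "\<lambda>y. frechet_derivative ?Du (at y) v"
  have d1: "((\<lambda>a. f (x + a *\<^sub>R u + b *\<^sub>R v)) has_real_derivative ?Du (x + a *\<^sub>R u + b *\<^sub>R v)) (at a)"
    if "0 \<le> a" "a \<le> t" "0 \<le> b" "b \<le> t" for a b
  proof -
    have "((\<lambda>a. f (x + a *\<^sub>R u + b *\<^sub>R v)) has_derivative
       (\<lambda>h. frechet_derivative f (at (x + a *\<^sub>R u + b *\<^sub>R v)) (h *\<^sub>R u))) (at a)"
      by (rule has_derivative_compose[where g = f and f = "\<lambda>a. x + a *\<^sub>R u + b *\<^sub>R v",
            OF _ smooth_on_imp_has_derivative[OF f sub[OF that]]])
         (auto intro!: derivative_eq_intros)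
    then show ?thesis
      using linear_cmul[OF linear_frechet_derivative[OF smooth_on_imp_differentiable[OF f sub[OF that]]]]
      by (simp add: has_field_derivative_def mult_commute_abs)
  qed
  have d2: "((\<lambda>b. ?Du (x + a *\<^sub>R u + b *\<^sub>R v)) has_real_derivative ?D (x + a *\<^sub>R u + b *\<^sub>R v)) (at b)"
    if "0 \<le> a" "a \<le> t" "0 \<le> b" "b \<le> t" for a b
  proof -
    note fu = smooth_on_directional_derivative[OF f, of u]
    have "((\<lambda>b. ?Du (x + a *\<^sub>R u + b *\<^sub>R v)) has_derivative
       (\<lambda>h. frechet_derivative ?Du (at (x + a *\<^sub>R u + b *\<^sub>R v)) (h *\<^sub>R v))) (at b)"
      by (rule has_derivative_compose[where g = ?Du and f = "\<lambda>b. x + a *\<^sub>R u + b *\<^sub>R v",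
            OF _ smooth_on_imp_has_derivative[OF fu sub[OF that]]])
         (auto intro!: derivative_eq_intros)
    then show ?thesis
      using linear_cmul[OF linear_frechet_derivative[OF smooth_on_imp_differentiable[OF fu sub[OF that]]]]
      by (simp add: has_field_derivative_def mult_commute_abs)
  qed
  have "\<exists>a. 0 < a \<and> a < t \<and>
    (f (x + t *\<^sub>R u + t *\<^sub>R v) - f (x + t *\<^sub>R u + 0 *\<^sub>R v)) - (f (x + 0 *\<^sub>R u + t *\<^sub>R v) - f (x + 0 *\<^sub>R u + 0 *\<^sub>R v)) =
    (t - 0) * (?Du (x + a *\<^sub>R u + t *\<^sub>R v) - ?Du (x + a *\<^sub>R u + 0 *\<^sub>R v))"
    using t by (intro MVT2[of 0 t "\<lambda>a. f (x + a *\<^sub>R u + t *\<^sub>R v) - f (x + a *\<^sub>R u + 0 *\<^sub>R v)"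
        "\<lambda>a. ?Du (x + a *\<^sub>R u + t *\<^sub>R v) - ?Du (x + a *\<^sub>R u + 0 *\<^sub>R v)"] DERIV_diff d1) auto
  then obtain a where a: "0 < a" "a < t" and fa: "f (x + t *\<^sub>R u + t *\<^sub>R v) - f (x + t *\<^sub>R u) - (f (x + t *\<^sub>R v) - f x) =
    t * (?Du (x + a *\<^sub>R u + t *\<^sub>R v) - ?Du (x + a *\<^sub>R u))" by auto
  have "\<exists>b. 0 < b \<and> b < t \<and> ?Du (x + a *\<^sub>R u + t *\<^sub>R v) - ?Du (x + a *\<^sub>R u + 0 *\<^sub>R v)
    = (t - 0) * ?D (x + a *\<^sub>R u + b *\<^sub>R v)"
    using t a by (intro MVT2[of 0 t "\<lambda>b. ?Du (x + a *\<^sub>R u + b *\<^sub>R v)"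
        "\<lambda>b. ?D (x + a *\<^sub>R u + b *\<^sub>R v)"] d2) auto
  then show ?thesis using a fa by fastforce
qed

text \<open>The second difference does not change when \<open>u\<close> and \<open>v\<close> are
  exchanged. So each small square at \<open>x\<close> contains a point where one mixed derivative
  equals the other one at a second point of the square, and continuity concludes.\<close>

lemma smooth_on_second_derivative_symmetric_real:
  fixes f :: "'a::real_normed_vector \<Rightarrow> real"
  assumes S: "open S" and f: "smooth_on S f" and x: "x \<in> S"
  shows "frechet_derivative (\<lambda>y. frechet_derivative f (at y) u) (at x) v
       = frechet_derivative (\<lambda>y. frechet_derivative f (at y) v) (at x) u"
proof (rule ccontr)
  let ?D = "\<lambda>u v y. frechet_derivative (\<lambda>y. frechet_derivative f (at y) u) (at y) v"
  assume ne: "?D u v x \<noteq> ?D v u x"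
  \<comment> \<open>Half the gap: balls of this radius around the two values are disjoint.\<close>
  define e where "e = \<bar>?D u v x - ?D v u x\<bar> / 2"
  have e: "e > 0" using ne by (simp add: e_def)
  have "isCont (?D u v) x" for u v
    using smooth_on_imp_continuous_on[OF smooth_on_directional_derivative[OF smooth_on_directional_derivative[OF f]]] S x
    by (simp add: continuous_on_eq_continuous_at)
  then have ev: "eventually (\<lambda>y. dist (?D u v y) (?D u v x) < e) (nhds x)" for u v
    using e by (metis continuous_at_imp_continuous_at_within isCont_def tendstoD tendsto_at_iff_tendsto_nhds)
  obtain r where r: "r > 0"
    "\<And>y. dist y x < r \<Longrightarrow> dist (?D u v y) (?D u v x) < e"
    "\<And>y. dist y x < r \<Longrightarrow> dist (?D v u y) (?D v u x) < e" "\<And>y. dist y x < r \<Longrightarrow> y \<in> S"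
    using eventually_conj[OF ev[of u v] eventually_conj[OF ev[of v u] eventually_nhds_in_open[OF S x]]]
    by (auto simp: eventually_nhds_metric)
  \<comment> \<open>Keeps the whole square within distance \<open>r / 2\<close> of \<open>x\<close>;
    the summand 1 keeps the denominator positive when \<open>u\<close> and \<open>v\<close>
    vanish.\<close>
  define t where "t = r / (2 * (norm u + norm v + 1))"
  have t: "t > 0" using r by (simp add: t_def add_nonneg_pos)
  have near: "dist (x + a *\<^sub>R u + b *\<^sub>R v) x < r" if "0 \<le> a" "a \<le> t" "0 \<le> b" "b \<le> t" for a b
  proof -
    have "norm (a *\<^sub>R u + b *\<^sub>R v) \<le> t * norm u + t * norm v"
      using that by (intro norm_triangle_le add_mono) (auto intro: mult_right_mono)
    also have "\<dots> \<le> t * (norm u + norm v + 1)" using t by (simp add: algebra_simps)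
    also have "\<dots> = r / 2" using add_nonneg_pos[of "norm u + norm v" 1] by (simp add: t_def field_simps)
    finally show ?thesis using r(1) by (simp add: dist_norm add.assoc)
  qed
  obtain a b where ab: "0 < a" "a < t" "0 < b" "b < t"
    "f (x + t *\<^sub>R u + t *\<^sub>R v) - f (x + t *\<^sub>R u) - (f (x + t *\<^sub>R v) - f x) = t * (t * ?D u v (x + a *\<^sub>R u + b *\<^sub>R v))"
    using second_difference_mean_value[OF f t r(4)[OF near]] by blast
  have near': "dist (x + a *\<^sub>R v + b *\<^sub>R u) x < r" if "0 \<le> a" "a \<le> t" "0 \<le> b" "b \<le> t" for a b
    using near[OF that(3,4,1,2)] by (simp add: add_ac)
  obtain c d where cd: "0 < c" "c < t" "0 < d" "d < t"
    "f (x + t *\<^sub>R v + t *\<^sub>R u) - f (x + t *\<^sub>R v) - (f (x + t *\<^sub>R u) - f x) = t * (t * ?D v u (x + c *\<^sub>R v + d *\<^sub>R u))"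
    using second_difference_mean_value[OF f t r(4)[OF near']] by blast
  have "t * (t * ?D u v (x + a *\<^sub>R u + b *\<^sub>R v)) = t * (t * ?D v u (x + c *\<^sub>R v + d *\<^sub>R u))"
    using ab(5) cd(5) unfolding add.commute[of "t *\<^sub>R v" "t *\<^sub>R u"] add.assoc[of x] by linarith
  then have eq: "?D u v (x + a *\<^sub>R u + b *\<^sub>R v) = ?D v u (x + c *\<^sub>R v + d *\<^sub>R u)"
    using t by simp
  have "dist (?D u v (x + a *\<^sub>R u + b *\<^sub>R v)) (?D u v x) < e"
    using ab by (intro r(2) near) auto
  moreover have "dist (?D v u (x + c *\<^sub>R v + d *\<^sub>R u)) (?D v u x) < e"
    using cd by (intro r(3) near') auto
  ultimately show False
    unfolding eq dist_real_def e_def by argo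
qed

lemma smooth_on_second_derivative_symmetric:
  fixes f :: "'a::real_normed_vector \<Rightarrow> 'b::euclidean_space"
  assumes S: "open S" and f: "smooth_on S f" and x: "x \<in> S"
  shows "frechet_derivative (\<lambda>y. frechet_derivative f (at y) u) (at x) v
       = frechet_derivative (\<lambda>y. frechet_derivative f (at y) v) (at x) u"
proof (rule euclidean_eqI)
  fix b :: 'b assume "b \<in> Basis"
  have D: "frechet_derivative (\<lambda>y. g y \<bullet> b) (at y) w = frechet_derivative g (at y) w \<bullet> b"
    if "smooth_on S g" "y \<in> S" for g :: "'a \<Rightarrow> 'b" and y w
    using frechet_derivative_at[OF has_derivative_inner_left[OF smooth_on_imp_has_derivative[OF that]]]
    by metis
  have D2: "frechet_derivative (\<lambda>y. frechet_derivative (\<lambda>y. f y \<bullet> b) (at y) w) (at x) z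
      = frechet_derivative (\<lambda>y. frechet_derivative f (at y) w) (at x) z \<bullet> b" for w z
    using frechet_derivative_cong_open[OF S x D[OF f]]
      D[OF smooth_on_directional_derivative[OF f] x] by simp
  have "smooth_on S (\<lambda>y. f y \<bullet> b)" using S f by (intro smooth_on_inner) auto
  then show "frechet_derivative (\<lambda>y. frechet_derivative f (at y) u) (at x) v \<bullet> b
       = frechet_derivative (\<lambda>y. frechet_derivative f (at y) v) (at x) u \<bullet> b"
    using smooth_on_second_derivative_symmetric_real[OF S _ x] by (simp flip: D2)
qed

section \<open>Orthogonal projection for an arbitrary inner product\<close>

text \<open>One Gram-Schmidt step per vector of \<open>B\<close>: the new vector is made orthogonal
  to the old span, then the projection onto it is added.\<close>

lemma orthogonal_decomposition_span:
  fixes \<beta> :: "'e::real_vector \<Rightarrow> 'e \<Rightarrow> real"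
  assumes bil: "bilinear \<beta>" and pos: "\<And>u. u \<noteq> 0 \<Longrightarrow> \<beta> u u > 0" and fin: "finite B"
  shows "\<exists>w\<in>span B. \<forall>z\<in>span B. \<beta> (v - w) z = 0"
  using fin
proof (induction B arbitrary: v)
  case empty
  then show ?case using bil by (simp add: bilinear_rzero)
next
  case (insert b B)
  note r = bilinear_ladd[OF bil] bilinear_radd[OF bil] bilinear_lsub[OF bil] bilinear_rsub[OF bil]
    bilinear_lmul[OF bil] bilinear_rmul[OF bil]
  obtain wb where wb: "wb \<in> span B" "\<And>z. z \<in> span B \<Longrightarrow> \<beta> (b - wb) z = 0"
    using insert.IH by blast
  obtain wv where wv: "wv \<in> span B" "\<And>z. z \<in> span B \<Longrightarrow> \<beta> (v - wv) z = 0"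
    using insert.IH by blast
  define b' where "b' = b - wb"
  have sub: "span B \<subseteq> span (insert b B)" by (intro span_mono) auto
  have b': "b' \<in> span (insert b B)"
    unfolding b'_def using wb(1) sub by (intro span_diff span_base[of b]) auto
  have dec: "\<exists>k. \<exists>y\<in>span B. z = y + k *\<^sub>R b'" if "z \<in> span (insert b B)" for z
  proof -
    obtain k where k: "z - k *\<^sub>R b \<in> span B" using \<open>z \<in> span (insert b B)\<close> by (auto simp: span_insert)
    then have "z - k *\<^sub>R b' \<in> span B"
      using span_add[OF k span_scale[OF wb(1), of k]] by (simp add: b'_def algebra_simps)
    then show ?thesis by (intro exI[of _ k] bexI[of _ "z - k *\<^sub>R b'"]) auto
  qed
  \<comment> \<open>If \<open>b\<close> already lies in the old span, then \<open>b' = 0\<close> and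
    division by zero gives \<open>k = 0\<close>. The identity required of \<open>k\<close> still
    holds, so a dependent \<open>B\<close> causes no trouble.\<close>
  define k where "k = \<beta> (v - wv) b' / \<beta> b' b'"
  have k: "\<beta> (v - wv) b' - k * \<beta> b' b' = 0"
    using pos[of b'] bil by (cases "b' = 0") (auto simp: k_def bilinear_rzero)
  show ?case
  proof (intro bexI[of _ "wv + k *\<^sub>R b'"] ballI)
    show "wv + k *\<^sub>R b' \<in> span (insert b B)"
      using wv(1) sub b' by (intro span_add span_scale) auto
    fix z assume "z \<in> span (insert b B)"
    then obtain m y where y: "y \<in> span B" "z = y + m *\<^sub>R b'" using dec by blast
    have "\<beta> (v - (wv + k *\<^sub>R b')) z = \<beta> (v - wv) y - k * \<beta> b' y + m * (\<beta> (v - wv) b' - k * \<beta> b' b')"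
      by (simp add: y(2) r algebra_simps)
    then show "\<beta> (v - (wv + k *\<^sub>R b')) z = 0"
      using wv(2)[OF y(1)] wb(2)[OF y(1)] k by (simp add: b'_def)
  qed
qed

lemma orthogonal_decomposition:
  fixes \<beta> :: "'e::euclidean_space \<Rightarrow> 'e \<Rightarrow> real"
  assumes "bilinear \<beta>" "\<And>u. u \<noteq> 0 \<Longrightarrow> \<beta> u u > 0" "subspace V"
  shows "\<exists>w\<in>V. \<forall>z\<in>V. \<beta> (v - w) z = 0"
proof -
  obtain B where "finite B" "span B = V"
    using basis_exists[of V] assms(3) by (metis independent_imp_finite span_subspace)
  then show ?thesis using orthogonal_decomposition_span[OF assms(1,2)] by blast
qed

section \<open>Charts, tangent vectors and vector fields\<close>

abbreviation transition_derivative ::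
    "('m, 'e::euclidean_space) chart \<Rightarrow> ('m, 'e) chart \<Rightarrow> 'm \<Rightarrow> 'e \<Rightarrow> 'e"
  where "transition_derivative c c' p \<equiv> frechet_derivative (transition c c') (at (cmap c p))"

section \<open>Change of charts\<close>

locale smooth_mfd =
  fixes M :: "('m, 'e::euclidean_space) manifold"
  assumes smooth_manifold: "smooth_manifold M"
begin

lemma mem_charts_at: "c \<in> charts_at M p \<longleftrightarrow> c \<in> atlas M \<and> p \<in> cdom c"
  by (simp add: charts_at_def)

lemma compatible: "c \<in> atlas M \<Longrightarrow> compatible_chart M c"
  using smooth_manifold by (simp add: smooth_manifold_def)

lemma openin_cdom: "c \<in> atlas M \<Longrightarrow> openin (topo M) (cdom c)"
  using compatible by (simp add: compatible_chart_def)

lemma cdom_subset_points: "c \<in> atlas M \<Longrightarrow> p \<in> cdom c \<Longrightarrow> p \<in> points M"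
  using openin_cdom openin_subset by blast

lemma homeomorphic_cmap:
  "c \<in> atlas M \<Longrightarrow> homeomorphic_map (subtopology (topo M) (cdom c)) (top_of_set (cmap c ` cdom c)) (cmap c)"
  using compatible by (simp add: compatible_chart_def)

lemma inj_on_cmap: "c \<in> atlas M \<Longrightarrow> inj_on (cmap c) (cdom c)"
  using homeomorphic_imp_injective_map[OF homeomorphic_cmap] openin_subset[OF openin_cdom]
  by (metis inf.absorb_iff2 topspace_subtopology)

lemma cinv_cmap: "c \<in> atlas M \<Longrightarrow> p \<in> cdom c \<Longrightarrow> cinv c (cmap c p) = p"
  by (simp add: cinv_def inj_on_cmap)

lemma open_cmap_image:
  assumes c: "c \<in> atlas M" and U: "openin (topo M) U"
  shows "open (cmap c ` (U \<inter> cdom c))"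
proof -
  have "openin (subtopology (topo M) (cdom c)) (U \<inter> cdom c)"
    using U by (auto simp: openin_subtopology)
  then have "openin (top_of_set (cmap c ` cdom c)) (cmap c ` (U \<inter> cdom c))"
    using homeomorphic_imp_open_map[OF homeomorphic_cmap[OF c]] by (simp add: open_map_def)
  moreover have "open (cmap c ` cdom c)"
    using compatible[OF c] by (simp add: compatible_chart_def)
  ultimately show ?thesis using openin_open_trans by blast
qed

lemma charts_at_nonempty: "p \<in> points M \<Longrightarrow> \<exists>c. c \<in> charts_at M p"
  using smooth_manifold by (auto simp: smooth_manifold_def charts_at_def)

lemma chart_at: "p \<in> points M \<Longrightarrow> chart_at M p \<in> charts_at M p"
  unfolding chart_at_def using charts_at_nonempty by (rule someI_ex)

lemma smooth_on_transition:
  assumes "c \<in> atlas M" "c' \<in> atlas M"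
  shows "smooth_on (cmap c ` (cdom c' \<inter> cdom c)) (transition c c')"
  using compatible[OF assms(1)] assms(2) by (simp add: compatible_chart_def Int_commute[of "cdom c'"])

lemma transition_cmap: "c \<in> atlas M \<Longrightarrow> p \<in> cdom c \<Longrightarrow> transition c c' (cmap c p) = cmap c' p"
  by (simp add: transition_def cinv_cmap)

lemma transition_has_derivative:
  assumes "c \<in> charts_at M p" "c' \<in> charts_at M p"
  shows "(transition c c' has_derivative transition_derivative c c' p) (at (cmap c p))"
  using assms by (intro smooth_on_imp_has_derivative[OF smooth_on_transition]) (auto simp: mem_charts_at)

lemma linear_transition_derivative:
  "c \<in> charts_at M p \<Longrightarrow> c' \<in> charts_at M p \<Longrightarrow> linear (transition_derivative c c' p)"
  using transition_has_derivative has_derivative_linear by blast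

lemma cinv_transition:
  assumes "c \<in> atlas M" "c' \<in> atlas M" "x \<in> cmap c' ` (cdom c \<inter> cdom c')"
  shows "cinv c (transition c' c x) = cinv c' x"
  using assms by (auto simp: transition_cmap cinv_cmap)

text \<open>Coordinate independence has its source here: the cocycle rule, the differential of a map
  and the derivative of a function along a vector are instances for different
  \<open>\<phi>\<close>.\<close>

lemma has_derivative_change_chart:
  fixes \<phi> :: "'m \<Rightarrow> 'b::real_normed_vector"
  assumes c: "c \<in> charts_at M p" "c' \<in> charts_at M p"
    and "((\<lambda>x. \<phi> (cinv c x)) has_derivative \<phi>') (at (cmap c p))"
  shows "((\<lambda>x. \<phi> (cinv c' x)) has_derivative (\<lambda>u. \<phi>' (transition_derivative c' c p u))) (at (cmap c' p))"
proof -
  have a: "c \<in> atlas M" "c' \<in> atlas M" "p \<in> cdom c" "p \<in> cdom c'"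
    using c by (auto simp: mem_charts_at)
  have "((\<lambda>x. \<phi> (cinv c (transition c' c x))) has_derivative (\<lambda>u. \<phi>' (transition_derivative c' c p u))) (at (cmap c' p))"
    using assms(3) a
    by (intro has_derivative_compose[OF transition_has_derivative[OF c(2,1)], where g = "\<lambda>x. \<phi> (cinv c x)"])
       (simp add: transition_cmap)
  then show ?thesis
    by (rule has_derivative_transform_within_open[OF _ open_cmap_image[OF a(2) openin_cdom[OF a(1)]]])
      (use a in \<open>auto simp: cinv_transition\<close>)
qed

text \<open>This is \<open>has_derivative_change_chart\<close> for the function
  \<open>cmap c''\<close>, which is \<open>transition c c''\<close> when read in the chart
  \<open>c\<close>.\<close>

lemma transition_derivative_compose:
  assumes "c \<in> charts_at M p" "c' \<in> charts_at M p" "c'' \<in> charts_at M p"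
  shows "transition_derivative c' c'' p (transition_derivative c c' p u) = transition_derivative c c'' p u"
proof -
  have "((\<lambda>x. cmap c'' (cinv c x)) has_derivative
      (\<lambda>u. transition_derivative c' c'' p (transition_derivative c c' p u))) (at (cmap c p))"
    using transition_has_derivative[OF assms(2,3)]
    by (intro has_derivative_change_chart[OF assms(2,1)]) (simp add: transition_def comp_def)
  then have "(transition c c'' has_derivative
      (\<lambda>u. transition_derivative c' c'' p (transition_derivative c c' p u))) (at (cmap c p))"
    by (simp add: transition_def comp_def)
  from frechet_derivative_at[OF this] show ?thesis by metis
qed

lemma transition_derivative_self:
  assumes "c \<in> charts_at M p"
  shows "transition_derivative c c p u = u"
proof -
  have a: "c \<in> atlas M" "p \<in> cdom c" using assms by (auto simp: mem_charts_at)
  have "transition_derivative c c p = frechet_derivative (\<lambda>x. x) (at (cmap c p))"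
    by (rule frechet_derivative_cong_open[OF open_cmap_image[OF a(1) openin_cdom[OF a(1)]]])
      (use a in \<open>auto simp: transition_cmap\<close>)
  then show ?thesis by simp
qed

section \<open>Tangent vectors and coordinate fields\<close>

lemma tangent_spaceD:
  "v \<in> tangent_space M p \<Longrightarrow> c \<in> charts_at M p \<Longrightarrow> c' \<in> charts_at M p
    \<Longrightarrow> v c' = transition_derivative c c' p (v c)"
  unfolding tangent_space_def by blast

lemma tangent_spaceI:
  assumes "\<And>c c'. c \<in> charts_at M p \<Longrightarrow> c' \<in> charts_at M p \<Longrightarrow> transition_derivative c c' p (v c) = v c'"
    and "\<And>c. c \<notin> charts_at M p \<Longrightarrow> v c = 0"
  shows "v \<in> tangent_space M p"
  unfolding tangent_space_def
proof (intro CollectI conjI ballI allI impI)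
  show "v c' = transition_derivative c c' p (v c)" if "c \<in> charts_at M p" "c' \<in> charts_at M p" for c c'
    using assms(1)[OF that] by (rule sym)
qed (rule assms(2))

lemma tangent_space_outside: "v \<in> tangent_space M p \<Longrightarrow> c \<notin> charts_at M p \<Longrightarrow> v c = 0"
  unfolding tangent_space_def by blast

lemma subspace_tangent_space: "subspace (tangent_space M p)"
proof -
  note l = linear_transition_derivative and D = tangent_spaceD[symmetric]
  have "0 \<in> tangent_space M p"
    by (rule tangent_spaceI) (simp_all add: linear_0[OF l])
  moreover have "u + v \<in> tangent_space M p" if "u \<in> tangent_space M p" "v \<in> tangent_space M p" for u v
    using that by (intro tangent_spaceI) (simp_all add: linear_add[OF l] D tangent_space_outside)
  moreover have "a *\<^sub>R u \<in> tangent_space M p" if "u \<in> tangent_space M p" for a u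
    using that by (intro tangent_spaceI) (simp_all add: scaleR_fun_def linear_cmul[OF l] D tangent_space_outside)
  ultimately show ?thesis by (simp add: subspace_def)
qed

text \<open>One coordinate vector determines the others through the transition derivatives, and
  entries at charts away from \<open>p\<close> are 0 by convention. Equations between tangent
  vectors are therefore checked in a single chart.\<close>

lemma tangent_eqI:
  assumes "v \<in> tangent_space M p" "w \<in> tangent_space M p" "c \<in> charts_at M p" "v c = w c"
  shows "v = w"
proof
  fix c'
  show "v c' = w c'"
  proof (cases "c' \<in> charts_at M p")
    case True
    then show ?thesis
      using tangent_spaceD[OF assms(1,3)] tangent_spaceD[OF assms(2,3)] assms(4) by simp
  next
    case False
    then show ?thesis using assms(1,2) by (simp add: tangent_space_outside)
  qed
qed

lemma coord_field_tangent: "c \<in> charts_at M p \<Longrightarrow> coord_field M c u p \<in> tangent_space M p"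
  by (rule tangent_spaceI) (simp_all add: coord_field_def transition_derivative_compose)

lemma coord_field_self: "c \<in> charts_at M p \<Longrightarrow> coord_field M c u p c = u"
  by (simp add: coord_field_def transition_derivative_self)

text \<open>Together with \<open>coord_field_self\<close>, this identifies the tangent space with
  the coordinate space \<open>'e\<close>.\<close>

lemma coord_field_coord:
  "v \<in> tangent_space M p \<Longrightarrow> c \<in> charts_at M p \<Longrightarrow> coord_field M c (v c) p = v"
  using tangent_eqI coord_field_tangent coord_field_self by metis

lemma linear_coord_field:
  assumes c: "c \<in> charts_at M p"
  shows "linear (\<lambda>u. coord_field M c u p)"
proof (rule linearI)
  note t = coord_field_tangent[OF c] and s = subspace_tangent_space[of p]
  show "coord_field M c (u + v) p = coord_field M c u p + coord_field M c v p" for u v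
    by (rule tangent_eqI[OF t subspace_add[OF s t t] c]) (simp add: coord_field_self c)
  show "coord_field M c (a *\<^sub>R u) p = a *\<^sub>R coord_field M c u p" for a u
    by (rule tangent_eqI[OF t subspace_scale[OF s t] c]) (simp add: coord_field_self c scaleR_fun_def)
qed

section \<open>Locality of smoothness\<close>

lemma smooth_on_change_chart:
  fixes \<phi> :: "'m \<Rightarrow> 'b::real_normed_vector"
  assumes c: "c \<in> atlas M" "c' \<in> atlas M" and W: "openin (topo M) W" "W \<subseteq> cdom c'"
    and "smooth_on (cmap c ` (W \<inter> cdom c)) (\<lambda>x. \<phi> (cinv c x))"
  shows "smooth_on (cmap c' ` (W \<inter> cdom c)) (\<lambda>x. \<phi> (cinv c' x))"
proof -
  have eq: "W \<inter> cdom c = (W \<inter> cdom c) \<inter> cdom c'" using W by auto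
  have o: "open (cmap c' ` (W \<inter> cdom c))"
    by (subst eq) (use W c in \<open>auto intro!: open_cmap_image openin_cdom\<close>)
  have "smooth_on (cmap c' ` (W \<inter> cdom c)) (\<lambda>x. \<phi> (cinv c (transition c' c x)))"
  proof (rule smooth_on_compose[OF o open_cmap_image[OF c(1) W(1)] _ _ assms(5)])
    show "transition c' c ` cmap c' ` (W \<inter> cdom c) \<subseteq> cmap c ` (W \<inter> cdom c)"
      using W c by (auto simp: transition_cmap subset_iff)
    show "smooth_on (cmap c' ` (W \<inter> cdom c)) (transition c' c)"
      using smooth_on_transition[OF c(2,1)] by (rule smooth_on_subset) (use W in auto)
  qed
  moreover have "\<phi> (cinv c (transition c' c x)) = \<phi> (cinv c' x)" if "x \<in> cmap c' ` (W \<inter> cdom c)" for x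
    using that W c by (subst cinv_transition) auto
  ultimately show ?thesis by (rule smooth_on_transform[OF o])
qed

text \<open>The definition demands every chart of the atlas; smoothness of the transitions makes one
  chart around each point enough.\<close>

lemma smooth_fun_localI:
  assumes "\<And>p. p \<in> U \<Longrightarrow> \<exists>c\<in>charts_at M p. \<exists>W. openin (topo M) W \<and> p \<in> W \<and>
     smooth_on (cmap c ` (W \<inter> cdom c)) (\<lambda>x. f (cinv c x))"
  shows "smooth_fun M U f"
  unfolding smooth_fun_def
proof (intro ballI smooth_on_local)
  fix c' x assume c': "c' \<in> atlas M" and "x \<in> cmap c' ` (U \<inter> cdom c')"
  then obtain p where p: "p \<in> U" "p \<in> cdom c'" "x = cmap c' p" by auto
  then obtain c W where c: "c \<in> atlas M" "p \<in> cdom c" and W: "openin (topo M) W" "p \<in> W"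
     "smooth_on (cmap c ` (W \<inter> cdom c)) (\<lambda>x. f (cinv c x))"
    using assms[OF p(1)] by (auto simp: mem_charts_at)
  let ?W = "W \<inter> cdom c'"
  have oW: "openin (topo M) ?W" using W openin_cdom[OF c'] by auto
  have "open (cmap c' ` (W \<inter> cdom c \<inter> cdom c'))"
    using W c c' by (intro open_cmap_image) (auto intro: openin_cdom)
  then have "open (cmap c' ` (?W \<inter> cdom c))" by (simp add: Int_ac)
  moreover have "smooth_on (cmap c' ` (?W \<inter> cdom c)) (\<lambda>x. f (cinv c' x))"
    by (rule smooth_on_change_chart[OF c(1) c' oW]) (auto intro: smooth_on_subset[OF W(3)])
  ultimately show "\<exists>T. open T \<and> x \<in> T \<and> smooth_on T (\<lambda>x. f (cinv c' x))"
    using p c W by blast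
qed

text \<open>As for functions, except that the coordinate vector is also carried to the other chart
  by the transition derivative.\<close>

lemma vfields_localI:
  assumes "\<And>p. p \<in> U \<Longrightarrow> X p \<in> tangent_space M p" and U: "openin (topo M) U"
    and "\<And>p. p \<in> U \<Longrightarrow> \<exists>c\<in>charts_at M p. \<exists>W. openin (topo M) W \<and> p \<in> W \<and>
     smooth_on (cmap c ` (W \<inter> cdom c)) (\<lambda>x. X (cinv c x) c)"
  shows "X \<in> vfields M U"
  unfolding vfields_def
proof (intro CollectI conjI ballI smooth_on_local)
  show "X p \<in> tangent_space M p" if "p \<in> U" for p using assms(1)[OF that] .
  fix c' x assume c': "c' \<in> atlas M" and "x \<in> cmap c' ` (U \<inter> cdom c')"
  then obtain p where p: "p \<in> U" "p \<in> cdom c'" "x = cmap c' p" by auto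
  then obtain c W where c: "c \<in> atlas M" "p \<in> cdom c" and W: "openin (topo M) W" "p \<in> W"
     "smooth_on (cmap c ` (W \<inter> cdom c)) (\<lambda>x. X (cinv c x) c)"
    using assms(3)[OF p(1)] by (auto simp: mem_charts_at)
  let ?W = "W \<inter> U \<inter> cdom c'" and ?T = "transition_derivative c c'"
  have oW: "openin (topo M) ?W" using W U openin_cdom[OF c'] by auto
  have o: "open (cmap c ` (?W \<inter> cdom c))"
    using c oW by (intro open_cmap_image) auto
  have "smooth_on (cmap c ` (?W \<inter> cdom c)) (\<lambda>x. frechet_derivative (transition c c') (at x) (X (cinv c x) c))"
    by (intro smooth_on_frechet_derivative o smooth_on_subset[OF smooth_on_transition[OF c(1) c']]
        smooth_on_subset[OF W(3)]) auto
  moreover have "frechet_derivative (transition c c') (at x) (X (cinv c x) c) = X (cinv c x) c'"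
    if "x \<in> cmap c ` (?W \<inter> cdom c)" for x
  proof -
    obtain q where q: "q \<in> ?W" "q \<in> cdom c" "x = cmap c q" using \<open>x \<in> _\<close> by auto
    then show ?thesis
      using tangent_spaceD[OF assms(1)[of q], of c c'] c c' by (simp add: cinv_cmap mem_charts_at)
  qed
  ultimately have s: "smooth_on (cmap c ` (?W \<inter> cdom c)) (\<lambda>x. X (cinv c x) c')"
    by (rule smooth_on_transform[OF o])
  have "open (cmap c' ` (W \<inter> U \<inter> cdom c \<inter> cdom c'))"
    using W U c c' by (intro open_cmap_image) (auto intro: openin_cdom)
  then have "open (cmap c' ` (?W \<inter> cdom c))" by (simp add: Int_ac)
  moreover have "smooth_on (cmap c' ` (?W \<inter> cdom c)) (\<lambda>x. X (cinv c' x) c')"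
    by (rule smooth_on_change_chart[OF c(1) c' oW _ s]) auto
  ultimately show "\<exists>T. open T \<and> x \<in> T \<and> smooth_on T (\<lambda>x. X (cinv c' x) c')"
    using p c W by blast
qed

lemma vfieldsD: "X \<in> vfields M U \<Longrightarrow> p \<in> U \<Longrightarrow> X p \<in> tangent_space M p"
  by (simp add: vfields_def)

lemma vfields_smooth:
  "X \<in> vfields M U \<Longrightarrow> c \<in> atlas M \<Longrightarrow> smooth_on (cmap c ` (U \<inter> cdom c)) (\<lambda>x. X (cinv c x) c)"
  by (simp add: vfields_def)

lemma vfields_subset: "X \<in> vfields M U \<Longrightarrow> W \<subseteq> U \<Longrightarrow> X \<in> vfields M W"
  unfolding vfields_def by (blast intro: smooth_on_subset)

lemma vfields_cong:
  assumes "openin (topo M) U" "\<And>p. p \<in> U \<Longrightarrow> X p = Y p" "X \<in> vfields M U"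
  shows "Y \<in> vfields M U"
proof -
  have "smooth_on (cmap c ` (U \<inter> cdom c)) (\<lambda>x. Y (cinv c x) c)" if "c \<in> atlas M" for c
    using open_cmap_image[OF that assms(1)] vfields_smooth[OF assms(3) that]
    by (rule smooth_on_transform) (use that assms(2) in \<open>auto simp: cinv_cmap\<close>)
  then show ?thesis using vfieldsD[OF assms(3)] assms(2) by (auto simp: vfields_def)
qed

lemma vfields_add:
  assumes "openin (topo M) U" "X \<in> vfields M U" "Y \<in> vfields M U"
  shows "X + Y \<in> vfields M U"
  using vfields_smooth[OF assms(2)] vfields_smooth[OF assms(3)] vfieldsD[OF assms(2)] vfieldsD[OF assms(3)]
    subspace_add[OF subspace_tangent_space]
  by (auto simp: vfields_def intro!: smooth_on_add open_cmap_image assms(1))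

lemma vfields_scale:
  assumes "openin (topo M) U" "smooth_fun M U f" "Y \<in> vfields M U"
  shows "(\<lambda>p. f p *\<^sub>R Y p) \<in> vfields M U"
  using vfields_smooth[OF assms(3)] vfieldsD[OF assms(3)] assms(2)
    subspace_scale[OF subspace_tangent_space]
  by (auto simp: vfields_def scaleR_fun_def smooth_fun_def intro!: smooth_on_scaleR open_cmap_image assms(1))

lemma smooth_fun_const: "smooth_fun M U (\<lambda>p. a)"
  by (auto simp: smooth_fun_def)

lemma smooth_fun_add:
  "openin (topo M) U \<Longrightarrow> smooth_fun M U f \<Longrightarrow> smooth_fun M U k \<Longrightarrow> smooth_fun M U (\<lambda>p. f p + k p)"
  by (auto simp: smooth_fun_def intro!: smooth_on_add open_cmap_image)

lemma smooth_fun_mult: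
  "openin (topo M) U \<Longrightarrow> smooth_fun M U f \<Longrightarrow> smooth_fun M U k \<Longrightarrow> smooth_fun M U (\<lambda>p. f p * k p)"
  by (auto simp: smooth_fun_def intro!: smooth_on_mult open_cmap_image)

lemma vfields_scale_const:
  "openin (topo M) U \<Longrightarrow> Y \<in> vfields M U \<Longrightarrow> a *\<^sub>R Y \<in> vfields M U"
  using vfields_scale[OF _ smooth_fun_const, of U Y a] by (simp add: scaleR_fun_def)

lemma vfields_diff:
  assumes "openin (topo M) U" "X \<in> vfields M U" "Y \<in> vfields M U"
  shows "X - Y \<in> vfields M U"
  using vfields_add[OF assms(1,2) vfields_scale_const[OF assms(1,3), of "-1"]] by simp

lemma coord_field_vfields:
  assumes "c \<in> atlas M"
  shows "coord_field M c u \<in> vfields M (cdom c)"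
proof (rule vfields_localI[OF _ openin_cdom[OF assms]])
  fix p assume p: "p \<in> cdom c"
  then show "coord_field M c u p \<in> tangent_space M p"
    using assms by (simp add: coord_field_tangent mem_charts_at)
  have "smooth_on (cmap c ` (cdom c \<inter> cdom c)) (\<lambda>x. coord_field M c u (cinv c x) c)"
    by (rule smooth_on_transform[OF open_cmap_image[OF assms openin_cdom[OF assms]] smooth_on_const[of _ u]])
       (use assms in \<open>auto simp: cinv_cmap coord_field_self mem_charts_at\<close>)
  then show "\<exists>c'\<in>charts_at M p. \<exists>W. openin (topo M) W \<and> p \<in> W \<and>
     smooth_on (cmap c' ` (W \<inter> cdom c')) (\<lambda>x. coord_field M c u (cinv c' x) c')"
    using p assms openin_cdom[OF assms] by (intro bexI[of _ c] exI[of _ "cdom c"]) (auto simp: mem_charts_at)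
qed

section \<open>Derivatives of functions along tangent vectors\<close>

lemma smooth_fun_has_derivative:
  assumes "openin (topo M) U" "smooth_fun M U f" "p \<in> U" "c \<in> charts_at M p"
  shows "((\<lambda>x. f (cinv c x)) has_derivative frechet_derivative (\<lambda>x. f (cinv c x)) (at (cmap c p))) (at (cmap c p))"
  using assms by (intro smooth_on_imp_has_derivative[of "cmap c ` (U \<inter> cdom c)"])
    (auto simp: smooth_fun_def mem_charts_at)

text \<open>\<open>deriv_along\<close> is defined with the arbitrarily chosen chart
  \<open>chart_at M p\<close>. The changes of the function and of the coordinate vector cancel, so
  any chart may be used.\<close>

lemma deriv_along_has_derivative:
  assumes "((\<lambda>x. f (cinv c x)) has_derivative f') (at (cmap c p))"
    and "v \<in> tangent_space M p" "c \<in> charts_at M p"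
  shows "deriv_along M f p v = f' (v c)"
proof -
  have "p \<in> points M" using assms(3) cdom_subset_points by (auto simp: mem_charts_at)
  then have c': "chart_at M p \<in> charts_at M p" by (rule chart_at)
  show ?thesis
    unfolding deriv_along_def Let_def
    using frechet_derivative_at[OF has_derivative_change_chart[OF assms(3) c' assms(1)], symmetric]
      tangent_spaceD[OF assms(2) c' assms(3)] by simp
qed

lemma deriv_along_add:
  assumes "openin (topo M) U" "smooth_fun M U f" "smooth_fun M U k" "p \<in> U" "v \<in> tangent_space M p"
  shows "deriv_along M (\<lambda>q. a * f q + b * k q) p v = a * deriv_along M f p v + b * deriv_along M k p v"
proof -
  have "p \<in> points M" using assms openin_subset by blast
  then obtain c where c: "c \<in> charts_at M p" using charts_at_nonempty by blast
  note f = smooth_fun_has_derivative[OF assms(1,2,4) c] and k = smooth_fun_has_derivative[OF assms(1,3,4) c]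
  show ?thesis
    using deriv_along_has_derivative[OF f assms(5) c] deriv_along_has_derivative[OF k assms(5) c]
      deriv_along_has_derivative[of "\<lambda>q. a * f q + b * k q", OF _ assms(5) c,
        OF has_derivative_add[OF has_derivative_mult_right[OF f] has_derivative_mult_right[OF k]]]
    by simp
qed

lemma deriv_along_cong:
  assumes "openin (topo M) U" "\<And>q. q \<in> U \<Longrightarrow> f q = k q" "p \<in> U"
  shows "deriv_along M f p v = deriv_along M k p v"
proof -
  have "p \<in> points M" using assms openin_subset by blast
  then have c: "chart_at M p \<in> charts_at M p" by (rule chart_at)
  then have a: "chart_at M p \<in> atlas M" "p \<in> cdom (chart_at M p)" by (auto simp: mem_charts_at)
  have "frechet_derivative (\<lambda>x. f (cinv (chart_at M p) x)) (at (cmap (chart_at M p) p))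
      = frechet_derivative (\<lambda>x. k (cinv (chart_at M p) x)) (at (cmap (chart_at M p) p))"
    by (rule frechet_derivative_cong_open[OF open_cmap_image[OF a(1) assms(1)]])
      (use a assms in \<open>auto simp: cinv_cmap\<close>)
  then show ?thesis by (simp add: deriv_along_def Let_def)
qed

end

section \<open>Smooth maps and their differentials\<close>

locale smooth_mfd_map = smooth_mfd M + target: smooth_mfd N
  for M :: "('m, 'e::euclidean_space) manifold" and N :: "('n, 'f::euclidean_space) manifold" +
  fixes \<pi> :: "'m \<Rightarrow> 'n"
  assumes smooth_map: "smooth_map M N \<pi>"
begin

lemma map_points: "p \<in> points M \<Longrightarrow> \<pi> p \<in> points N"
  using smooth_map by (auto simp: smooth_map_def continuous_map_def)

definition chart_preimage :: "('m, 'e) chart \<Rightarrow> ('n, 'f) chart \<Rightarrow> 'm set"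
  where "chart_preimage c d = {p \<in> cdom c. \<pi> p \<in> cdom d}"

lemma openin_chart_preimage:
  assumes "c \<in> atlas M" "d \<in> atlas N"
  shows "openin (topo M) (chart_preimage c d)"
proof -
  have "openin (topo M) {p \<in> points M. \<pi> p \<in> cdom d}"
    using smooth_map target.openin_cdom[OF assms(2)]
    by (auto simp: smooth_map_def intro: openin_continuous_map_preimage)
  moreover have "chart_preimage c d = cdom c \<inter> {p \<in> points M. \<pi> p \<in> cdom d}"
    using cdom_subset_points[OF assms(1)] by (auto simp: chart_preimage_def)
  ultimately show ?thesis using openin_cdom[OF assms(1)] by auto
qed

definition coord_map :: "('m, 'e) chart \<Rightarrow> ('n, 'f) chart \<Rightarrow> 'e \<Rightarrow> 'f"
  where "coord_map c d x = cmap d (\<pi> (cinv c x))"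

lemma chart_preimage_Int: "chart_preimage c d \<inter> cdom c = chart_preimage c d"
  by (auto simp: chart_preimage_def)

lemma open_chart_preimage:
  "c \<in> atlas M \<Longrightarrow> d \<in> atlas N \<Longrightarrow> open (cmap c ` chart_preimage c d)"
  using open_cmap_image[OF _ openin_chart_preimage] by (metis chart_preimage_Int)

lemma smooth_on_coord_map:
  "c \<in> atlas M \<Longrightarrow> d \<in> atlas N \<Longrightarrow> smooth_on (cmap c ` chart_preimage c d) (coord_map c d)"
  using smooth_map by (simp add: smooth_map_def chart_preimage_def coord_map_def[abs_def])

lemma mem_chart_preimage:
  "c \<in> charts_at M p \<Longrightarrow> d \<in> charts_at N (\<pi> p) \<Longrightarrow> p \<in> chart_preimage c d"
  by (simp add: mem_charts_at target.mem_charts_at chart_preimage_def)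

lemma coord_map_has_derivative:
  assumes "c \<in> charts_at M p" "d \<in> charts_at N (\<pi> p)"
  shows "(coord_map c d has_derivative frechet_derivative (coord_map c d) (at (cmap c p))) (at (cmap c p))"
  using assms mem_chart_preimage[OF assms]
  by (intro smooth_on_imp_has_derivative[OF smooth_on_coord_map])
     (auto simp: mem_charts_at target.mem_charts_at)

lemma differential_chart:
  assumes c: "c \<in> charts_at M p" and d: "d \<in> charts_at N (\<pi> p)" and v: "v \<in> tangent_space M p"
  shows "differential M N \<pi> p v d = frechet_derivative (coord_map c d) (at (cmap c p)) (v c)"
proof -
  have "p \<in> points M" using c cdom_subset_points by (auto simp: mem_charts_at)
  then have c': "chart_at M p \<in> charts_at M p" by (rule chart_at)
  have "((\<lambda>x. cmap d (\<pi> (cinv c x))) has_derivative frechet_derivative (coord_map c d) (at (cmap c p))) (at (cmap c p))"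
    using coord_map_has_derivative[OF c d] by (simp add: coord_map_def[abs_def])
  from frechet_derivative_at[OF has_derivative_change_chart[where \<phi> = "\<lambda>q. cmap d (\<pi> q)", OF c c' this], symmetric]
  show ?thesis
    using d tangent_spaceD[OF v c' c] by (simp add: differential_def Let_def)
qed

lemma differential_tangent:
  assumes p: "p \<in> points M" and v: "v \<in> tangent_space M p"
  shows "differential M N \<pi> p v \<in> tangent_space N (\<pi> p)"
proof -
  obtain c where c: "c \<in> charts_at M p" using charts_at_nonempty[OF p] by blast
  have "differential M N \<pi> p v d' = transition_derivative d d' (\<pi> p) (differential M N \<pi> p v d)"
    if d: "d \<in> charts_at N (\<pi> p)" "d' \<in> charts_at N (\<pi> p)" for d d'
  proof -
    have a: "c \<in> atlas M" "p \<in> cdom c" "d \<in> atlas N" "\<pi> p \<in> cdom d" "d' \<in> atlas N" "\<pi> p \<in> cdom d'"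
      using c d by (auto simp: mem_charts_at target.mem_charts_at)
    have "((\<lambda>x. transition d d' (coord_map c d x)) has_derivative
        (\<lambda>u. transition_derivative d d' (\<pi> p) (frechet_derivative (coord_map c d) (at (cmap c p)) u))) (at (cmap c p))"
      using target.transition_has_derivative[OF d] a
      by (intro has_derivative_compose[OF coord_map_has_derivative[OF c d(1)]])
        (simp add: coord_map_def cinv_cmap)
    then have "(coord_map c d' has_derivative
        (\<lambda>u. transition_derivative d d' (\<pi> p) (frechet_derivative (coord_map c d) (at (cmap c p)) u))) (at (cmap c p))"
      by (rule has_derivative_transform_within_open[OF _ open_chart_preimage[OF a(1,3)]])
        (use a in \<open>auto simp: chart_preimage_def coord_map_def cinv_cmap target.transition_cmap\<close>)
    from frechet_derivative_at[OF this, symmetric] show ?thesis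
      using differential_chart[OF c d(1) v] differential_chart[OF c d(2) v] by simp
  qed
  then show ?thesis
    by (intro target.tangent_spaceI) (metis, simp add: differential_def)
qed

lemma differential_linear:
  assumes p: "p \<in> points M" and "u \<in> tangent_space M p" "v \<in> tangent_space M p"
  shows "differential M N \<pi> p (a *\<^sub>R u + b *\<^sub>R v)
     = a *\<^sub>R differential M N \<pi> p u + b *\<^sub>R differential M N \<pi> p v"
proof -
  obtain c where c: "c \<in> charts_at M p" using charts_at_nonempty[OF p] by blast
  obtain d where d: "d \<in> charts_at N (\<pi> p)" using target.charts_at_nonempty[OF map_points[OF p]] by blast
  have s: "a *\<^sub>R u + b *\<^sub>R v \<in> tangent_space M p"
    using assms by (intro subspace_add[OF subspace_tangent_space] subspace_scale[OF subspace_tangent_space])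
  have l: "linear (frechet_derivative (coord_map c d) (at (cmap c p)))"
    using coord_map_has_derivative[OF c d] by (rule has_derivative_linear)
  show ?thesis
  proof (rule target.tangent_eqI[OF _ _ d])
    show "a *\<^sub>R differential M N \<pi> p u + b *\<^sub>R differential M N \<pi> p v \<in> tangent_space N (\<pi> p)"
      using assms differential_tangent
      by (intro subspace_add[OF target.subspace_tangent_space] subspace_scale[OF target.subspace_tangent_space])
    show "differential M N \<pi> p (a *\<^sub>R u + b *\<^sub>R v) d
      = (a *\<^sub>R differential M N \<pi> p u + b *\<^sub>R differential M N \<pi> p v) d"
      by (simp add: differential_chart[OF c d] s assms)
         (simp add: scaleR_fun_def linear_add[OF l] linear_cmul[OF l] differential_chart[OF c d] assms)
  qed (rule differential_tangent[OF p s])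
qed

end

section \<open>Riemannian submersions\<close>

locale riem_mfd = smooth_mfd M for M :: "('m, 'e::euclidean_space) manifold" +
  fixes g :: "('m, 'e) bilin"
  assumes riemannian_metric: "riemannian_metric M g"
begin

context
  fixes p assumes p: "p \<in> points M"
begin

lemma metric_sym: "u \<in> tangent_space M p \<Longrightarrow> v \<in> tangent_space M p \<Longrightarrow> g p u v = g p v u"
  using riemannian_metric p unfolding riemannian_metric_def by blast

lemma metric_linear_left:
  "u \<in> tangent_space M p \<Longrightarrow> v \<in> tangent_space M p \<Longrightarrow> w \<in> tangent_space M p
   \<Longrightarrow> g p (a *\<^sub>R u + b *\<^sub>R v) w = a * g p u w + b * g p v w"
  using riemannian_metric p unfolding riemannian_metric_def by blast

lemma metric_pos: "u \<in> tangent_space M p \<Longrightarrow> u \<noteq> 0 \<Longrightarrow> g p u u > 0"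
  using riemannian_metric p unfolding riemannian_metric_def by blast

lemma metric_add_left:
  assumes "u \<in> tangent_space M p" "v \<in> tangent_space M p" "w \<in> tangent_space M p"
  shows "g p (u + v) w = g p u w + g p v w"
  using metric_linear_left[OF assms, of 1 1] by simp

lemma metric_diff_left:
  assumes "u \<in> tangent_space M p" "v \<in> tangent_space M p" "w \<in> tangent_space M p"
  shows "g p (u - v) w = g p u w - g p v w"
  using metric_linear_left[OF assms, of 1 "-1"] by simp

lemma metric_scale_left:
  assumes "u \<in> tangent_space M p" "w \<in> tangent_space M p"
  shows "g p (a *\<^sub>R u) w = a * g p u w"
  using metric_linear_left[OF assms(1,1,2), of a 0] by simp

lemma metric_zero_left: "w \<in> tangent_space M p \<Longrightarrow> g p 0 w = 0"
  using metric_scale_left[of w w 0] by simp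

lemma metric_add_right:
  assumes "u \<in> tangent_space M p" "v \<in> tangent_space M p" "w \<in> tangent_space M p"
  shows "g p w (u + v) = g p w u + g p w v"
  using assms metric_add_left[OF assms] subspace_add[OF subspace_tangent_space]
  by (simp add: metric_sym[of w])

lemma metric_diff_right:
  assumes "u \<in> tangent_space M p" "v \<in> tangent_space M p" "w \<in> tangent_space M p"
  shows "g p w (u - v) = g p w u - g p w v"
  using assms metric_diff_left[OF assms] subspace_diff[OF subspace_tangent_space]
  by (simp add: metric_sym[of w])

lemma metric_scale_right:
  assumes "u \<in> tangent_space M p" "w \<in> tangent_space M p"
  shows "g p w (a *\<^sub>R u) = a * g p w u"
  using assms metric_scale_left[OF assms, of a] subspace_scale[OF subspace_tangent_space]
  by (simp add: metric_sym[of w])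

lemma metric_eq_zero_iff: "u \<in> tangent_space M p \<Longrightarrow> g p u u = 0 \<longleftrightarrow> u = 0"
  using metric_pos[of u] metric_zero_left[of u] by force

lemma bilinear_metric_coord:
  assumes c: "c \<in> charts_at M p"
  shows "bilinear (\<lambda>a b. g p (coord_field M c a p) (coord_field M c b p))"
  unfolding bilinear_def
  by (auto intro!: linearI simp: linear_add[OF linear_coord_field[OF c]] linear_cmul[OF linear_coord_field[OF c]]
      coord_field_tangent[OF c] metric_add_left metric_add_right metric_scale_left metric_scale_right)

end

lemma smooth_fun_metric:
  assumes "openin (topo M) U" "X \<in> vfields M U" "Y \<in> vfields M U"
  shows "smooth_fun M U (\<lambda>p. g p (X p) (Y p))"
proof -
  have "\<forall>U. openin (topo M) U \<longrightarrow>
      (\<forall>X\<in>vfields M U. \<forall>Y\<in>vfields M U. smooth_fun M U (\<lambda>p. g p (X p) (Y p)))"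
    using riemannian_metric unfolding riemannian_metric_def by (rule conjunct2)
  then show ?thesis using assms by simp
qed

text \<open>The usual coefficients \<open>g_ij\<close> of the chart \<open>c\<close>, with arbitrary
  vectors of \<open>'e\<close> in place of the basis vectors.\<close>

definition metric_coeff :: "('m, 'e) chart \<Rightarrow> 'e \<Rightarrow> 'e \<Rightarrow> 'e \<Rightarrow> real"
  where "metric_coeff c x a b = g (cinv c x) (coord_field M c a (cinv c x)) (coord_field M c b (cinv c x))"

lemma smooth_on_metric_coeff:
  assumes c: "c \<in> atlas M"
  shows "smooth_on (cmap c ` cdom c) (\<lambda>x. metric_coeff c x a b)"
  using bspec[OF smooth_fun_metric[OF openin_cdom[OF c] coord_field_vfields[OF c, of a]
      coord_field_vfields[OF c, of b], unfolded smooth_fun_def] c]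
  by (simp add: metric_coeff_def)

lemma bilinear_metric_coeff:
  assumes "c \<in> atlas M" "x \<in> cmap c ` cdom c"
  shows "bilinear (metric_coeff c x)"
proof -
  obtain q where q: "q \<in> cdom c" "x = cmap c q" using assms(2) by auto
  have "bilinear (\<lambda>a b. g q (coord_field M c a q) (coord_field M c b q))"
    using q assms(1) by (intro bilinear_metric_coord cdom_subset_points) (auto simp: mem_charts_at)
  then show ?thesis
    using q assms(1) by (simp add: metric_coeff_def[abs_def] cinv_cmap)
qed

lemma open_cmap_cdom: "c \<in> atlas M \<Longrightarrow> open (cmap c ` cdom c)"
  using open_cmap_image[OF _ openin_cdom, of c c] by simp

end

section \<open>The vertical and horizontal splitting\<close>

locale riem_submersion =
  fixes M :: "('m, 'e::euclidean_space) manifold" and g :: "('m, 'e) bilin"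
    and N :: "('n, 'f::euclidean_space) manifold" and h :: "('n, 'f) bilin" and \<pi> :: "'m \<Rightarrow> 'n"
  assumes submersion: "riemannian_submersion M g N h \<pi>"

sublocale riem_submersion \<subseteq> riem_mfd M g
  using submersion by unfold_locales (auto simp: riemannian_submersion_def)

sublocale riem_submersion \<subseteq> target: riem_mfd N h
  using submersion by unfold_locales (auto simp: riemannian_submersion_def)

sublocale riem_submersion \<subseteq> smooth_mfd_map M N \<pi>
  using submersion by unfold_locales (auto simp: riemannian_submersion_def)

context riem_submersion
begin

abbreviation "TM \<equiv> tangent_space M"
abbreviation "VV \<equiv> vertical M N \<pi>"
abbreviation "HH \<equiv> horizontal M g N \<pi>"
abbreviation "vpart \<equiv> vert_part M g N \<pi>"
abbreviation "hpart \<equiv> hor_part M g N \<pi>"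
abbreviation "dpi \<equiv> differential M N \<pi>"

definition pullback :: "('m, 'e) bilin"
  where "pullback p u v = h (\<pi> p) (dpi p u) (dpi p v)"

lemma TM_add: "u \<in> TM p \<Longrightarrow> v \<in> TM p \<Longrightarrow> u + v \<in> TM p"
  by (rule subspace_add[OF subspace_tangent_space])

lemma TM_diff: "u \<in> TM p \<Longrightarrow> v \<in> TM p \<Longrightarrow> u - v \<in> TM p"
  by (rule subspace_diff[OF subspace_tangent_space])

lemma TM_scale: "u \<in> TM p \<Longrightarrow> a *\<^sub>R u \<in> TM p"
  by (rule subspace_scale[OF subspace_tangent_space])

lemma TM_zero: "0 \<in> TM p"
  by (rule subspace_0[OF subspace_tangent_space])

lemma TM_minus: "u \<in> TM p \<Longrightarrow> - u \<in> TM p"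
  by (rule subspace_neg[OF subspace_tangent_space])

lemmas TM_closed = TM_add TM_diff TM_scale TM_zero TM_minus

lemma VV_TM: "v \<in> VV p \<Longrightarrow> v \<in> TM p" and HH_TM: "v \<in> HH p \<Longrightarrow> v \<in> TM p"
  by (auto simp: vertical_def horizontal_def)

lemma metric_HH_VV: "u \<in> HH p \<Longrightarrow> v \<in> VV p \<Longrightarrow> g p u v = 0"
  by (auto simp: horizontal_def)

lemma submersion_isometry:
  "p \<in> points M \<Longrightarrow> u \<in> HH p \<Longrightarrow> v \<in> HH p \<Longrightarrow> pullback p u v = g p u v"
  using submersion by (auto simp: riemannian_submersion_def pullback_def)

lemma submersion_surj: "p \<in> points M \<Longrightarrow> dpi p ` TM p = tangent_space N (\<pi> p)"
  using submersion by (auto simp: riemannian_submersion_def)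

context
  fixes p assumes p: "p \<in> points M"
begin

lemma metric_VV_HH: "u \<in> HH p \<Longrightarrow> v \<in> VV p \<Longrightarrow> g p v u = 0"
  using metric_HH_VV[of u p v] metric_sym[OF p] VV_TM HH_TM by metis

lemma subspace_VV: "subspace (VV p)"
proof -
  have "dpi p (a *\<^sub>R u + b *\<^sub>R v) = 0" if "u \<in> VV p" "v \<in> VV p" for a b u v
    using differential_linear[OF p, of u v a b] that by (simp add: vertical_def)
  from this[of _ _ 0 0] this[of _ _ 1 1] this[of _ _ _ 0] show ?thesis
    using differential_linear[OF p TM_zero TM_zero, of 0 0]
    by (auto simp: subspace_def vertical_def TM_closed)
qed

lemma subspace_HH: "subspace (HH p)"
  by (auto simp: subspace_def horizontal_def vertical_def TM_closed metric_add_left[OF p]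
      metric_scale_left[OF p] metric_zero_left[OF p])

lemma VV_Int_HH: "v \<in> VV p \<Longrightarrow> v \<in> HH p \<Longrightarrow> v = 0"
  using metric_HH_VV metric_eq_zero_iff[OF p] VV_TM by blast

text \<open>Tangent vectors are functions on charts, not elements of a Euclidean space. The linear
  algebra is therefore carried out in \<open>'e\<close>, where \<open>g p\<close> becomes an inner
  product and the vertical space a subspace, and is then transported back.\<close>

lemma decomposition_exists:
  assumes v: "v \<in> TM p"
  shows "\<exists>w\<in>VV p. v - w \<in> HH p"
proof -
  obtain c where c: "c \<in> charts_at M p" using charts_at_nonempty[OF p] by blast
  let ?C = "\<lambda>u. coord_field M c u p"
  have lin: "linear ?C" using linear_coord_field[OF c] .
  have sub: "subspace {u. ?C u \<in> VV p}"
    using subspace_VV by (auto simp: subspace_def linear_0[OF lin] linear_add[OF lin] linear_cmul[OF lin])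
  have pos: "g p (?C u) (?C u) > 0" if "u \<noteq> 0" for u
  proof (rule metric_pos[OF p coord_field_tangent[OF c]])
    show "?C u \<noteq> 0" using coord_field_self[OF c, of u] that by auto
  qed
  obtain w where w: "?C w \<in> VV p" "\<And>z. ?C z \<in> VV p \<Longrightarrow> g p (?C (v c - w)) (?C z) = 0"
    using orthogonal_decomposition[OF bilinear_metric_coord[OF p c] pos sub] by blast
  have "v - ?C w = ?C (v c - w)"
    by (simp add: linear_diff[OF lin] coord_field_coord[OF v c])
  moreover have "g p (?C (v c - w)) z = 0" if z: "z \<in> VV p" for z
    using w(2)[of "z c"] coord_field_coord[OF VV_TM[OF z] c] z by simp
  then have "?C (v c - w) \<in> HH p"
    using coord_field_tangent[OF c] by (simp add: horizontal_def)
  ultimately show ?thesis using w(1) by metis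
qed

lemma decomposition_unique:
  assumes "w \<in> VV p" "v - w \<in> HH p" "w' \<in> VV p" "v - w' \<in> HH p"
  shows "w' = w"
proof -
  have "(v - w) - (v - w') \<in> HH p" using subspace_diff[OF subspace_HH assms(2,4)] .
  then have "w' - w \<in> HH p" by simp
  then show ?thesis using VV_Int_HH[of "w' - w"] subspace_diff[OF subspace_VV assms(3,1)] by simp
qed

lemma vpart_unique: "w \<in> VV p \<Longrightarrow> v - w \<in> HH p \<Longrightarrow> vpart p v = w"
  unfolding vert_part_def by (rule the_equality) (auto intro: decomposition_unique)

lemma vpart_VV: "v \<in> TM p \<Longrightarrow> vpart p v \<in> VV p"
  and hpart_HH: "v \<in> TM p \<Longrightarrow> hpart p v \<in> HH p"
  using decomposition_exists vpart_unique by (fastforce simp: hor_part_def)+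

lemma vpart_TM: "v \<in> TM p \<Longrightarrow> vpart p v \<in> TM p" and hpart_TM: "v \<in> TM p \<Longrightarrow> hpart p v \<in> TM p"
  using vpart_VV VV_TM hpart_HH HH_TM by blast+

lemma vpart_of_VV: "v \<in> VV p \<Longrightarrow> vpart p v = v" and hpart_of_VV: "v \<in> VV p \<Longrightarrow> hpart p v = 0"
  using vpart_unique[of v v] subspace_0[OF subspace_HH] by (auto simp: hor_part_def)

lemma vpart_of_HH: "v \<in> HH p \<Longrightarrow> vpart p v = 0" and hpart_of_HH: "v \<in> HH p \<Longrightarrow> hpart p v = v"
  using vpart_unique[of 0 v] subspace_0[OF subspace_VV] by (auto simp: hor_part_def)

lemma vpart_linear:
  assumes "u \<in> TM p" "v \<in> TM p"
  shows "vpart p (a *\<^sub>R u + b *\<^sub>R v) = a *\<^sub>R vpart p u + b *\<^sub>R vpart p v"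
proof (rule vpart_unique)
  show "a *\<^sub>R vpart p u + b *\<^sub>R vpart p v \<in> VV p"
    using assms by (intro subspace_add[OF subspace_VV] subspace_scale[OF subspace_VV] vpart_VV)
  have "a *\<^sub>R hpart p u + b *\<^sub>R hpart p v \<in> HH p"
    using assms by (intro subspace_add[OF subspace_HH] subspace_scale[OF subspace_HH] hpart_HH)
  then show "a *\<^sub>R u + b *\<^sub>R v - (a *\<^sub>R vpart p u + b *\<^sub>R vpart p v) \<in> HH p"
    by (simp add: hor_part_def algebra_simps)
qed

lemma hpart_linear:
  "u \<in> TM p \<Longrightarrow> v \<in> TM p \<Longrightarrow> hpart p (a *\<^sub>R u + b *\<^sub>R v) = a *\<^sub>R hpart p u + b *\<^sub>R hpart p v"
  by (simp add: hor_part_def vpart_linear algebra_simps)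

lemma differential_hpart:
  assumes "v \<in> TM p"
  shows "dpi p (hpart p v) = dpi p v"
  using differential_linear[OF p assms vpart_TM[OF assms], of 1 "-1"] vpart_VV[OF assms]
  by (simp add: hor_part_def vertical_def)

text \<open>Leaving \<open>v\<close> unprojected on the right turns the identity into a linear
  system for the horizontal part with the metric as its matrix. This is what
  \<open>vfields_hpart\<close> solves.\<close>

lemma pullback_eq_metric:
  assumes "u \<in> TM p" "v \<in> TM p"
  shows "pullback p u v = g p (hpart p u) v"
proof -
  have "pullback p u v = g p (hpart p u) (hpart p v)"
    using submersion_isometry[OF p hpart_HH[OF assms(1)] hpart_HH[OF assms(2)]] assms
    by (simp add: pullback_def differential_hpart)
  also have "\<dots> = g p (hpart p u) v"
    using metric_diff_right[OF p assms(2) vpart_TM[OF assms(2)] hpart_TM[OF assms(1)]]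
      metric_HH_VV[OF hpart_HH[OF assms(1)] vpart_VV[OF assms(2)]]
    by (simp add: hor_part_def)
  finally show ?thesis .
qed

lemma pullback_coord:
  assumes c: "c \<in> charts_at M p" and d: "d \<in> charts_at N (\<pi> p)" and "u \<in> TM p" "v \<in> TM p"
  shows "pullback p u v = target.metric_coeff d (coord_map c d (cmap c p))
    (frechet_derivative (coord_map c d) (at (cmap c p)) (u c))
    (frechet_derivative (coord_map c d) (at (cmap c p)) (v c))"
proof -
  have "cinv d (coord_map c d (cmap c p)) = \<pi> p"
    using c d by (simp add: coord_map_def mem_charts_at target.mem_charts_at cinv_cmap target.cinv_cmap)
  then show ?thesis
    using assms p
    by (simp add: target.metric_coeff_def pullback_def differential_chart[OF c d, symmetric]
        target.coord_field_coord[OF differential_tangent d])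
qed

end

section \<open>Smoothness of the pulled back metric and of the projections\<close>

lemma pullback_sym:
  "p \<in> points M \<Longrightarrow> u \<in> TM p \<Longrightarrow> v \<in> TM p \<Longrightarrow> pullback p u v = pullback p v u"
  unfolding pullback_def by (intro target.metric_sym map_points differential_tangent)

lemma coord_map_image: "c \<in> atlas M \<Longrightarrow> coord_map c d ` cmap c ` chart_preimage c d \<subseteq> cmap d ` cdom d"
  by (auto simp: coord_map_def chart_preimage_def cinv_cmap)

text \<open>The image of a field under \<open>dpi\<close> is in general not a field on
  \<open>N\<close>, so smoothness of \<open>h\<close> on fields does not apply directly. The form is
  expressed by the coefficients of \<open>h\<close> along the coordinate expression of
  \<open>\<pi>\<close>.\<close>

lemma smooth_fun_pullback:
  assumes U: "openin (topo M) U" and X: "X \<in> vfields M U" and Y: "Y \<in> vfields M U"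
  shows "smooth_fun M U (\<lambda>q. pullback q (X q) (Y q))"
proof (rule smooth_fun_localI)
  fix p assume pU: "p \<in> U"
  then have p: "p \<in> points M" using U openin_subset by blast
  obtain c where c: "c \<in> charts_at M p" using charts_at_nonempty[OF p] by blast
  obtain d where d: "d \<in> charts_at N (\<pi> p)" using target.charts_at_nonempty[OF map_points[OF p]] by blast
  have a: "c \<in> atlas M" "p \<in> cdom c" "d \<in> atlas N" "\<pi> p \<in> cdom d"
    using c d by (auto simp: mem_charts_at target.mem_charts_at)
  define W where "W = U \<inter> chart_preimage c d"
  have W: "openin (topo M) W" using U openin_chart_preimage a by (auto simp: W_def)
  let ?S = "cmap c ` (W \<inter> cdom c)" and ?F = "coord_map c d"
  have S: "open ?S" using W a by (intro open_cmap_image)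
  have sub: "?S \<subseteq> cmap c ` chart_preimage c d" by (auto simp: W_def)
  have F: "smooth_on ?S ?F"
    using smooth_on_coord_map[OF a(1,3)] sub by (rule smooth_on_subset)
  have Fim: "?F ` ?S \<subseteq> cmap d ` cdom d"
    using coord_map_image[OF a(1), of d] sub by blast
  have lift: "smooth_on ?S (\<lambda>x. frechet_derivative ?F (at x) (Z (cinv c x) c))" if "Z \<in> vfields M U" for Z
    using smooth_on_subset[OF vfields_smooth[OF that a(1)], of ?S]
    by (intro smooth_on_frechet_derivative S F) (auto simp: W_def)
  have "smooth_on ?S (\<lambda>x. target.metric_coeff d (?F x) (frechet_derivative ?F (at x) (X (cinv c x) c))
      (frechet_derivative ?F (at x) (Y (cinv c x) c)))"
  proof (rule smooth_on_bilinear_family[OF S _ _ lift[OF X] lift[OF Y]])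
    show "bilinear (target.metric_coeff d (?F x))" if "x \<in> ?S" for x
      using that Fim a(3) by (intro target.bilinear_metric_coeff) auto
    show "smooth_on ?S (\<lambda>x. target.metric_coeff d (?F x) a b)" for a b
      using S target.open_cmap_cdom[OF a(3)] Fim F target.smooth_on_metric_coeff[OF a(3)]
      by (rule smooth_on_compose)
  qed
  then have "smooth_on ?S (\<lambda>x. pullback (cinv c x) (X (cinv c x)) (Y (cinv c x)))"
  proof (rule smooth_on_transform[OF S])
    fix x assume "x \<in> ?S"
    then obtain q where q: "q \<in> W" "q \<in> cdom c" "x = cmap c q" by auto
    then have "q \<in> U" "c \<in> charts_at M q" "d \<in> charts_at N (\<pi> q)" "q \<in> points M"
      using a cdom_subset_points by (auto simp: W_def chart_preimage_def mem_charts_at target.mem_charts_at)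
    then show "target.metric_coeff d (?F x) (frechet_derivative ?F (at x) (X (cinv c x) c))
      (frechet_derivative ?F (at x) (Y (cinv c x) c)) = pullback (cinv c x) (X (cinv c x)) (Y (cinv c x))"
      using q a vfieldsD[OF X] vfieldsD[OF Y] by (simp add: pullback_coord cinv_cmap)
  qed
  then show "\<exists>c\<in>charts_at M p. \<exists>W. openin (topo M) W \<and> p \<in> W \<and>
     smooth_on (cmap c ` (W \<inter> cdom c)) (\<lambda>x. pullback (cinv c x) (X (cinv c x)) (Y (cinv c x)))"
    using W c pU mem_chart_preimage[OF c d] by (auto simp: W_def)
qed

text \<open>In a chart, the horizontal part is the unique vector whose products with the coordinate
  fields are the values of \<open>pullback\<close>. Those values and the metric coefficients are
  smooth, hence so is the solution.\<close>

lemma vfields_hpart: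
  assumes U: "openin (topo M) U" and X: "X \<in> vfields M U"
  shows "apply_endo hpart X \<in> vfields M U"
proof (rule vfields_localI[OF _ U])
  fix p assume pU: "p \<in> U"
  then have p: "p \<in> points M" using U openin_subset by blast
  show "apply_endo hpart X p \<in> TM p"
    using hpart_TM[OF p vfieldsD[OF X pU]] by (simp add: apply_endo_def)
  obtain c where c: "c \<in> charts_at M p" using charts_at_nonempty[OF p] by blast
  then have a: "c \<in> atlas M" "p \<in> cdom c" by (auto simp: mem_charts_at)
  define W where "W = U \<inter> cdom c"
  have W: "openin (topo M) W" "W \<inter> cdom c = W" using U openin_cdom[OF a(1)] by (auto simp: W_def)
  let ?S = "cmap c ` (W \<inter> cdom c)"
  have S: "open ?S" using W a by (intro open_cmap_image)
  have XW: "X \<in> vfields M W" and cf: "coord_field M c u \<in> vfields M W" for u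
    using vfields_subset[OF X] vfields_subset[OF coord_field_vfields[OF a(1)]] by (auto simp: W_def)
  have qD: "q \<in> points M" "c \<in> charts_at M q" "q \<in> W" "X q \<in> TM q" "cinv c x = q"
    if "x = cmap c q" "q \<in> W" for q x
    using that a cdom_subset_points vfieldsD[OF X] by (auto simp: W_def mem_charts_at cinv_cmap)
  \<comment> \<open>The bilinear coefficients turned into an operator: its components are the
    products with the basis coordinate fields.\<close>
  define A where "A x u = (\<Sum>b\<in>Basis. metric_coeff c x u b *\<^sub>R b)" for x u
  have A_inner: "A x u \<bullet> b = metric_coeff c x u b" if "b \<in> Basis" for x u b
    using that by (simp add: A_def)
  have bil: "bilinear (metric_coeff c x)" if "x \<in> ?S" for x
    using that a by (intro bilinear_metric_coeff) auto
  have "smooth_on ?S (\<lambda>x. apply_endo hpart X (cinv c x) c)"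
  proof (rule smooth_on_linear_system_solution[where A = A
        and b = "\<lambda>x. \<Sum>b\<in>Basis. pullback (cinv c x) (X (cinv c x)) (coord_field M c b (cinv c x)) *\<^sub>R b"])
    show "linear (A x)" if "x \<in> ?S" for x
      using bil[OF that] unfolding A_def
      by (intro linearI) (auto simp: bilinear_ladd bilinear_lmul scaleR_add_left sum.distrib scaleR_sum_right)
    show "u = 0" if x: "x \<in> ?S" and Au: "A x u = 0" for x u
    proof -
      obtain q where q: "q \<in> W" "x = cmap c q" using x by auto
      note q' = qD[OF q(2,1)]
      have "metric_coeff c x u b = 0" if "b \<in> Basis" for b
        using A_inner[OF that, of x u] Au by simp
      moreover have "linear (metric_coeff c x u)" using bil[OF x] by (simp add: bilinear_def)
      ultimately have "metric_coeff c x u u = 0" using linear_eq_sum_Basis[of "metric_coeff c x u" u] by simp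
      then have "coord_field M c u q = 0"
        using metric_eq_zero_iff[OF q'(1) coord_field_tangent[OF q'(2)]] by (simp add: metric_coeff_def q'(5))
      then show ?thesis using coord_field_self[OF q'(2), of u] by simp
    qed
    show "smooth_on ?S (\<lambda>x. A x u)" for u
      unfolding A_def using smooth_on_metric_coeff[OF a(1)]
      by (intro smooth_on_sum smooth_on_scaleR S) (auto intro: smooth_on_subset)
    have "smooth_fun M W (\<lambda>q. pullback q (X q) (coord_field M c b q))" for b
      using smooth_fun_pullback[OF W(1) XW cf] .
    then show "smooth_on ?S (\<lambda>x. \<Sum>b\<in>Basis. pullback (cinv c x) (X (cinv c x)) (coord_field M c b (cinv c x)) *\<^sub>R b)"
      using a(1) by (intro smooth_on_sum smooth_on_scaleR S) (auto simp: smooth_fun_def)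
    show "A x (apply_endo hpart X (cinv c x) c) =
      (\<Sum>b\<in>Basis. pullback (cinv c x) (X (cinv c x)) (coord_field M c b (cinv c x)) *\<^sub>R b)" if x: "x \<in> ?S" for x
    proof -
      obtain q where q: "q \<in> W" "x = cmap c q" using x by auto
      note q' = qD[OF q(2,1)]
      show ?thesis
        using pullback_eq_metric[OF q'(1,4) coord_field_tangent[OF q'(2)]]
        by (simp add: A_def metric_coeff_def q'(5) apply_endo_def coord_field_coord[OF hpart_TM[OF q'(1,4)] q'(2)])
    qed
  qed (rule S)
  then show "\<exists>c\<in>charts_at M p. \<exists>W. openin (topo M) W \<and> p \<in> W \<and>
     smooth_on (cmap c ` (W \<inter> cdom c)) (\<lambda>x. apply_endo hpart X (cinv c x) c)"
    using c W(1) a pU by (intro bexI[of _ c] exI[of _ W]) (auto simp: W_def)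
qed

lemma vfields_vpart:
  assumes U: "openin (topo M) U" and X: "X \<in> vfields M U"
  shows "apply_endo vpart X \<in> vfields M U"
  by (rule vfields_cong[OF U _ vfields_diff[OF U X vfields_hpart[OF U X]]], rule ext)
     (simp add: apply_endo_def hor_part_def)

text \<open>This is why the mixed part of the connection is skew on horizontal vectors.\<close>

lemma pullback_invariant:
  assumes U: "openin (topo M) U" and E: "E \<in> vfields M U" and X: "X \<in> vfields M U" and Y: "Y \<in> vfields M U"
    and vert: "\<And>q. q \<in> U \<Longrightarrow> E q \<in> VV q" and pU: "p \<in> U"
    and brX: "bracket M E X p \<in> TM p" and brY: "bracket M E Y p \<in> TM p"
  shows "deriv_along M (\<lambda>q. pullback q (X q) (Y q)) p (E p)
    = pullback p (bracket M E X p) (Y p) + pullback p (X p) (bracket M E Y p)"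
proof -
  have p: "p \<in> points M" using U pU openin_subset by blast
  obtain c where c: "c \<in> charts_at M p" using charts_at_nonempty[OF p] by blast
  obtain d where d: "d \<in> charts_at N (\<pi> p)" using target.charts_at_nonempty[OF map_points[OF p]] by blast
  have a: "c \<in> atlas M" "p \<in> cdom c" "d \<in> atlas N" "\<pi> p \<in> cdom d"
    using c d by (auto simp: mem_charts_at target.mem_charts_at)
  define W where "W = U \<inter> chart_preimage c d"
  have W: "openin (topo M) W" using U openin_chart_preimage a by (auto simp: W_def)
  define S where "S = cmap c ` (W \<inter> cdom c)"
  define F where "F = coord_map c d"
  define x0 where "x0 = cmap c p"
  have S: "open S" unfolding S_def using W a by (intro open_cmap_image)
  have x0: "x0 \<in> S" using pU mem_chart_preimage[OF c d] a by (auto simp: S_def x0_def W_def)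
  have sub: "S \<subseteq> cmap c ` chart_preimage c d" by (auto simp: S_def W_def)
  have F: "smooth_on S F"
    unfolding F_def using smooth_on_coord_map[OF a(1,3)] sub by (rule smooth_on_subset)
  have Fim: "F ` S \<subseteq> cmap d ` cdom d"
    using coord_map_image[OF a(1), of d] sub unfolding F_def by blast
  define co where "co Z x = Z (cinv c x) c" for Z :: "('m, 'e) vfield" and x
  define L where "L x = frechet_derivative F (at x)" for x
  define L2 where "L2 u = frechet_derivative (\<lambda>x. L x u) (at x0)" for u
  have linL: "linear (L x)" if "x \<in> S" for x
    unfolding L_def using F that by (intro linear_frechet_derivative smooth_on_imp_differentiable)
  have L2: "((\<lambda>x. L x u) has_derivative L2 u) (at x0)" for u
    unfolding L2_def L_def using smooth_on_imp_has_derivative[OF smooth_on_directional_derivative[OF F] x0] .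
  have sym: "L2 u v = L2 v u" for u v
    unfolding L2_def L_def by (rule smooth_on_second_derivative_symmetric[OF S F x0])
  define D where "D Z = frechet_derivative (co Z) (at x0)" for Z
  have D: "(co Z has_derivative D Z) (at x0)" if "Z \<in> vfields M U" for Z
    unfolding D_def using smooth_on_subset[OF vfields_smooth[OF that a(1)], of S] x0
    by (intro smooth_on_imp_has_derivative[of S]) (auto simp: S_def W_def co_def[abs_def])
  have co0: "co Z x0 = Z p c" for Z using a by (simp add: co_def x0_def cinv_cmap)
  have lift: "((\<lambda>x. L x (co Z x)) has_derivative (\<lambda>k. L2 (co Z x0) k + L x0 (D Z k))) (at x0)"
    if "Z \<in> vfields M U" for Z
    using has_derivative_linear_family[OF S linL L2 has_derivative_ident D[OF that] x0] by simp
  have qD: "q \<in> points M" "q \<in> U" "c \<in> charts_at M q" "d \<in> charts_at N (\<pi> q)" "cinv c x = q"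
    if "x = cmap c q" "q \<in> W" "q \<in> cdom c" for q x
    using that a cdom_subset_points
    by (auto simp: W_def chart_preimage_def mem_charts_at target.mem_charts_at cinv_cmap)
  have LE: "L x (co E x) = 0" if x: "x \<in> S" for x
  proof -
    obtain q where q: "q \<in> W" "q \<in> cdom c" "x = cmap c q" using x by (auto simp: S_def)
    note q' = qD[OF q(3,1,2)]
    have "dpi q (E q) d = L x (co E x)"
      using differential_chart[OF q'(3,4) vfieldsD[OF E q'(2)]] q(3) q'(5) by (simp add: L_def F_def co_def)
    then show ?thesis using vert[OF q'(2)] by (simp add: vertical_def)
  qed
  have "((\<lambda>x. L x (co E x)) has_derivative (\<lambda>k. 0)) (at x0)"
    by (rule has_derivative_transform_within_open[OF has_derivative_const S x0]) (simp add: LE)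
  then have LE': "L2 (co E x0) k + L x0 (D E k) = 0" for k
    by (rule fun_cong[OF has_derivative_unique[OF lift[OF E]]])
  \<comment> \<open>\<open>LE'\<close> is the derivative of the identity that \<open>dpi\<close>
    kills \<open>E\<close>. Combined with the symmetry of \<open>L2\<close>, it shows that the image
    of the bracket is the derivative of \<open>L x (co Z x)\<close> along \<open>E\<close>.\<close>
  have br: "L x0 (bracket M E Z p c) = L2 (co Z x0) (co E x0) + L x0 (D Z (co E x0))"
    if "Z \<in> vfields M U" for Z
  proof -
    have "bracket M E Z p c = D Z (co E x0) - D E (co Z x0)"
      using c by (simp add: bracket_def D_def co_def[abs_def] x0_def a cinv_cmap)
    then have "L x0 (bracket M E Z p c) = L x0 (D Z (co E x0)) - L x0 (D E (co Z x0))"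
      by (simp add: linear_diff[OF linL[OF x0]])
    then show ?thesis using LE'[of "co Z x0"] sym[of "co E x0" "co Z x0"]
      by (simp add: algebra_simps add_eq_0_iff)
  qed
  define k where "k = target.metric_coeff d"
  define k' where "k' u v = frechet_derivative (\<lambda>y. k y u v) (at (F x0))" for u v
  have Fx0: "F x0 \<in> cmap d ` cdom d" using Fim x0 by blast
  have k': "((\<lambda>y. k y u v) has_derivative k' u v) (at (F x0))" for u v
    unfolding k'_def k_def using target.smooth_on_metric_coeff[OF a(3)] Fx0 by (rule smooth_on_imp_has_derivative)
  have bil: "bilinear (k y)" if "y \<in> cmap d ` cdom d" for y
    unfolding k_def using a(3) that by (rule target.bilinear_metric_coeff)
  have "((\<lambda>x. k (F x) (L x (co X x)) (L x (co Y x))) has_derivative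
    (\<lambda>v. k' (L x0 (co X x0)) (L x0 (co Y x0)) (L x0 v)
       + k (F x0) (L2 (co X x0) v + L x0 (D X v)) (L x0 (co Y x0))
       + k (F x0) (L x0 (co X x0)) (L2 (co Y x0) v + L x0 (D Y v)))) (at x0)"
    using target.open_cmap_cdom[OF a(3)] bil k' smooth_on_imp_has_derivative[OF F x0, folded L_def]
      lift[OF X] lift[OF Y] Fx0 UNIV_I
    by (rule has_derivative_bilinear_family)
  then have *: "((\<lambda>x. pullback (cinv c x) (X (cinv c x)) (Y (cinv c x))) has_derivative
    (\<lambda>v. k' (L x0 (co X x0)) (L x0 (co Y x0)) (L x0 v)
       + k (F x0) (L2 (co X x0) v + L x0 (D X v)) (L x0 (co Y x0))
       + k (F x0) (L x0 (co X x0)) (L2 (co Y x0) v + L x0 (D Y v)))) (at x0)"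
  proof (rule has_derivative_transform_within_open[OF _ S x0])
    fix x assume "x \<in> S"
    then obtain q where q: "q \<in> W" "q \<in> cdom c" "x = cmap c q" by (auto simp: S_def)
    note q' = qD[OF q(3,1,2)]
    show "k (F x) (L x (co X x)) (L x (co Y x)) = pullback (cinv c x) (X (cinv c x)) (Y (cinv c x))"
      using pullback_coord[OF q'(1,3,4) vfieldsD[OF X q'(2)] vfieldsD[OF Y q'(2)]] q(3) q'(5)
      by (simp add: k_def L_def F_def co_def)
  qed
  \<comment> \<open>The image point in \<open>N\<close> does not move along the vertical field
    \<open>E\<close>, so the derivative of the coefficients of \<open>h\<close> contributes
    nothing.\<close>
  have "k' u v 0 = 0" for u v
    using has_derivative_linear[OF k'] by (rule linear_0)
  moreover have "L x0 (E p c) = 0" using LE[OF x0] co0 by simp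
  ultimately have "deriv_along M (\<lambda>q. pullback q (X q) (Y q)) p (E p) =
      k (F x0) (L x0 (bracket M E X p c)) (L x0 (Y p c)) + k (F x0) (L x0 (X p c)) (L x0 (bracket M E Y p c))"
    using deriv_along_has_derivative[OF *[unfolded x0_def] vfieldsD[OF E pU] c] br[OF X] br[OF Y]
    by (simp add: co0 x0_def[symmetric])
  then show ?thesis
    using pullback_coord[OF p c d brX vfieldsD[OF Y pU]] pullback_coord[OF p c d vfieldsD[OF X pU] brY]
    by (simp add: k_def L_def F_def x0_def)
qed

end

lemma scaleR_fun_apply: "(a *\<^sub>R f) x = a *\<^sub>R f x"
  by (simp add: scaleR_fun_def)

section \<open>Connections\<close>

context smooth_mfd
begin

lemma affine_connectionD:
  assumes "affine_connection M D" "openin (topo M) U" "X \<in> vfields M U" "Y \<in> vfields M U"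
  shows "D X Y \<in> vfields M U"
    and "Z \<in> vfields M U \<Longrightarrow> p \<in> U \<Longrightarrow> D (X + Z) Y p = D X Y p + D Z Y p"
    and "Z \<in> vfields M U \<Longrightarrow> p \<in> U \<Longrightarrow> D X (Y + Z) p = D X Y p + D X Z p"
    and "smooth_fun M U f \<Longrightarrow> p \<in> U \<Longrightarrow> D (\<lambda>q. f q *\<^sub>R X q) Y p = f p *\<^sub>R D X Y p"
    and "smooth_fun M U f \<Longrightarrow> p \<in> U \<Longrightarrow>
      D X (\<lambda>q. f q *\<^sub>R Y q) p = deriv_along M f p (X p) *\<^sub>R Y p + f p *\<^sub>R D X Y p"
    and "X' \<in> vfields M U \<Longrightarrow> Y' \<in> vfields M U \<Longrightarrow> (\<And>q. q \<in> U \<Longrightarrow> X q = X' q) \<Longrightarrow>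
      (\<And>q. q \<in> U \<Longrightarrow> Y q = Y' q) \<Longrightarrow> p \<in> U \<Longrightarrow> D X Y p = D X' Y' p"
proof -
  note c = assms(1)[unfolded affine_connection_def, rule_format, OF assms(2-4)]
  show "D X Y \<in> vfields M U" using c by (rule conjunct1)
  note c = conjunct2[OF c]
  show "D (X + Z) Y p = D X Y p + D Z Y p" "D X (Y + Z) p = D X Y p + D X Z p"
    if "Z \<in> vfields M U" "p \<in> U"
    using conjunct1[OF c, rule_format, OF that] by simp_all
  note c = conjunct2[OF c]
  show "D (\<lambda>q. f q *\<^sub>R X q) Y p = f p *\<^sub>R D X Y p"
    "D X (\<lambda>q. f q *\<^sub>R Y q) p = deriv_along M f p (X p) *\<^sub>R Y p + f p *\<^sub>R D X Y p"
    if "smooth_fun M U f" "p \<in> U"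
    using conjunct1[OF c, rule_format, OF that] by simp_all
  show "D X Y p = D X' Y' p" if "X' \<in> vfields M U" "Y' \<in> vfields M U" "\<And>q. q \<in> U \<Longrightarrow> X q = X' q"
      "\<And>q. q \<in> U \<Longrightarrow> Y q = Y' q" "p \<in> U"
    using conjunct2[OF c, rule_format, OF that(1,2) _ that(5)] that(3,4) by simp
qed

lemma affine_connection_cong_right:
  assumes "affine_connection M D" "openin (topo M) U" "X \<in> vfields M U" "Y \<in> vfields M U"
    and "\<And>q. q \<in> U \<Longrightarrow> Y q = Y' q" "p \<in> U"
  shows "D X Y p = D X Y' p"
  using affine_connectionD(6)[OF assms(1-4,3) vfields_cong[OF assms(2) assms(5,4)]] assms(5,6) by blast

lemma affine_connection_diff:
  assumes "affine_connection M D" "openin (topo M) U" "X \<in> vfields M U" "Y \<in> vfields M U"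
    and "Z \<in> vfields M U" "p \<in> U"
  shows "D X (Y - Z) p = D X Y p - D X Z p" "D (Y - Z) X p = D Y X p - D Z X p"
proof -
  note YZ = vfields_diff[OF assms(2,4,5)]
  show "D X (Y - Z) p = D X Y p - D X Z p"
    using affine_connectionD(3)[OF assms(1-3) YZ assms(5,6)] by simp
  show "D (Y - Z) X p = D Y X p - D Z X p"
    using affine_connectionD(2)[OF assms(1,2) YZ assms(3,5,6)] by simp
qed

end

lemma levi_civitaD:
  assumes "levi_civita M g D"
  shows "affine_connection M D"
    and "openin (topo M) U \<Longrightarrow> X \<in> vfields M U \<Longrightarrow> Y \<in> vfields M U \<Longrightarrow> p \<in> U \<Longrightarrow>
      D X Y p - D Y X p = bracket M X Y p"
    and "openin (topo M) U \<Longrightarrow> X \<in> vfields M U \<Longrightarrow> Y \<in> vfields M U \<Longrightarrow> Z \<in> vfields M U \<Longrightarrow> p \<in> U \<Longrightarrow>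
      deriv_along M (\<lambda>q. g q (Y q) (Z q)) p (X p) = g p (D X Y p) (Z p) + g p (Y p) (D X Z p)"
proof -
  note c = assms[unfolded levi_civita_def]
  show "affine_connection M D" using c by (rule conjunct1)
  note c = conjunct2[OF c, rule_format]
  show "D X Y p - D Y X p = bracket M X Y p"
    if "openin (topo M) U" "X \<in> vfields M U" "Y \<in> vfields M U" "p \<in> U"
    using c[OF that] by (rule conjunct1)
  show "deriv_along M (\<lambda>q. g q (Y q) (Z q)) p (X p) = g p (D X Y p) (Z p) + g p (Y p) (D X Z p)"
    if "openin (topo M) U" "X \<in> vfields M U" "Y \<in> vfields M U" "Z \<in> vfields M U" "p \<in> U"
    using conjunct2[OF c[OF that(1-3,5)], rule_format, OF that(4)] .
qed

text \<open>The difference of the connections, paired with a third field, is symmetric in the first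
  two slots by equality of torsion and skew in the last two by compatibility with \<open>g\<close>.
  Alternating these rules six times shows that it equals its own negative.\<close>

lemma (in riem_mfd) levi_civita_unique:
  assumes D: "levi_civita M g D" and D': "levi_civita M g D'" and U: "openin (topo M) U"
    and X: "X \<in> vfields M U" and Y: "Y \<in> vfields M U" and pU: "p \<in> U"
  shows "D X Y p = D' X Y p"
proof -
  have p: "p \<in> points M" using U pU openin_subset by blast
  note aff = levi_civitaD(1)[OF D] levi_civitaD(1)[OF D']
  note vf = affine_connectionD(1)[OF aff(1) U] affine_connectionD(1)[OF aff(2) U]
  define s where "s A B C = g p (D A B p - D' A B p) (C p)" for A B C
  have sym: "s A B C = s B A C" if "A \<in> vfields M U" "B \<in> vfields M U" for A B C
  proof -
    have "D A B p - D B A p = D' A B p - D' B A p"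
      using levi_civitaD(2)[OF D U that pU] levi_civitaD(2)[OF D' U that pU] by simp
    then have "D A B p - D' A B p = D B A p - D' B A p" by (simp add: algebra_simps)
    then show ?thesis by (simp add: s_def)
  qed
  have skew: "s A B C = - s A C B" if "A \<in> vfields M U" "B \<in> vfields M U" "C \<in> vfields M U" for A B C
  proof -
    note t = vfieldsD[OF _ pU]
    have T: "D A B p \<in> tangent_space M p" "D A C p \<in> tangent_space M p" "D' A B p \<in> tangent_space M p"
      "D' A C p \<in> tangent_space M p" "B p \<in> tangent_space M p" "C p \<in> tangent_space M p"
      using that vf t by blast+
    have "g p (D A B p) (C p) + g p (B p) (D A C p) = g p (D' A B p) (C p) + g p (B p) (D' A C p)"
      using levi_civitaD(3)[OF D U that pU] levi_civitaD(3)[OF D' U that pU] by simp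
    then show ?thesis
      using T by (simp add: s_def metric_diff_left[OF p] metric_sym[OF p, of "B p"])
  qed
  \<comment> \<open>Testing the difference against itself brings in positivity of
    \<open>g\<close>.\<close>
  define Z where "Z = D X Y - D' X Y"
  have Z: "Z \<in> vfields M U" unfolding Z_def using vf X Y by (intro vfields_diff[OF U])
  have "s X Y Z = - s X Y Z"
    using sym[OF X Y, of Z] skew[OF Y X Z] sym[OF Y Z, of X] skew[OF Z Y X] sym[OF Z X, of Y] skew[OF X Z Y]
    by simp
  then have "g p (Z p) (Z p) = 0" by (simp add: s_def Z_def)
  then show ?thesis using metric_eq_zero_iff[OF p vfieldsD[OF Z pU]] by (simp add: Z_def)
qed

section \<open>The rescaled Kaehler submersion\<close>

text \<open>Bookkeeping for \<open>cov_endo_hat\<close>. There \<open>va\<close>, \<open>vb\<close>,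
  \<open>hb\<close> become the images under \<open>J\<close> of the vertical part of
  \<open>D X (Vf Y)\<close> and of the two parts of \<open>D X (Hf Y)\<close>, and \<open>m\<close>,
  \<open>n\<close> those of half the mixed terms, so that no scalars remain.\<close>

lemma cov_endo_hat_algebra:
  fixes va vb hb m n :: "'a::ab_group_add"
  shows "vb + hb - (va + (m + m)) + m + n - (m + m + hb - (m + n) - (va + vb)) = vb + vb + (n + n) - (m + m)"
  by (simp add: algebra_simps)

text \<open>The same notation without \<open>J\<close>: the mixed terms and the vertical part of
  \<open>D X (Hf Y)\<close> cancel.\<close>

lemma canonical_hat_algebra:
  fixes va vb hb m n :: "'a::ab_group_add"
  shows "(va + (m + m)) + (vb + hb) - (m + n) + (n - m - vb) = va + hb"
  by (simp add: algebra_simps)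

text \<open>One connection \<open>D\<close> carries both \<open>J_parallel\<close> and
  \<open>geodesic\<close>, whereas the definitions behind them each assert a Levi-Civita connection
  of their own; uniqueness merges the two in the final proof.\<close>

locale kaehler_submersion = riem_submersion M g N h \<pi>
  for M :: "('m, 'e::euclidean_space) manifold" and g :: "('m, 'e) bilin"
    and N :: "('n, 'f::euclidean_space) manifold" and h :: "('n, 'f) bilin" and \<pi> :: "'m \<Rightarrow> 'n" +
  fixes J :: "('m, 'e) endo" and D :: "('m, 'e) connection"
  assumes hermitian: "almost_hermitian M g J"
    and levi_civita: "levi_civita M g D"
    and J_parallel: "openin (topo M) U \<Longrightarrow> X \<in> vfields M U \<Longrightarrow> Y \<in> vfields M U \<Longrightarrow> p \<in> U
      \<Longrightarrow> cov_endo D J X Y p = 0"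
    and geodesic: "openin (topo M) U \<Longrightarrow> X \<in> vfields M U \<Longrightarrow> Y \<in> vfields M U
      \<Longrightarrow> (\<And>q. q \<in> U \<Longrightarrow> X q \<in> VV q) \<Longrightarrow> (\<And>q. q \<in> U \<Longrightarrow> Y q \<in> VV q) \<Longrightarrow> p \<in> U \<Longrightarrow> D X Y p \<in> VV p"
    and J_VV: "preserves M J VV" and J_HH: "preserves M J HH"
begin

abbreviation "Vf \<equiv> apply_endo vpart"
abbreviation "Hf \<equiv> apply_endo hpart"
abbreviation "Jf \<equiv> apply_endo J"

text \<open>O'Neill's tensor \<open>A\<close> in its action on vertical fields, once the fibers are totally geodesic.\<close>

definition mixed :: "('m, 'e) connection"
  where "mixed X Y = Hf (D X (Vf Y))"

text \<open>The correction is symmetric in \<open>X\<close> and \<open>Y\<close>, so the torsion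
  stays zero; its size is fixed by compatibility with the rescaled metric, as
  \<open>g_hat_hat_connection\<close> shows.\<close>

definition hat_connection :: "('m, 'e) connection"
  where "hat_connection X Y = D X Y - (1/2) *\<^sub>R (mixed X Y + mixed Y X)"

abbreviation "g_hat \<equiv> hat_metric M g N \<pi>"
abbreviation "J_hat \<equiv> hat_structure M g J N \<pi>"
abbreviation "Jhf \<equiv> apply_endo J_hat"

lemma Jhf_eq: "Jhf Y = Jf (Hf Y) - Jf (Vf Y)"
  by (intro ext) (simp add: apply_endo_def hat_structure_def)

lemmas affine = levi_civitaD(1)[OF levi_civita]

context
  fixes p assumes p: "p \<in> points M"
begin

section \<open>Pointwise algebra of the complex structure and the projections\<close>

lemma J_TM: "v \<in> TM p \<Longrightarrow> J p v \<in> TM p"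
  using hermitian p unfolding almost_hermitian_def almost_complex_def endo_field_def by blast

lemma J_linear:
  assumes "u \<in> TM p" "v \<in> TM p"
  shows "J p (a *\<^sub>R u + b *\<^sub>R v) = a *\<^sub>R J p u + b *\<^sub>R J p v"
  using hermitian p assms unfolding almost_hermitian_def almost_complex_def endo_field_def by blast

lemma J_add: "u \<in> TM p \<Longrightarrow> v \<in> TM p \<Longrightarrow> J p (u + v) = J p u + J p v"
  using J_linear[of u v 1 1] by simp

lemma J_diff: "u \<in> TM p \<Longrightarrow> v \<in> TM p \<Longrightarrow> J p (u - v) = J p u - J p v"
  using J_linear[of u v 1 "-1"] by simp

lemma J_scale: "u \<in> TM p \<Longrightarrow> J p (a *\<^sub>R u) = a *\<^sub>R J p u"
  using J_linear[of u u a 0] by simp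

lemma J_minus: "u \<in> TM p \<Longrightarrow> J p (- u) = - J p u"
  using J_scale[of u "-1"] by simp

lemma J_zero: "J p 0 = 0"
  using J_scale[OF TM_zero, of 0] by simp

lemma J_J: "v \<in> TM p \<Longrightarrow> J p (J p v) = - v"
  using hermitian p by (simp add: almost_hermitian_def almost_complex_def)

lemma metric_J_J: "u \<in> TM p \<Longrightarrow> v \<in> TM p \<Longrightarrow> g p (J p u) (J p v) = g p u v"
  using hermitian p by (simp add: almost_hermitian_def)

lemma metric_J_right:
  assumes "u \<in> TM p" "v \<in> TM p"
  shows "g p u (J p v) = - g p (J p u) v"
  using metric_J_J[OF assms(1) J_TM[OF assms(2)]] metric_scale_right[OF p assms(2) J_TM[OF assms(1)], of "-1"]
  by (simp add: J_J assms)

lemma J_in_VV: "v \<in> VV p \<Longrightarrow> J p v \<in> VV p" and J_in_HH: "v \<in> HH p \<Longrightarrow> J p v \<in> HH p"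
  using J_VV J_HH p unfolding preserves_def by blast+

lemma vpart_J:
  assumes "v \<in> TM p"
  shows "vpart p (J p v) = J p (vpart p v)"
proof (rule vpart_unique[OF p J_in_VV[OF vpart_VV[OF p assms]]])
  show "J p v - J p (vpart p v) \<in> HH p"
    using J_in_HH[OF hpart_HH[OF p assms]] assms
    by (simp add: hor_part_def J_diff vpart_TM[OF p])
qed

lemma hpart_J: "v \<in> TM p \<Longrightarrow> hpart p (J p v) = J p (hpart p v)"
  by (simp add: hor_part_def vpart_J J_diff vpart_TM[OF p])

lemma vpart_add: "u \<in> TM p \<Longrightarrow> v \<in> TM p \<Longrightarrow> vpart p (u + v) = vpart p u + vpart p v"
  using vpart_linear[OF p, of u v 1 1] by simp

lemma vpart_diff: "u \<in> TM p \<Longrightarrow> v \<in> TM p \<Longrightarrow> vpart p (u - v) = vpart p u - vpart p v"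
  using vpart_linear[OF p, of u v 1 "-1"] by simp

lemma vpart_scale: "u \<in> TM p \<Longrightarrow> vpart p (a *\<^sub>R u) = a *\<^sub>R vpart p u"
  using vpart_linear[OF p, of u u a 0] by simp

lemma hpart_add: "u \<in> TM p \<Longrightarrow> v \<in> TM p \<Longrightarrow> hpart p (u + v) = hpart p u + hpart p v"
  using hpart_linear[OF p, of u v 1 1] by simp

lemma hpart_diff: "u \<in> TM p \<Longrightarrow> v \<in> TM p \<Longrightarrow> hpart p (u - v) = hpart p u - hpart p v"
  using hpart_linear[OF p, of u v 1 "-1"] by simp

lemma hpart_scale: "u \<in> TM p \<Longrightarrow> hpart p (a *\<^sub>R u) = a *\<^sub>R hpart p u"
  using hpart_linear[OF p, of u u a 0] by simp

lemma hpart_vpart: "v \<in> TM p \<Longrightarrow> hpart p (vpart p v) = 0"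
  and vpart_hpart: "v \<in> TM p \<Longrightarrow> vpart p (hpart p v) = 0"
  and hpart_hpart: "v \<in> TM p \<Longrightarrow> hpart p (hpart p v) = hpart p v"
  and vpart_vpart: "v \<in> TM p \<Longrightarrow> vpart p (vpart p v) = vpart p v"
  by (simp_all add: hpart_of_VV[OF p] vpart_of_HH[OF p] hpart_of_HH[OF p] vpart_of_VV[OF p] vpart_VV[OF p] hpart_HH[OF p])

lemma vpart_plus_hpart: "vpart p v + hpart p v = v"
  by (simp add: hor_part_def)

lemma metric_vpart_right:
  assumes "u \<in> TM p" "v \<in> TM p"
  shows "g p u (vpart p v) = g p (vpart p u) (vpart p v)"
  using metric_add_left[OF p vpart_TM[OF p assms(1)] hpart_TM[OF p assms(1)] vpart_TM[OF p assms(2)]]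
    metric_HH_VV[OF hpart_HH[OF p assms(1)] vpart_VV[OF p assms(2)]]
  by (simp add: vpart_plus_hpart)

lemma metric_hpart_right:
  assumes "u \<in> TM p" "v \<in> TM p"
  shows "g p u (hpart p v) = g p (hpart p u) (hpart p v)"
  using metric_add_left[OF p vpart_TM[OF p assms(1)] hpart_TM[OF p assms(1)] hpart_TM[OF p assms(2)]]
    metric_VV_HH[OF p hpart_HH[OF p assms(2)] vpart_VV[OF p assms(1)]]
  by (simp add: vpart_plus_hpart)

lemma metric_hpart_left:
  assumes "u \<in> TM p" "v \<in> TM p"
  shows "g p (hpart p u) v = g p (hpart p u) (hpart p v)"
  using metric_hpart_right[OF assms(2,1)] assms by (simp add: metric_sym[OF p] hpart_TM[OF p])

end

context
  fixes U assumes U: "openin (topo M) U"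
begin

lemma U_points: "q \<in> U \<Longrightarrow> q \<in> points M"
  using U openin_subset by blast

lemma Jf_vfields:
  assumes "X \<in> vfields M U"
  shows "Jf X \<in> vfields M U"
proof -
  have "endo_field M J" using hermitian by (simp add: almost_hermitian_def almost_complex_def)
  then have "\<forall>U. openin (topo M) U \<longrightarrow> (\<forall>X\<in>vfields M U. Jf X \<in> vfields M U)"
    unfolding endo_field_def by (rule conjunct2)
  then show ?thesis using assms U by simp
qed

lemmas Vf_vfields = vfields_vpart[OF U]
lemmas Hf_vfields = vfields_hpart[OF U]
lemmas D_vfields = affine_connectionD(1)[OF affine U]

section \<open>The mixed tensor and its symmetries\<close>

lemma mixed_vfields: "X \<in> vfields M U \<Longrightarrow> Y \<in> vfields M U \<Longrightarrow> mixed X Y \<in> vfields M U"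
  unfolding mixed_def by (intro Hf_vfields D_vfields Vf_vfields)

lemma hat_connection_vfields:
  "X \<in> vfields M U \<Longrightarrow> Y \<in> vfields M U \<Longrightarrow> hat_connection X Y \<in> vfields M U"
  unfolding hat_connection_def
  by (intro vfields_diff[OF U] vfields_scale_const[OF U] vfields_add[OF U] mixed_vfields D_vfields)

lemma Jhf_vfields: "Y \<in> vfields M U \<Longrightarrow> Jhf Y \<in> vfields M U"
  unfolding Jhf_eq by (intro vfields_diff[OF U] Jf_vfields Hf_vfields Vf_vfields)

context
  fixes p assumes pU: "p \<in> U"
begin

lemmas pM = U_points[OF pU]
lemmas at_p = vfieldsD[OF _ pU]

lemma mixed_eq: "mixed X Y p = hpart p (D X (Vf Y) p)"
  by (simp add: mixed_def apply_endo_def)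

lemma mixed_HH: "X \<in> vfields M U \<Longrightarrow> Y \<in> vfields M U \<Longrightarrow> mixed X Y p \<in> HH p"
  unfolding mixed_eq by (intro hpart_HH[OF pM] at_p D_vfields Vf_vfields)

lemma D_split:
  assumes "X \<in> vfields M U" "Y \<in> vfields M U"
  shows "D X Y p = D X (Vf Y) p + D X (Hf Y) p"
proof -
  have "D X Y p = D X (Vf Y + Hf Y) p"
    by (rule affine_connection_cong_right[OF affine U assms _ pU])
       (simp add: apply_endo_def vpart_plus_hpart[OF U_points])
  then show ?thesis
    using affine_connectionD(3)[OF affine U assms(1) Vf_vfields Hf_vfields pU] assms by simp
qed

lemma mixed_add_left:
  assumes "X \<in> vfields M U" "Y \<in> vfields M U" "Z \<in> vfields M U"
  shows "mixed (X + Z) Y p = mixed X Y p + mixed Z Y p"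
  using affine_connectionD(2)[OF affine U assms(1) Vf_vfields[OF assms(2)] assms(3) pU]
  by (simp add: mixed_eq hpart_add[OF pM] at_p D_vfields Vf_vfields assms)

lemma mixed_add_right:
  assumes "X \<in> vfields M U" "Y \<in> vfields M U" "Z \<in> vfields M U"
  shows "mixed X (Y + Z) p = mixed X Y p + mixed X Z p"
proof -
  have "D X (Vf (Y + Z)) p = D X (Vf Y + Vf Z) p"
    using assms
    by (intro affine_connection_cong_right[OF affine U _ _ _ pU] Vf_vfields vfields_add[OF U])
       (simp_all add: apply_endo_def vpart_add[OF U_points] vfieldsD)
  also have "\<dots> = D X (Vf Y) p + D X (Vf Z) p"
    using assms by (intro affine_connectionD(3)[OF affine U] Vf_vfields pU)
  finally show ?thesis
    by (simp add: mixed_eq hpart_add[OF pM] at_p D_vfields Vf_vfields assms)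
qed

lemma mixed_diff_left:
  assumes "X \<in> vfields M U" "Y \<in> vfields M U" "Z \<in> vfields M U"
  shows "mixed (X - Z) Y p = mixed X Y p - mixed Z Y p"
  using mixed_add_left[OF vfields_diff[OF U assms(1,3)] assms(2,3)] by simp

lemma mixed_diff_right:
  assumes "X \<in> vfields M U" "Y \<in> vfields M U" "Z \<in> vfields M U"
  shows "mixed X (Y - Z) p = mixed X Y p - mixed X Z p"
  using mixed_add_right[OF assms(1) vfields_diff[OF U assms(2,3)] assms(3)] by simp

lemma mixed_scale_left:
  assumes "X \<in> vfields M U" "Y \<in> vfields M U" "smooth_fun M U f"
  shows "mixed (\<lambda>q. f q *\<^sub>R X q) Y p = f p *\<^sub>R mixed X Y p"
  using affine_connectionD(4)[OF affine U assms(1) Vf_vfields[OF assms(2)] assms(3) pU]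
  by (simp add: mixed_eq hpart_scale[OF pM] at_p D_vfields Vf_vfields assms)

text \<open>The derivative of \<open>f\<close> multiplies a vertical vector, which the horizontal
  projection kills. This is why \<open>mixed\<close> is a tensor also in its second
  argument.\<close>

lemma mixed_scale_right:
  assumes "X \<in> vfields M U" "Y \<in> vfields M U" "smooth_fun M U f"
  shows "mixed X (\<lambda>q. f q *\<^sub>R Y q) p = f p *\<^sub>R mixed X Y p"
proof -
  have "D X (Vf (\<lambda>q. f q *\<^sub>R Y q)) p = D X (\<lambda>q. f q *\<^sub>R Vf Y q) p"
    using assms
    by (intro affine_connection_cong_right[OF affine U _ _ _ pU] Vf_vfields vfields_scale[OF U])
       (simp_all add: apply_endo_def vpart_scale[OF U_points] vfieldsD)
  also have "\<dots> = deriv_along M f p (X p) *\<^sub>R Vf Y p + f p *\<^sub>R D X (Vf Y) p"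
    using assms by (intro affine_connectionD(5)[OF affine U] Vf_vfields pU)
  finally have eq: "D X (Vf (\<lambda>q. f q *\<^sub>R Y q)) p
      = deriv_along M f p (X p) *\<^sub>R Vf Y p + f p *\<^sub>R D X (Vf Y) p" .
  have "hpart p (Vf Y p) = 0"
    using hpart_vpart[OF pM at_p[OF assms(2)]] by (simp add: apply_endo_def)
  then show ?thesis
    unfolding mixed_eq eq
      hpart_linear[OF pM at_p[OF Vf_vfields[OF assms(2)]] at_p[OF D_vfields[OF assms(1) Vf_vfields[OF assms(2)]]]]
    by simp
qed

lemma mixed_cong:
  assumes "X \<in> vfields M U" "Y \<in> vfields M U" "X' \<in> vfields M U" "Y' \<in> vfields M U"
    and "\<And>q. q \<in> U \<Longrightarrow> X q = X' q" "\<And>q. q \<in> U \<Longrightarrow> Y q = Y' q"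
  shows "mixed X Y p = mixed X' Y' p"
proof -
  have "D X (Vf Y) p = D X' (Vf Y') p"
    using assms by (intro affine_connectionD(6)[OF affine U] Vf_vfields pU) (simp_all add: apply_endo_def)
  then show ?thesis by (simp add: mixed_eq)
qed

text \<open>Total geodesy of the fibers enters the computation here and nowhere else.\<close>

lemma mixed_Vf_left:
  assumes "X \<in> vfields M U" "Y \<in> vfields M U"
  shows "mixed (Vf X) Y p = 0"
  using geodesic[OF U Vf_vfields[OF assms(1)] Vf_vfields[OF assms(2)] _ _ pU] assms
  by (simp add: mixed_eq hpart_of_VV[OF pM] apply_endo_def vpart_VV[OF U_points] vfieldsD)

lemma mixed_Hf_left:
  assumes "X \<in> vfields M U" "Y \<in> vfields M U"
  shows "mixed (Hf X) Y p = mixed X Y p"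
proof -
  have "mixed X Y p = mixed (Vf X + Hf X) Y p"
    using assms by (intro mixed_cong vfields_add[OF U] Vf_vfields Hf_vfields)
      (simp_all add: apply_endo_def vpart_plus_hpart[OF U_points])
  then show ?thesis
    using mixed_add_left[OF Vf_vfields[OF assms(1)] assms(2) Hf_vfields[OF assms(1)]] mixed_Vf_left[OF assms]
    by simp
qed

lemma mixed_Vf_right:
  assumes "X \<in> vfields M U" "Y \<in> vfields M U"
  shows "mixed X (Vf Y) p = mixed X Y p"
proof -
  have "D X (Vf (Vf Y)) p = D X (Vf Y) p"
    using assms by (intro affine_connection_cong_right[OF affine U _ _ _ pU] Vf_vfields)
      (simp_all add: apply_endo_def vpart_vpart[OF U_points] vfieldsD)
  then show ?thesis by (simp add: mixed_eq)
qed

lemma mixed_Hf_right: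
  assumes "X \<in> vfields M U" "Y \<in> vfields M U"
  shows "mixed X (Hf Y) p = 0"
proof -
  have "mixed X Y p = mixed X (Vf Y + Hf Y) p"
    using assms by (intro mixed_cong vfields_add[OF U] Vf_vfields Hf_vfields)
      (simp_all add: apply_endo_def vpart_plus_hpart[OF U_points])
  then show ?thesis
    using mixed_add_right[OF assms(1) Vf_vfields[OF assms(2)] Hf_vfields[OF assms(2)]] mixed_Vf_right[OF assms]
    by simp
qed

text \<open>Vanishing torsion trades the derivative of the vertical field \<open>E\<close> along a
  horizontal field for the derivative along \<open>E\<close> minus a bracket. Summing over both
  orders of \<open>X\<close> and \<open>Z\<close> leaves the derivative of
  \<open>g(H X, H Z)\<close> along \<open>E\<close> minus the bracket terms, which is zero by
  \<open>pullback_invariant\<close>.\<close>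

lemma mixed_skew:
  assumes X: "X \<in> vfields M U" and Y: "Y \<in> vfields M U" and Z: "Z \<in> vfields M U"
  shows "g p (mixed X Y p) (Z p) = - g p (mixed Z Y p) (X p)"
proof -
  let ?E = "Vf Y"
  note E = Vf_vfields[OF Y] and HX = Hf_vfields[OF X] and HZ = Hf_vfields[OF Z]
  have br: "bracket M ?E A p = D ?E A p - D A ?E p" if "A \<in> vfields M U" for A
    using levi_civitaD(2)[OF levi_civita U E that pU] by simp
  have brT: "bracket M ?E A p \<in> TM p" if "A \<in> vfields M U" for A
    unfolding br[OF that] using that E by (intro TM_diff at_p D_vfields)
  have pull: "pullback p u (Hf A p) = g p (Hf A p) u" if "A \<in> vfields M U" "u \<in> TM p" for A u
  proof -
    have A: "Hf A p \<in> HH p" using hpart_HH[OF pM at_p[OF that(1)]] by (simp add: apply_endo_def)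
    have "pullback p u (Hf A p) = g p (hpart p u) (hpart p (A p))"
      using pullback_eq_metric[OF pM that(2) HH_TM[OF A]] by (simp add: apply_endo_def)
    also have "\<dots> = g p u (hpart p (A p))"
      using metric_hpart_right[OF pM that(2) at_p[OF that(1)]] by simp
    finally show ?thesis using metric_sym[OF pM that(2) HH_TM[OF A]] by (simp add: apply_endo_def)
  qed
  \<comment> \<open>General in \<open>A\<close> and \<open>B\<close> because both orders of
    \<open>X\<close> and \<open>Z\<close> are needed.\<close>
  have key: "g p (mixed A Y p) (B p) = g p (Hf B p) (D ?E (Hf A) p) - pullback p (bracket M ?E (Hf A) p) (Hf B p)"
    if A: "A \<in> vfields M U" and B: "B \<in> vfields M U" for A B
  proof -
    note HA = Hf_vfields[OF A] and HB = Hf_vfields[OF B]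
    have "g p (mixed A Y p) (B p) = g p (hpart p (D (Hf A) ?E p)) (B p)"
      using mixed_Hf_left[OF A Y] by (simp add: mixed_eq)
    also have "\<dots> = g p (hpart p (D (Hf A) ?E p)) (hpart p (B p))"
      using A B E by (intro metric_hpart_left[OF pM] at_p D_vfields Hf_vfields)
    also have "\<dots> = g p (D (Hf A) ?E p) (hpart p (B p))"
      using A B E by (intro metric_hpart_right[OF pM, symmetric] at_p D_vfields Hf_vfields)
    also have "\<dots> = g p (Hf B p) (D (Hf A) ?E p)"
      using metric_sym[OF pM at_p[OF D_vfields[OF HA E]] at_p[OF HB]] by (simp add: apply_endo_def)
    also have "D (Hf A) ?E p = D ?E (Hf A) p - bracket M ?E (Hf A) p"
      using br[OF HA] by simp
    also have "g p (Hf B p) \<dots> = g p (Hf B p) (D ?E (Hf A) p) - g p (Hf B p) (bracket M ?E (Hf A) p)"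
      using HA HB E by (intro metric_diff_right[OF pM] brT at_p D_vfields)
    finally show ?thesis using pull[OF B brT[OF HA]] by simp
  qed
  have "deriv_along M (\<lambda>q. g q (Hf X q) (Hf Z q)) p (?E p) = deriv_along M (\<lambda>q. pullback q (Hf X q) (Hf Z q)) p (?E p)"
  proof (rule deriv_along_cong[OF U _ pU])
    show "g q (Hf X q) (Hf Z q) = pullback q (Hf X q) (Hf Z q)" if "q \<in> U" for q
      using submersion_isometry[OF U_points[OF that] hpart_HH hpart_HH] that U_points[OF that] X Z
      by (simp add: apply_endo_def vfieldsD)
  qed
  also have "\<dots> = pullback p (bracket M ?E (Hf X) p) (Hf Z p) + pullback p (Hf X p) (bracket M ?E (Hf Z) p)"
    using Y by (intro pullback_invariant[OF U E HX HZ _ pU] brT HX HZ)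
      (simp add: apply_endo_def vpart_VV[OF U_points] vfieldsD)
  also have "deriv_along M (\<lambda>q. g q (Hf X q) (Hf Z q)) p (?E p) = g p (D ?E (Hf X) p) (Hf Z p) + g p (Hf X p) (D ?E (Hf Z) p)"
    using levi_civitaD(3)[OF levi_civita U E HX HZ pU] .
  finally show ?thesis
    using key[OF X Z] key[OF Z X] metric_sym[OF pM at_p[OF D_vfields[OF E HX]] at_p[OF HZ]]
      pullback_sym[OF pM at_p[OF HX] brT[OF HZ]] by simp
qed

lemma D_Jf: "X \<in> vfields M U \<Longrightarrow> Y \<in> vfields M U \<Longrightarrow> D X (Jf Y) p = J p (D X Y p)"
  using J_parallel[OF U _ _ pU, of X Y] by (simp add: cov_endo_def apply_endo_def[of J "D X Y"])

lemma mixed_Jf_right: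
  assumes "X \<in> vfields M U" "Y \<in> vfields M U"
  shows "mixed X (Jf Y) p = J p (mixed X Y p)"
proof -
  have "D X (Vf (Jf Y)) p = D X (Jf (Vf Y)) p"
    using assms
    by (intro affine_connection_cong_right[OF affine U _ _ _ pU] Vf_vfields Jf_vfields)
       (simp_all add: apply_endo_def vpart_J[OF U_points] vfieldsD)
  also have "\<dots> = J p (D X (Vf Y) p)"
    using assms by (intro D_Jf Vf_vfields)
  finally show ?thesis
    using assms by (simp add: mixed_eq hpart_J[OF pM] at_p D_vfields Vf_vfields)
qed

text \<open>Skewness moves \<open>J X\<close> into the metric slot, the metric passes
  \<open>J\<close> on to \<open>mixed\<close>, where it is absorbed by \<open>Y\<close>, and
  skewness moves \<open>X\<close> back. The sign comes from \<open>J\<close> being skew for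
  \<open>g\<close>, as two uses of skewness cancel.\<close>

lemma mixed_Jf_left:
  assumes X: "X \<in> vfields M U" and Y: "Y \<in> vfields M U"
  shows "mixed (Jf X) Y p = - J p (mixed X Y p)"
proof -
  \<comment> \<open>The defect, taken as a field so that it can be the third argument of
    \<open>mixed_skew\<close>; its length turns out to be zero.\<close>
  define W where "W = mixed (Jf X) Y + Jf (mixed X Y)"
  have W: "W \<in> vfields M U"
    unfolding W_def using X Y by (intro vfields_add[OF U] mixed_vfields Jf_vfields)
  have T: "mixed A B p \<in> TM p" if "A \<in> vfields M U" "B \<in> vfields M U" for A B
    using that by (intro at_p mixed_vfields)
  have "g p (mixed (Jf X) Y p) (W p) = - g p (mixed W Y p) (J p (X p))"
    using mixed_skew[OF Jf_vfields[OF X] Y W] by (simp add: apply_endo_def)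
  also have "\<dots> = g p (mixed W (Jf Y) p) (X p)"
    using metric_J_right[OF pM T[OF W Y] at_p[OF X]] mixed_Jf_right[OF W Y] by simp
  also have "\<dots> = - g p (J p (mixed X Y p)) (W p)"
    using mixed_skew[OF W Jf_vfields[OF Y] X] mixed_Jf_right[OF X Y] by simp
  finally have "g p (W p) (W p) = 0"
    using metric_add_left[OF pM T[OF Jf_vfields[OF X] Y] J_TM[OF pM T[OF X Y]] at_p[OF W]]
    by (simp add: W_def apply_endo_def[of J "mixed X Y"])
  then show ?thesis
    using metric_eq_zero_iff[OF pM at_p[OF W]] by (simp add: W_def apply_endo_def[of J "mixed X Y"] eq_neg_iff_add_eq_0)
qed

section \<open>The connection of the rescaled metric\<close>

lemma hat_connection_eq:
  "hat_connection X Y p = D X Y p - (1/2) *\<^sub>R (mixed X Y p + mixed Y X p)"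
  by (simp add: hat_connection_def scaleR_fun_apply)

lemma hat_connection_add_left:
  assumes "X \<in> vfields M U" "Y \<in> vfields M U" "Z \<in> vfields M U"
  shows "hat_connection (X + Z) Y p = hat_connection X Y p + hat_connection Z Y p"
  unfolding hat_connection_eq affine_connectionD(2)[OF affine U assms pU]
    mixed_add_left[OF assms] mixed_add_right[OF assms(2,1,3)]
  by (simp add: algebra_simps)

lemma hat_connection_add_right:
  assumes "X \<in> vfields M U" "Y \<in> vfields M U" "Z \<in> vfields M U"
  shows "hat_connection X (Y + Z) p = hat_connection X Y p + hat_connection X Z p"
  unfolding hat_connection_eq affine_connectionD(3)[OF affine U assms pU]
    mixed_add_right[OF assms] mixed_add_left[OF assms(2,1,3)]
  by (simp add: algebra_simps)

lemma hat_connection_scale_left: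
  assumes "X \<in> vfields M U" "Y \<in> vfields M U" "smooth_fun M U f"
  shows "hat_connection (\<lambda>q. f q *\<^sub>R X q) Y p = f p *\<^sub>R hat_connection X Y p"
  unfolding hat_connection_eq affine_connectionD(4)[OF affine U assms pU]
    mixed_scale_left[OF assms] mixed_scale_right[OF assms(2,1,3)]
  by (simp add: algebra_simps)

lemma hat_connection_scale_right:
  assumes "X \<in> vfields M U" "Y \<in> vfields M U" "smooth_fun M U f"
  shows "hat_connection X (\<lambda>q. f q *\<^sub>R Y q) p
    = deriv_along M f p (X p) *\<^sub>R Y p + f p *\<^sub>R hat_connection X Y p"
  unfolding hat_connection_eq affine_connectionD(5)[OF affine U assms pU]
    mixed_scale_right[OF assms] mixed_scale_left[OF assms(2,1,3)]
  by (simp add: algebra_simps)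

lemma hat_connection_cong:
  assumes "X \<in> vfields M U" "Y \<in> vfields M U" "X' \<in> vfields M U" "Y' \<in> vfields M U"
    and "\<And>q. q \<in> U \<Longrightarrow> X q = X' q" "\<And>q. q \<in> U \<Longrightarrow> Y q = Y' q"
  shows "hat_connection X Y p = hat_connection X' Y' p"
proof -
  have "mixed X Y p = mixed X' Y' p" "mixed Y X p = mixed Y' X' p"
    using assms by (blast intro: mixed_cong)+
  moreover have "D X Y p = D X' Y' p"
    by (rule affine_connectionD(6)[OF affine U]) (fact assms pU)+
  ultimately show ?thesis by (simp add: hat_connection_eq)
qed

text \<open>Orthogonality removes the cross terms. With \<open>u\<close> left unprojected, a sum in
  the first slot can be expanded directly.\<close>

lemma g_hat_eq:
  assumes "u \<in> TM p" "v \<in> TM p"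
  shows "g_hat p u v = (1/2) * g p u (vpart p v) + g p u (hpart p v)"
  unfolding hat_metric_def metric_vpart_right[OF pM assms, symmetric] metric_hpart_right[OF pM assms, symmetric] ..

text \<open>Differentiating \<open>g(H Y, V Z) = 0\<close> along \<open>X\<close> shows that the
  vertical part of \<open>D X (Hf Y)\<close> is minus an adjoint of \<open>mixed\<close>.\<close>

lemma metric_D_Hf_Vf:
  assumes X: "X \<in> vfields M U" and Y: "Y \<in> vfields M U" and Z: "Z \<in> vfields M U"
  shows "g p (D X (Hf Y) p) (Vf Z p) = - g p (mixed X Z p) (Y p)"
proof -
  note HY = Hf_vfields[OF Y] and VZ = Vf_vfields[OF Z]
  have "deriv_along M (\<lambda>q. g q (Hf Y q) (Vf Z q)) p (X p) = deriv_along M (\<lambda>q. 0) p (X p)"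
  proof (rule deriv_along_cong[OF U _ pU])
    show "g q (Hf Y q) (Vf Z q) = 0" if "q \<in> U" for q
      using metric_HH_VV[OF hpart_HH[OF U_points[OF that] vfieldsD[OF Y that]]
          vpart_VV[OF U_points[OF that] vfieldsD[OF Z that]]]
      by (simp add: apply_endo_def)
  qed
  also have "\<dots> = 0" by (simp add: deriv_along_def)
  finally have "g p (D X (Hf Y) p) (Vf Z p) + g p (Hf Y p) (D X (Vf Z) p) = 0"
    using levi_civitaD(3)[OF levi_civita U X HY VZ pU] by simp
  moreover have "g p (Hf Y p) (D X (Vf Z) p) = g p (mixed X Z p) (Y p)"
    using metric_hpart_left[OF pM at_p[OF Y] at_p[OF D_vfields[OF X VZ]]]
      metric_sym[OF pM hpart_TM[OF pM at_p[OF D_vfields[OF X VZ]]] at_p[OF Y]]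
      metric_sym[OF pM hpart_TM[OF pM at_p[OF Y]] hpart_TM[OF pM at_p[OF D_vfields[OF X VZ]]]]
      metric_hpart_left[OF pM at_p[OF D_vfields[OF X VZ]] at_p[OF Y]]
    by (simp add: mixed_eq apply_endo_def)
  ultimately show ?thesis by linarith
qed

text \<open>The metric halves the term given by \<open>metric_D_Hf_Vf\<close>, and the correction
  halves the horizontal part of \<open>D X (Vf Y)\<close>. These two halves are antisymmetric in
  \<open>Y\<close> and \<open>Z\<close> together, and so is the last term by
  \<open>mixed_skew\<close>; compatibility with the metric can be read off.\<close>

lemma g_hat_hat_connection:
  assumes X: "X \<in> vfields M U" and Y: "Y \<in> vfields M U" and Z: "Z \<in> vfields M U"
  shows "g_hat p (hat_connection X Y p) (Z p) =
    (1/2) * g p (D X (Vf Y) p) (Vf Z p) + g p (D X (Hf Y) p) (Hf Z p)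
     + (1/2) * (g p (mixed X Y p) (Z p) - g p (mixed X Z p) (Y p) - g p (mixed Y X p) (Z p))"
proof -
  define a b m n z where "a = D X (Vf Y) p" and "b = D X (Hf Y) p" and "m = mixed X Y p"
    and "n = mixed Y X p" and "z = Z p"
  have z: "z \<in> TM p" unfolding z_def using Z by (rule at_p)
  have a: "a \<in> TM p" unfolding a_def using X Y by (intro at_p D_vfields Vf_vfields)
  have b: "b \<in> TM p" unfolding b_def using X Y by (intro at_p D_vfields Hf_vfields)
  have mn: "m \<in> HH p" "n \<in> HH p" unfolding m_def n_def using X Y by (simp_all add: mixed_HH)
  note mnT = HH_TM[OF mn(1)] HH_TM[OF mn(2)]
  have vz: "vpart p z \<in> TM p" "hpart p z \<in> TM p" using z by (simp_all add: vpart_TM[OF pM] hpart_TM[OF pM])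
  have w: "hat_connection X Y p = (a + b) - (1/2) *\<^sub>R (m + n)"
    unfolding hat_connection_eq D_split[OF X Y] a_def b_def m_def n_def ..
  have wT: "(a + b) - (1/2) *\<^sub>R (m + n) \<in> TM p"
    using a b mnT by (intro TM_closed)
  have exp: "g p ((a + b) - (1/2) *\<^sub>R (m + n)) t = g p a t + g p b t - (1/2) * (g p m t + g p n t)"
    if "t \<in> TM p" for t
    using that a b mnT
    by (simp add: metric_diff_left[OF pM] metric_add_left[OF pM] metric_scale_left[OF pM] TM_add TM_scale)
  have "g p m (vpart p z) = 0" "g p n (vpart p z) = 0"
    using mn metric_HH_VV[OF _ vpart_VV[OF pM z]] by blast+
  moreover have "g p a (hpart p z) = g p m z" "g p m (hpart p z) = g p m z" "g p n (hpart p z) = g p n z"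
    using metric_hpart_right[OF pM a z] metric_hpart_left[OF pM a z]
      metric_hpart_right[OF pM mnT(1) z] metric_hpart_left[OF pM mnT(1) z]
      metric_hpart_right[OF pM mnT(2) z] metric_hpart_left[OF pM mnT(2) z] mn
    by (simp_all add: hpart_of_HH[OF pM]) (simp_all add: m_def mixed_eq a_def)
  moreover have "g p b (vpart p z) = - g p (mixed X Z p) (Y p)"
    using metric_D_Hf_Vf[OF X Y Z] by (simp add: b_def z_def apply_endo_def[of vpart Z])
  ultimately have "g_hat p (hat_connection X Y p) z = (1/2) * g p a (vpart p z) + g p b (hpart p z)
     + (1/2) * (g p m z - g p (mixed X Z p) (Y p) - g p n z)"
    unfolding w g_hat_eq[OF wT z] exp[OF vz(1)] exp[OF vz(2)] by (simp add: algebra_simps)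
  then show ?thesis
    by (simp add: a_def b_def m_def n_def z_def apply_endo_def[of vpart Z] apply_endo_def[of hpart Z])
qed

section \<open>The covariant derivative of the new structure\<close>

text \<open>The second argument matters only through its vertical part, where \<open>J_hat\<close>
  is \<open>- J\<close>.\<close>

lemma mixed_Jhf_right:
  assumes "X \<in> vfields M U" "Y \<in> vfields M U"
  shows "mixed X (Jhf Y) p = - J p (mixed X Y p)"
  unfolding Jhf_eq
  by (simp add: mixed_diff_right mixed_Jf_right mixed_Hf_right mixed_Vf_right J_zero[OF pM]
      Jf_vfields Hf_vfields Vf_vfields assms)

text \<open>The first argument matters only through its horizontal part, where \<open>J_hat\<close>
  is \<open>J\<close> but \<open>mixed\<close> is conjugate linear. So both slots give the same
  sign.\<close>

lemma mixed_Jhf_left: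
  assumes "X \<in> vfields M U" "Y \<in> vfields M U"
  shows "mixed (Jhf X) Y p = - J p (mixed X Y p)"
  unfolding Jhf_eq
  by (simp add: mixed_diff_left mixed_Jf_left mixed_Hf_left mixed_Vf_left J_zero[OF pM]
      Jf_vfields Hf_vfields Vf_vfields assms)

lemma D_Jhf:
  assumes "X \<in> vfields M U" "Y \<in> vfields M U"
  shows "D X (Jhf Y) p = J p (D X (Hf Y) p) - J p (D X (Vf Y) p)"
  unfolding Jhf_eq
  by (simp add: affine_connection_diff(1)[OF affine U _ _ _ pU] D_Jf
      Jf_vfields Hf_vfields Vf_vfields assms)

lemma cov_endo_hat:
  assumes X: "X \<in> vfields M U" and Y: "Y \<in> vfields M U"
  shows "cov_endo hat_connection J_hat X Y p
    = J p (2 *\<^sub>R vpart p (D X (Hf Y) p) + mixed Y X p - mixed X Y p)"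
proof -
  define a b where "a = D X (Vf Y) p" and "b = D X (Hf Y) p"
  \<comment> \<open>Halves of the mixed terms: \<open>hat_connection\<close> subtracts
    \<open>m + n\<close> and the horizontal part of \<open>a\<close> is \<open>m + m\<close>, which
    leaves an identity in an abelian group.\<close>
  define m n where "m = (1/2) *\<^sub>R mixed X Y p" and "n = (1/2) *\<^sub>R mixed Y X p"
  have aT: "a \<in> TM p" unfolding a_def using X Y by (intro at_p D_vfields Vf_vfields)
  have bT: "b \<in> TM p" unfolding b_def using X Y by (intro at_p D_vfields Hf_vfields)
  have mn: "m \<in> HH p" "n \<in> HH p"
    unfolding m_def n_def using X Y by (simp_all add: mixed_HH subspace_scale[OF subspace_HH[OF pM]])
  note mnT = HH_TM[OF mn(1)] HH_TM[OF mn(2)]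
  have M2: "mixed X Y p = m + m" "mixed Y X p = n + n"
    by (simp_all add: m_def n_def flip: scaleR_add_left)
  define va vb hb where "va = vpart p a" and "vb = vpart p b" and "hb = hpart p b"
  have T: "va \<in> TM p" "vb \<in> TM p" "hb \<in> TM p" "m \<in> TM p" "n \<in> TM p"
    unfolding va_def vb_def hb_def using aT bT mnT by (auto intro: vpart_TM[OF pM] hpart_TM[OF pM])
  have "hpart p a = m + m" using M2(1) by (simp add: mixed_eq a_def)
  then have a: "a = va + (m + m)" using vpart_plus_hpart[OF pM, of a] by (simp add: va_def)
  have b: "b = vb + hb" using vpart_plus_hpart[OF pM, of b] by (simp add: vb_def hb_def)
  have w: "hat_connection X Y p = (a + b) - (m + n)"
    unfolding hat_connection_eq D_split[OF X Y] a_def b_def m_def n_def by (simp add: scaleR_add_right)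
  have vw: "vpart p (hat_connection X Y p) = va + vb"
    using aT bT mnT mn unfolding w
    by (simp add: vpart_diff[OF pM] vpart_add[OF pM] vpart_of_HH[OF pM] TM_closed va_def vb_def)
  have hw: "hpart p (hat_connection X Y p) = (m + m) + hb - (m + n)"
    using aT bT mnT mn \<open>hpart p a = m + m\<close> unfolding w
    by (simp add: hpart_diff[OF pM] hpart_add[OF pM] hpart_of_HH[OF pM] TM_closed hb_def)
  have "cov_endo hat_connection J_hat X Y p = hat_connection X (Jhf Y) p - J_hat p (hat_connection X Y p)"
    by (simp add: cov_endo_def apply_endo_def[of J_hat "hat_connection X Y"])
  also have "hat_connection X (Jhf Y) p = J p b - J p a - (1/2) *\<^sub>R (- J p (mixed X Y p) + - J p (mixed Y X p))"
    unfolding hat_connection_eq D_Jhf[OF X Y] mixed_Jhf_right[OF X Y] mixed_Jhf_left[OF Y X] a_def b_def ..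
  also have "\<dots> = J p b - J p a + J p m + J p n"
    unfolding m_def n_def using X Y
    by (simp add: J_scale[OF pM] at_p mixed_vfields scaleR_diff_right)
  also have "J_hat p (hat_connection X Y p) = J p ((m + m) + hb - (m + n)) - J p (va + vb)"
    unfolding hat_structure_def vw hw by simp
  finally have "cov_endo hat_connection J_hat X Y p = J p vb + J p vb + (J p n + J p n) - (J p m + J p m)"
    unfolding a b J_add[OF pM T(2,3)] J_add[OF pM T(1,2)] J_add[OF pM T(1) TM_add[OF T(4,4)]]
      J_diff[OF pM TM_add[OF TM_add[OF T(4,4)] T(3)] TM_add[OF T(4,5)]]
      J_add[OF pM TM_add[OF T(4,4)] T(3)] J_add[OF pM T(4,4)] J_add[OF pM T(4,5)]
    by (simp only: cov_endo_hat_algebra)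
  also have "\<dots> = J p ((vb + vb) + (n + n) - (m + m))"
    using T by (simp add: J_add[OF pM] J_diff[OF pM] TM_closed)
  also have "(vb + vb) + (n + n) - (m + m) = 2 *\<^sub>R vpart p (D X (Hf Y) p) + mixed Y X p - mixed X Y p"
    unfolding M2 vb_def b_def by (simp add: scaleR_2)
  finally show ?thesis .
qed

text \<open>By skewness \<open>mixed X Z\<close> is orthogonal to \<open>X\<close> for every
  \<open>Z\<close>, so \<open>metric_D_Hf_Vf\<close> makes \<open>D X (Hf X)\<close> orthogonal to
  vertical vectors. It is tested against its own vertical part.\<close>

lemma vpart_D_Hf_self:
  assumes X: "X \<in> vfields M U"
  shows "vpart p (D X (Hf X) p) = 0"
proof -
  let ?Z = "D X (Hf X)"
  have Z: "?Z \<in> vfields M U" using X by (intro D_vfields Hf_vfields)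
  have "g p (mixed X ?Z p) (X p) = 0" using mixed_skew[OF X Z X] by simp
  then have "g p (?Z p) (vpart p (?Z p)) = 0"
    using metric_D_Hf_Vf[OF X X Z] by (simp add: apply_endo_def[of vpart ?Z])
  then have "g p (vpart p (?Z p)) (vpart p (?Z p)) = 0"
    using metric_vpart_right[OF pM at_p[OF Z] at_p[OF Z]] by simp
  then show ?thesis
    using metric_eq_zero_iff[OF pM vpart_TM[OF pM at_p[OF Z]]] by simp
qed

lemma cov_endo_hat_self: "X \<in> vfields M U \<Longrightarrow> cov_endo hat_connection J_hat X X p = 0"
  by (simp add: cov_endo_hat vpart_D_Hf_self J_zero[OF pM])

text \<open>In \<open>cov_endo_hat\<close> for \<open>Jhf Y\<close> every term carries
  \<open>J\<close> twice, and \<open>J\<close> squares to minus the identity. Half of the result,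
  \<open>n - m - vpart p b\<close>, removes precisely the vertical part of \<open>D X (Hf Y)\<close>
  and the mixed terms of \<open>hat_connection\<close>.\<close>

lemma canonical_hat:
  assumes X: "X \<in> vfields M U" and Y: "Y \<in> vfields M U"
  shows "canonical_hermitian_connection hat_connection J_hat X Y p
    = vpart p (D X (Vf Y) p) + hpart p (D X (Hf Y) p)"
proof -
  define a b where "a = D X (Vf Y) p" and "b = D X (Hf Y) p"
  define m n where "m = (1/2) *\<^sub>R mixed X Y p" and "n = (1/2) *\<^sub>R mixed Y X p"
  have bT: "b \<in> TM p" unfolding b_def using X Y by (intro at_p D_vfields Hf_vfields)
  have M2: "mixed X Y p = m + m" "mixed Y X p = n + n"
    by (simp_all add: m_def n_def flip: scaleR_add_left)
  have T: "m \<in> TM p" "n \<in> TM p" "vpart p b \<in> TM p"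
    unfolding m_def n_def using X Y vpart_TM[OF pM bT] by (simp_all add: TM_scale at_p mixed_vfields)
  have "D X (Hf (Jhf Y)) p = D X (Jf (Hf Y)) p"
  proof (rule affine_connection_cong_right[OF affine U X _ _ pU])
    show "Hf (Jhf Y) \<in> vfields M U" using Y by (intro Hf_vfields Jhf_vfields)
    show "Hf (Jhf Y) q = Jf (Hf Y) q" if "q \<in> U" for q
      using U_points[OF that] vfieldsD[OF Y that]
      by (simp add: Jhf_eq, simp add: apply_endo_def hpart_diff hpart_J J_TM hpart_TM vpart_TM
          hpart_hpart hpart_vpart J_zero)
  qed
  also have "\<dots> = J p b" unfolding b_def using X Y by (intro D_Jf Hf_vfields)
  finally have "vpart p (D X (Hf (Jhf Y)) p) = J p (vpart p b)"
    by (simp add: vpart_J[OF pM bT])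
  then have "cov_endo hat_connection J_hat X (Jhf Y) p
    = J p (2 *\<^sub>R J p (vpart p b) + - J p (mixed Y X p) - - J p (mixed X Y p))"
    by (simp add: cov_endo_hat[OF X Jhf_vfields[OF Y]] mixed_Jhf_left[OF Y X] mixed_Jhf_right[OF X Y])
  also have "\<dots> = (n + n) - (m + m) - (vpart p b + vpart p b)"
    unfolding M2 using T
    by (simp add: J_add[OF pM] J_diff[OF pM] J_minus[OF pM] J_scale[OF pM] J_J[OF pM] J_TM[OF pM] TM_closed scaleR_2)
  finally have "(1/2) *\<^sub>R cov_endo hat_connection J_hat X (Jhf Y) p = n - m - vpart p b"
    by (simp add: scaleR_diff_right flip: scaleR_2)
  moreover have "hat_connection X Y p = (a + b) - (m + n)"
    unfolding hat_connection_eq D_split[OF X Y] a_def b_def m_def n_def by (simp add: scaleR_add_right)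
  moreover have "a = vpart p a + (m + m)"
    using vpart_plus_hpart[OF pM, of a] M2(1) by (simp add: mixed_eq a_def)
  moreover have "b = vpart p b + hpart p b" using vpart_plus_hpart[OF pM, of b] by simp
  ultimately have "hat_connection X Y p + (1/2) *\<^sub>R cov_endo hat_connection J_hat X (Jhf Y) p
    = vpart p a + hpart p b"
    by (metis canonical_hat_algebra)
  then show ?thesis
    by (simp add: canonical_hermitian_connection_def scaleR_fun_apply a_def b_def)
qed

end

end

end

context kaehler_submersion
begin

section \<open>The rescaled manifold is nearly Kaehler\<close>

lemma affine_hat_connection: "affine_connection M hat_connection"
  unfolding affine_connection_def
proof (intro allI impI ballI conjI)
  fix U X Y assume *: "openin (topo M) U" "X \<in> vfields M U" "Y \<in> vfields M U"
  show "hat_connection X Y \<in> vfields M U" using * by (rule hat_connection_vfields)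
  fix Z p assume "Z \<in> vfields M U" "p \<in> U"
  then show "hat_connection (X + Z) Y p = hat_connection X Y p + hat_connection Z Y p"
    "hat_connection X (Y + Z) p = hat_connection X Y p + hat_connection X Z p"
    using * hat_connection_add_left hat_connection_add_right by blast+
next
  fix U X Y f p assume "openin (topo M) U" "X \<in> vfields M U" "Y \<in> vfields M U" "smooth_fun M U f" "p \<in> U"
  then show "hat_connection (\<lambda>q. f q *\<^sub>R X q) Y p = f p *\<^sub>R hat_connection X Y p"
    "hat_connection X (\<lambda>q. f q *\<^sub>R Y q) p = deriv_along M f p (X p) *\<^sub>R Y p + f p *\<^sub>R hat_connection X Y p"
    using hat_connection_scale_left hat_connection_scale_right by blast+
next
  fix U X Y X' Y' p
  assume "openin (topo M) U" "X \<in> vfields M U" "Y \<in> vfields M U" "X' \<in> vfields M U" "Y' \<in> vfields M U"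
    and "\<forall>p\<in>U. X p = X' p \<and> Y p = Y' p" and "p \<in> U"
  then show "hat_connection X Y p = hat_connection X' Y' p"
    by (intro hat_connection_cong[of U]) auto
qed

lemma g_hat_sym:
  assumes "p \<in> points M" "u \<in> TM p" "v \<in> TM p"
  shows "g_hat p u v = g_hat p v u"
  using assms by (simp add: hat_metric_def metric_sym[of p "vpart p u"] metric_sym[of p "hpart p u"] vpart_TM hpart_TM)

lemma g_hat_fields:
  "g_hat q (X q) (Y q) = (1/2) * g q (Vf X q) (Vf Y q) + 1 * g q (Hf X q) (Hf Y q)"
  by (simp add: hat_metric_def apply_endo_def)

lemma riemannian_g_hat: "riemannian_metric M g_hat"
  unfolding riemannian_metric_def
proof (intro conjI ballI allI impI)
  fix p u v assume p: "p \<in> points M" and u: "u \<in> TM p" and v: "v \<in> TM p"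
  show "g_hat p u v = g_hat p v u" using p u v by (rule g_hat_sym)
  show "g_hat p (a *\<^sub>R u + b *\<^sub>R v) w = a * g_hat p u w + b * g_hat p v w" if w: "w \<in> TM p" for a b w
    unfolding hat_metric_def vpart_linear[OF p u v] hpart_linear[OF p u v]
      metric_linear_left[OF p vpart_TM[OF p u] vpart_TM[OF p v] vpart_TM[OF p w]]
      metric_linear_left[OF p hpart_TM[OF p u] hpart_TM[OF p v] hpart_TM[OF p w]]
    by (simp add: algebra_simps add_divide_distrib)
  show "g_hat p u u > 0" if "u \<noteq> 0"
  proof -
    have nonneg: "g p w w \<ge> 0" if "w \<in> TM p" for w
      using metric_pos[OF p that] metric_zero_left[OF p TM_zero] by (cases "w = 0") auto
    have "vpart p u \<noteq> 0 \<or> hpart p u \<noteq> 0"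
      using that by (auto simp: hor_part_def)
    then show ?thesis
      using metric_pos[OF p vpart_TM[OF p u]] metric_pos[OF p hpart_TM[OF p u]]
        nonneg[OF vpart_TM[OF p u]] nonneg[OF hpart_TM[OF p u]]
      unfolding hat_metric_def by fastforce
  qed
next
  fix U X Y assume U: "openin (topo M) U" and X: "X \<in> vfields M U" and Y: "Y \<in> vfields M U"
  show "smooth_fun M U (\<lambda>p. g_hat p (X p) (Y p))"
    unfolding g_hat_fields
    by (intro smooth_fun_add[OF U] smooth_fun_mult[OF U] smooth_fun_const smooth_fun_metric[OF U]
        vfields_vpart[OF U] vfields_hpart[OF U] X Y)
qed

lemma levi_civita_hat_connection: "levi_civita M g_hat hat_connection"
  unfolding levi_civita_def
proof (intro conjI allI impI ballI)
  fix U X Y p assume *: "openin (topo M) U" "X \<in> vfields M U" "Y \<in> vfields M U" "p \<in> U"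
  show "hat_connection X Y p - hat_connection Y X p = bracket M X Y p"
    using levi_civitaD(2)[OF levi_civita *] by (simp add: hat_connection_eq[OF *(1,4)] add.commute)
next
  fix U X Y Z p assume U: "openin (topo M) U" and X: "X \<in> vfields M U" and Y: "Y \<in> vfields M U"
    and pU: "p \<in> U" and Z: "Z \<in> vfields M U"
  have p: "p \<in> points M" using U_points[OF U pU] .
  note VX = vfields_vpart[OF U] and HX = vfields_hpart[OF U]
  have t: "A p \<in> TM p" if "A \<in> vfields M U" for A using vfieldsD[OF that pU] .
  have "deriv_along M (\<lambda>q. g_hat q (Y q) (Z q)) p (X p)
    = (1/2) * (g p (D X (Vf Y) p) (Vf Z p) + g p (Vf Y p) (D X (Vf Z) p))
      + 1 * (g p (D X (Hf Y) p) (Hf Z p) + g p (Hf Y p) (D X (Hf Z) p))"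
    unfolding g_hat_fields levi_civitaD(3)[OF levi_civita U X VX[OF Y] VX[OF Z] pU, symmetric]
      levi_civitaD(3)[OF levi_civita U X HX[OF Y] HX[OF Z] pU, symmetric]
    by (rule deriv_along_add[OF U _ _ pU t[OF X]]) (intro smooth_fun_metric[OF U] VX HX Y Z)+
  moreover have "g p (Vf Y p) (D X (Vf Z) p) = g p (D X (Vf Z) p) (Vf Y p)"
    "g p (Hf Y p) (D X (Hf Z) p) = g p (D X (Hf Z) p) (Hf Y p)"
    using p X Y Z by (auto intro!: metric_sym t D_vfields[OF U] VX HX)
  moreover have "g_hat p (Y p) (hat_connection X Z p) = g_hat p (hat_connection X Z p) (Y p)"
    using X Y Z by (intro g_hat_sym[OF p] t hat_connection_vfields[OF U])
  \<comment> \<open>In the sum of the two instances of \<open>g_hat_hat_connection\<close> only the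
    mixed terms with \<open>X\<close> in the second slot survive; they cancel by skewness.\<close>
  moreover have "g p (mixed Y X p) (Z p) = - g p (mixed Z X p) (Y p)"
    using mixed_skew[OF U pU Y X Z] .
  ultimately show "deriv_along M (\<lambda>q. g_hat q (Y q) (Z q)) p (X p)
      = g_hat p (hat_connection X Y p) (Z p) + g_hat p (Y p) (hat_connection X Z p)"
    using g_hat_hat_connection[OF U pU X Y Z] g_hat_hat_connection[OF U pU X Z Y]
    by (simp add: algebra_simps)
qed (rule affine_hat_connection)

context
  fixes p assumes p: "p \<in> points M"
begin

lemma J_hat_eq: "J_hat p v = J p (hpart p v) - J p (vpart p v)"
  by (intro ext) (simp add: hat_structure_def)

lemma J_hat_TM: "v \<in> TM p \<Longrightarrow> J_hat p v \<in> TM p"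
  unfolding J_hat_eq by (intro TM_diff J_TM[OF p] hpart_TM[OF p] vpart_TM[OF p])

lemma vpart_J_hat: "v \<in> TM p \<Longrightarrow> vpart p (J_hat p v) = - J p (vpart p v)"
  unfolding J_hat_eq
  by (subst vpart_diff[OF p]) (simp_all add: J_TM[OF p] hpart_TM[OF p] vpart_TM[OF p] vpart_J[OF p]
      vpart_hpart[OF p] vpart_vpart[OF p] J_zero[OF p])

lemma hpart_J_hat: "v \<in> TM p \<Longrightarrow> hpart p (J_hat p v) = J p (hpart p v)"
  unfolding J_hat_eq
  by (subst hpart_diff[OF p]) (simp_all add: J_TM[OF p] hpart_TM[OF p] vpart_TM[OF p] hpart_J[OF p]
      hpart_hpart[OF p] hpart_vpart[OF p] J_zero[OF p])

lemma J_hat_J_hat: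
  assumes v: "v \<in> TM p"
  shows "J_hat p (J_hat p v) = - v"
proof -
  have "J_hat p (J_hat p v) = J p (J p (hpart p v)) - J p (- J p (vpart p v))"
    unfolding J_hat_eq[of "J_hat p v"] vpart_J_hat[OF v] hpart_J_hat[OF v] ..
  also have "\<dots> = - (vpart p v + hpart p v)"
    using v by (simp add: J_minus[OF p] J_TM[OF p] J_J[OF p] vpart_TM[OF p] hpart_TM[OF p])
  finally show ?thesis by (simp only: vpart_plus_hpart[OF p])
qed

lemma J_hat_linear:
  assumes u: "u \<in> TM p" and v: "v \<in> TM p"
  shows "J_hat p (a *\<^sub>R u + b *\<^sub>R v) = a *\<^sub>R J_hat p u + b *\<^sub>R J_hat p v"
  unfolding J_hat_eq vpart_linear[OF p u v] hpart_linear[OF p u v]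
    J_linear[OF p vpart_TM[OF p u] vpart_TM[OF p v]] J_linear[OF p hpart_TM[OF p u] hpart_TM[OF p v]]
  by (simp only: scaleR_diff_right add_diff_add)

lemma g_hat_J_hat:
  assumes u: "u \<in> TM p" and v: "v \<in> TM p"
  shows "g_hat p (J_hat p u) (J_hat p v) = g_hat p u v"
proof -
  have "g p (- J p (vpart p u)) (- J p (vpart p v)) = g p (vpart p u) (vpart p v)"
    using u v metric_scale_left[OF p, of "J p (vpart p u)" "- J p (vpart p v)" "-1"]
      metric_scale_right[OF p, of "J p (vpart p v)" "J p (vpart p u)" "-1"]
    by (simp add: J_TM[OF p] vpart_TM[OF p] TM_minus metric_J_J[OF p])
  then show ?thesis
    unfolding hat_metric_def vpart_J_hat[OF u] vpart_J_hat[OF v] hpart_J_hat[OF u] hpart_J_hat[OF v]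
    using u v by (simp add: metric_J_J[OF p] hpart_TM[OF p])
qed

end

lemma almost_hermitian_hat: "almost_hermitian M g_hat J_hat"
proof -
  have "endo_field M J_hat"
    unfolding endo_field_def
    by (intro conjI ballI allI impI J_hat_TM J_hat_linear Jhf_vfields)
  then show ?thesis
    using smooth_manifold riemannian_g_hat
    by (simp add: almost_hermitian_def almost_complex_def J_hat_J_hat g_hat_J_hat)
qed

lemma nearly_kaehler_hat: "nearly_kaehler M g_hat J_hat"
  unfolding nearly_kaehler_def
  using almost_hermitian_hat levi_civita_hat_connection cov_endo_hat_self by blast

section \<open>The canonical Hermitian connection\<close>

text \<open>The theorem quantifies over all Levi-Civita connections of the rescaled metric. By
  uniqueness each agrees with \<open>hat_connection\<close> on fields, hence so do the canonical
  connections.\<close>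

lemma canonical_levi_civita:
  assumes D': "levi_civita M g_hat D'" and U: "openin (topo M) U"
    and X: "X \<in> vfields M U" and Y: "Y \<in> vfields M U" and pU: "p \<in> U"
  shows "canonical_hermitian_connection D' J_hat X Y p = vpart p (D X (Vf Y) p) + hpart p (D X (Hf Y) p)"
proof -
  interpret hat: riem_mfd M g_hat by unfold_locales (rule riemannian_g_hat)
  have eq: "D' X Z p = hat_connection X Z p" if "Z \<in> vfields M U" for Z
    using hat.levi_civita_unique[OF D' levi_civita_hat_connection U X that pU] .
  note JY = Jhf_vfields[OF U Y]
  have "canonical_hermitian_connection D' J_hat X Y p = canonical_hermitian_connection hat_connection J_hat X Y p"
    \<comment> \<open>Unfolding the canonical connection differentiates \<open>Y\<close>,
      \<open>J_hat Y\<close> and \<open>J_hat (J_hat Y)\<close>.\<close>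
    using eq[OF Y] eq[OF JY] eq[OF Jhf_vfields[OF U JY]]
    by (simp add: canonical_hermitian_connection_def cov_endo_def scaleR_fun_apply apply_endo_def[of J_hat "D' X _"]
        apply_endo_def[of J_hat "hat_connection X _"])
  then show ?thesis using canonical_hat[OF U pU X Y] by simp
qed

lemma canonical_parallel:
  assumes D': "levi_civita M g_hat D'"
  shows "parallel_distribution M (canonical_hermitian_connection D' J_hat) VV"
    and "parallel_distribution M (canonical_hermitian_connection D' J_hat) HH"
proof -
  \<comment> \<open>\<open>Z\<close> is known to vanish on \<open>U\<close> only: locality replaces
    it by \<open>Z + Z\<close>, and additivity then forces the derivative to be 0.\<close>
  have zero: "D X Z p = 0" if U: "openin (topo M) U" and X: "X \<in> vfields M U" and Z: "Z \<in> vfields M U"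
      and "\<And>q. q \<in> U \<Longrightarrow> Z q = 0" and pU: "p \<in> U" for U X Z p
  proof -
    have "D X Z p = D X (Z + Z) p"
      by (rule affine_connection_cong_right[OF affine U X Z _ pU]) (simp add: that(4))
    then show ?thesis using affine_connectionD(3)[OF affine U X Z Z pU] by simp
  qed
  show "parallel_distribution M (canonical_hermitian_connection D' J_hat) VV"
    unfolding parallel_distribution_def
  proof (intro allI impI ballI)
    fix U X Y p assume U: "openin (topo M) U" and X: "X \<in> vfields M U" and Y: "Y \<in> vfields M U"
      and V: "\<forall>q\<in>U. Y q \<in> VV q" and pU: "p \<in> U"
    have p: "p \<in> points M" using U_points[OF U pU] .
    have "D X (Hf Y) p = 0"
      using V by (intro zero[OF U X vfields_hpart[OF U Y] _ pU]) (simp add: apply_endo_def hpart_of_VV U_points[OF U])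
    then show "canonical_hermitian_connection D' J_hat X Y p \<in> VV p"
      using vpart_VV[OF p vfieldsD[OF D_vfields[OF U X vfields_vpart[OF U Y]] pU]]
        hpart_of_VV[OF p subspace_0[OF subspace_VV[OF p]]]
      by (simp add: canonical_levi_civita[OF D' U X Y pU])
  qed
  show "parallel_distribution M (canonical_hermitian_connection D' J_hat) HH"
    unfolding parallel_distribution_def
  proof (intro allI impI ballI)
    fix U X Y p assume U: "openin (topo M) U" and X: "X \<in> vfields M U" and Y: "Y \<in> vfields M U"
      and H: "\<forall>q\<in>U. Y q \<in> HH q" and pU: "p \<in> U"
    have p: "p \<in> points M" using U_points[OF U pU] .
    have "D X (Vf Y) p = 0"
      using H by (intro zero[OF U X vfields_vpart[OF U Y] _ pU]) (simp add: apply_endo_def vpart_of_HH U_points[OF U])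
    then show "canonical_hermitian_connection D' J_hat X Y p \<in> HH p"
      using hpart_HH[OF p vfieldsD[OF D_vfields[OF U X vfields_hpart[OF U Y]] pU]]
        vpart_of_HH[OF p subspace_0[OF subspace_HH[OF p]]]
      by (simp add: canonical_levi_civita[OF D' U X Y pU])
  qed
qed

text \<open>The horizontal part of the canonical derivative is that of \<open>D X (Hf Y)\<close>, so
  the product rule is compatibility of \<open>D\<close> with \<open>g\<close>, applied to
  \<open>Hf Y\<close>. It supplies the hypothesis of \<open>reduced_holonomyI\<close>.\<close>

lemma pullback_canonical:
  assumes D': "levi_civita M g_hat D'" and U: "openin (topo M) U"
    and X: "X \<in> vfields M U" and Y: "Y \<in> vfields M U" and pU: "p \<in> U"
  shows "canonical_hermitian_connection D' J_hat X Y p \<in> TM p"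
    and "deriv_along M (\<lambda>q. pullback q (Y q) (Y q)) p (X p)
      = 2 * pullback p (canonical_hermitian_connection D' J_hat X Y p) (Y p)"
proof -
  let ?K = "canonical_hermitian_connection D' J_hat X Y p"
  have p: "p \<in> points M" using U_points[OF U pU] .
  note HY = vfields_hpart[OF U Y]
  define a b where "a = D X (Vf Y) p" and "b = D X (Hf Y) p"
  have a: "a \<in> TM p" unfolding a_def using vfieldsD[OF D_vfields[OF U X vfields_vpart[OF U Y]] pU] .
  have b: "b \<in> TM p" unfolding b_def using vfieldsD[OF D_vfields[OF U X HY] pU] .
  have y: "Y p \<in> TM p" using vfieldsD[OF Y pU] .
  have K: "?K = vpart p a + hpart p b"
    unfolding a_def b_def using canonical_levi_civita[OF assms] .
  show KT: "?K \<in> TM p" unfolding K using a b by (intro TM_add vpart_TM[OF p] hpart_TM[OF p])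
  have hK: "hpart p ?K = hpart p b"
    unfolding K using a b by (simp add: hpart_add[OF p] vpart_TM[OF p] hpart_TM[OF p] hpart_vpart[OF p] hpart_hpart[OF p])
  have "deriv_along M (\<lambda>q. pullback q (Y q) (Y q)) p (X p) = deriv_along M (\<lambda>q. g q (Hf Y q) (Hf Y q)) p (X p)"
  proof (rule deriv_along_cong[OF U _ pU])
    show "pullback q (Y q) (Y q) = g q (Hf Y q) (Hf Y q)" if "q \<in> U" for q
      using pullback_eq_metric[OF U_points[OF U that], of "Y q" "Y q"]
        metric_hpart_left[OF U_points[OF U that], of "Y q" "Y q"] vfieldsD[OF Y that]
      by (simp add: apply_endo_def)
  qed
  also have "\<dots> = g p b (Hf Y p) + g p (Hf Y p) b"
    unfolding b_def by (rule levi_civitaD(3)[OF levi_civita U X HY HY pU])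
  also have "g p (Hf Y p) b = g p b (Hf Y p)"
    using vfieldsD[OF HY pU] b by (intro metric_sym[OF p])
  also have "g p b (Hf Y p) = pullback p ?K (Y p)"
    unfolding pullback_eq_metric[OF p KT y] hK apply_endo_def metric_hpart_right[OF p b y] metric_hpart_left[OF p b y] ..
  finally show "deriv_along M (\<lambda>q. pullback q (Y q) (Y q)) p (X p) = 2 * pullback p ?K (Y p)" by simp
qed

end

section \<open>Holonomy\<close>

context riem_submersion
begin

definition pullback_coeff :: "('m, 'e) chart \<Rightarrow> 'e \<Rightarrow> 'e \<Rightarrow> 'e \<Rightarrow> real"
  where "pullback_coeff c x u v = pullback (cinv c x) (coord_field M c u (cinv c x)) (coord_field M c v (cinv c x))"

lemma pullback_linear_left:
  assumes p: "p \<in> points M" and "u \<in> TM p" "v \<in> TM p" "w \<in> TM p"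
  shows "pullback p (a *\<^sub>R u + b *\<^sub>R v) w = a * pullback p u w + b * pullback p v w"
  using assms
  by (simp add: pullback_eq_metric[OF p] TM_closed hpart_linear[OF p] metric_linear_left[OF p] hpart_TM[OF p])

lemma bilinear_pullback_coeff:
  assumes "c \<in> atlas M" "x \<in> cmap c ` cdom c"
  shows "bilinear (pullback_coeff c x)"
proof -
  obtain q where q: "q \<in> cdom c" "x = cmap c q" "cinv c x = q" using assms by (auto simp: cinv_cmap)
  have c: "c \<in> charts_at M q" and p: "q \<in> points M"
    using q assms(1) cdom_subset_points by (auto simp: mem_charts_at)
  note t = coord_field_tangent[OF c] and l = linear_coord_field[OF c]
  have lin: "linear (\<lambda>u. pullback_coeff c x u v)" for v
    using pullback_linear_left[OF p t t t, of 1 _ 1] pullback_linear_left[OF p t t t, of _ _ 0]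
    by (intro linearI) (simp_all add: pullback_coeff_def q(3) linear_add[OF l] linear_cmul[OF l])
  have sym: "pullback_coeff c x u v = pullback_coeff c x v u" for u v
    unfolding pullback_coeff_def q(3) using pullback_sym[OF p t t] .
  have "linear (pullback_coeff c x u)" for u
    using lin[of u] by (simp add: sym[of _ u])
  then show ?thesis using lin by (simp add: bilinear_def)
qed

lemma smooth_on_pullback_coeff:
  assumes c: "c \<in> atlas M"
  shows "smooth_on (cmap c ` cdom c) (\<lambda>x. pullback_coeff c x u v)"
  using bspec[OF smooth_fun_pullback[OF openin_cdom[OF c] coord_field_vfields[OF c, of u]
      coord_field_vfields[OF c, of v], unfolded smooth_fun_def] c]
  by (simp add: pullback_coeff_def)

text \<open>
  Conservation of the degenerate length \<open>pullback\<close>, which vanishes exactly on vertical vectors,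
  replaces a uniqueness theorem for the transport equation.
\<close>

lemma pullback_parallel_arc:
  assumes K: "\<And>U X Y p. openin (topo M) U \<Longrightarrow> X \<in> vfields M U \<Longrightarrow> Y \<in> vfields M U \<Longrightarrow> p \<in> U \<Longrightarrow>
      K X Y p \<in> TM p \<and> deriv_along M (\<lambda>q. pullback q (Y q) (Y q)) p (X p) = 2 * pullback p (K X Y p) (Y p)"
    and par: "parallel_along M K \<gamma> s" and arc: "C1_arc M \<gamma> a b" and ab: "0 \<le> a" "a < b" "b \<le> 1"
  shows "pullback (\<gamma> b) (s b) (s b) = pullback (\<gamma> a) (s a) (s a)"
proof -
  let ?f = "\<lambda>t. pullback (\<gamma> t) (s t) (s t)" and ?I = "{a..b}"
  have cont: "continuous_map (top_of_set ?I) (topo M) \<gamma>" using arc by (simp add: C1_arc_def)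
  have sT: "s t \<in> TM (\<gamma> t)" if "t \<in> ?I" for t
    using par that ab by (auto simp: parallel_along_def)
  have "(?f has_derivative (\<lambda>h. 0)) (at t within ?I)" if t: "t \<in> ?I" for t
  proof -
    have p: "\<gamma> t \<in> points M" using cont t by (auto simp: continuous_map_def)
    obtain c where c: "c \<in> charts_at M (\<gamma> t)" using charts_at_nonempty[OF p] by blast
    then have ca: "c \<in> atlas M" "\<gamma> t \<in> cdom c" by (auto simp: mem_charts_at)
    let ?x = "cmap c (\<gamma> t)" and ?S = "cmap c ` cdom c"
    define w where "w = s t c"
    obtain u where u: "((\<lambda>t. cmap c (\<gamma> t)) has_vector_derivative u) (at t within ?I)"
      using arc ca t unfolding C1_arc_def by blast
    \<comment> \<open>Derivatives within the interval are unique even at its ends, so the velocity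
      in the transport equation is \<open>u\<close>.\<close>
    have nb: "at t within ?I \<noteq> bot" using ab t by (auto simp: trivial_limit_within islimpt_Icc)
    have vu: "vector_derivative (\<lambda>t. cmap c (\<gamma> t)) (at t within ?I) = u"
      using vector_derivative_within[OF nb u] .
    define G where "G = christoffel M K c (\<gamma> t) u w"
    have ds: "((\<lambda>t. s t c) has_vector_derivative - G) (at t within ?I)"
      using par t c ab arc unfolding parallel_along_def G_def w_def vu[symmetric] by blast
    define P' where "P' v v' = frechet_derivative (\<lambda>x. pullback_coeff c x v v') (at ?x)" for v v'
    have xS: "?x \<in> ?S" using ca by blast
    have P': "((\<lambda>x. pullback_coeff c x v v') has_derivative P' v v') (at ?x)" for v v'
      unfolding P'_def using smooth_on_pullback_coeff[OF ca(1)] xS by (rule smooth_on_imp_has_derivative)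
    have bil: "bilinear (pullback_coeff c ?x)" using bilinear_pullback_coeff[OF ca(1) xS] .
    have D: "((\<lambda>t. pullback_coeff c (cmap c (\<gamma> t)) (s t c) (s t c)) has_derivative
        (\<lambda>h. P' w w (h *\<^sub>R u) + pullback_coeff c ?x (h *\<^sub>R - G) w + pullback_coeff c ?x w (h *\<^sub>R - G))) (at t within ?I)"
      unfolding w_def
      by (rule has_derivative_bilinear_family[where G = "pullback_coeff c",
            OF open_cmap_cdom[OF ca(1)] bilinear_pullback_coeff[OF ca(1)] P'
            u[unfolded has_vector_derivative_def] ds[unfolded has_vector_derivative_def]
            ds[unfolded has_vector_derivative_def] xS t])
    \<comment> \<open>Fields with constant coordinates: for them the derivative of the coefficients
      along \<open>u\<close> is covered by \<open>K\<close>, and \<open>G\<close> is the coordinate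
      vector of \<open>K ?X ?Y\<close> at the point.\<close>
    let ?X = "coord_field M c u" and ?Y = "coord_field M c w"
    note cf = coord_field_vfields[OF ca(1)]
    have KT: "K ?X ?Y (\<gamma> t) \<in> TM (\<gamma> t)"
      and dP: "deriv_along M (\<lambda>q. pullback q (?Y q) (?Y q)) (\<gamma> t) (?X (\<gamma> t)) = 2 * pullback (\<gamma> t) (K ?X ?Y (\<gamma> t)) (?Y (\<gamma> t))"
      using K[OF openin_cdom[OF ca(1)] cf cf ca(2)] by auto
    have "deriv_along M (\<lambda>q. pullback q (?Y q) (?Y q)) (\<gamma> t) (?X (\<gamma> t)) = P' w w u"
      using deriv_along_has_derivative[OF P'[of w w, unfolded pullback_coeff_def] coord_field_tangent[OF c] c]
      by (simp add: coord_field_self[OF c])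
    moreover have "coord_field M c G (\<gamma> t) = K ?X ?Y (\<gamma> t)"
      using coord_field_coord[OF KT c] by (simp add: G_def christoffel_def)
    \<comment> \<open>Moving the base point contributes \<open>2 * pullback_coeff c ?x G w\<close>,
      and the transport equation contributes its negative through the two slots.\<close>
    ultimately have PG: "P' w w u = 2 * pullback_coeff c ?x G w"
      using dP by (simp add: pullback_coeff_def cinv_cmap ca)
    have sym: "pullback_coeff c ?x w G = pullback_coeff c ?x G w"
      using pullback_sym[OF p coord_field_tangent[OF c] coord_field_tangent[OF c]]
      by (simp add: pullback_coeff_def cinv_cmap ca)
    have linP: "P' w w (h *\<^sub>R u) = h * P' w w u" for h
      using linear_cmul[OF has_derivative_linear[OF P']] by simp
    have "P' w w (h *\<^sub>R u) + pullback_coeff c ?x (h *\<^sub>R - G) w + pullback_coeff c ?x w (h *\<^sub>R - G) = 0" for h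
      unfolding linP PG bilinear_lmul[OF bil] bilinear_rmul[OF bil] bilinear_lneg[OF bil] bilinear_rneg[OF bil] sym
      by simp
    then have D0: "((\<lambda>t. pullback_coeff c (cmap c (\<gamma> t)) (s t c) (s t c)) has_derivative (\<lambda>h. 0)) (at t within ?I)"
      using D by simp
    have eq: "pullback_coeff c (cmap c (\<gamma> r)) (s r c) (s r c) = ?f r" if "r \<in> ?I" "\<gamma> r \<in> cdom c" for r
      using coord_field_coord[OF sT[OF that(1)], of c] that ca
      by (simp add: pullback_coeff_def cinv_cmap mem_charts_at)
    \<comment> \<open>The chart covers the curve only near \<open>t\<close>, so the coordinate
      expression is compared with the length on a neighbourhood of \<open>t\<close> in the
      interval.\<close>
    have "openin (top_of_set ?I) {r \<in> topspace (top_of_set ?I). \<gamma> r \<in> cdom c}"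
      using cont openin_cdom[OF ca(1)] by (rule openin_continuous_map_preimage)
    then obtain T where T: "open T" "{r \<in> ?I. \<gamma> r \<in> cdom c} = ?I \<inter> T"
      by (auto simp: openin_open)
    have "eventually (\<lambda>r. pullback_coeff c (cmap c (\<gamma> r)) (s r c) (s r c) = ?f r) (at t within ?I)"
      unfolding eventually_at_topological
    proof (intro exI[of _ T] conjI ballI impI)
      show "t \<in> T" using T t ca by blast
      show "pullback_coeff c (cmap c (\<gamma> r)) (s r c) (s r c) = ?f r" if "r \<in> T" "r \<in> ?I" for r
        using T that by (intro eq) blast+
    qed (rule T)
    then show ?thesis
      using D0 eq[OF t ca(2)] t by (intro has_derivative_transform_eventually[OF D0])
  qed
  then obtain k where "\<And>t. t \<in> ?I \<Longrightarrow> ?f t = k"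
    using has_derivative_zero_constant[of ?I ?f] by auto
  then show ?thesis using ab by auto
qed

text \<open>Conservation passes the break points because consecutive arcs share an end and
  \<open>s\<close> is one section along the whole path.\<close>

lemma pullback_parallel_path:
  assumes K: "\<And>U X Y p. openin (topo M) U \<Longrightarrow> X \<in> vfields M U \<Longrightarrow> Y \<in> vfields M U \<Longrightarrow> p \<in> U \<Longrightarrow>
      K X Y p \<in> TM p \<and> deriv_along M (\<lambda>q. pullback q (Y q) (Y q)) p (X p) = 2 * pullback p (K X Y p) (Y p)"
    and par: "parallel_along M K \<gamma> s" and path: "piecewise_C1_path M \<gamma>"
  shows "pullback (\<gamma> 1) (s 1) (s 1) = pullback (\<gamma> 0) (s 0) (s 0)"
proof -
  obtain ts where ts: "ts \<noteq> []" "sorted_wrt (<) ts" "hd ts = 0" "last ts = (1::real)"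
    "\<And>i. Suc i < length ts \<Longrightarrow> C1_arc M \<gamma> (ts ! i) (ts ! Suc i)"
    using path unfolding piecewise_C1_path_def by blast
  let ?f = "\<lambda>t. pullback (\<gamma> t) (s t) (s t)"
  have mono: "ts ! i \<le> ts ! j" if "i \<le> j" "j < length ts" for i j
    using sorted_wrt_nth_less[OF ts(2), of i j] that by (cases "i = j") auto
  have "?f (ts ! i) = ?f (ts ! 0)" if "i < length ts" for i
    using that
  proof (induction i)
    case (Suc i)
    have "?f (ts ! Suc i) = ?f (ts ! i)"
    proof (rule pullback_parallel_arc[OF K par ts(5)[OF Suc.prems]])
      show "0 \<le> ts ! i" using mono[of 0 i] ts(1,3) Suc.prems by (simp add: hd_conv_nth)
      show "ts ! i < ts ! Suc i" using sorted_wrt_nth_less[OF ts(2), of i "Suc i"] Suc.prems by simp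
      show "ts ! Suc i \<le> 1" using mono[of "Suc i" "length ts - 1"] ts(1,4) Suc.prems by (simp add: last_conv_nth)
    qed
    then show ?case using Suc by simp
  qed simp
  from this[of "length ts - 1"] show ?thesis
    using ts(1,3,4) by (simp add: hd_conv_nth last_conv_nth)
qed

lemma pullback_zero_iff:
  assumes p: "p \<in> points M" and v: "v \<in> TM p"
  shows "pullback p v v = 0 \<longleftrightarrow> v \<in> VV p"
proof -
  have "pullback p v v = 0 \<longleftrightarrow> dpi p v = 0"
    unfolding pullback_def using target.metric_eq_zero_iff[OF map_points[OF p] differential_tangent[OF p v]] .
  then show ?thesis using v by (simp add: vertical_def)
qed

text \<open>A dimension count: if the vertical space were trivial, the differential would be an
  injective linear map from \<open>'e\<close> to the smaller \<open>'f\<close> in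
  coordinates.\<close>

lemma VV_nontrivial:
  assumes p: "p \<in> points M" and dim: "DIM('f) < DIM('e)"
  shows "VV p \<noteq> {0}"
proof
  assume triv: "VV p = {0}"
  obtain c where c: "c \<in> charts_at M p" using charts_at_nonempty[OF p] by blast
  obtain d where d: "d \<in> charts_at N (\<pi> p)" using target.charts_at_nonempty[OF map_points[OF p]] by blast
  define L where "L = frechet_derivative (coord_map c d) (at (cmap c p))"
  have lin: "linear L" unfolding L_def using has_derivative_linear[OF coord_map_has_derivative[OF c d]] .
  have "u = 0" if "L u = 0" for u
  proof -
    note t = coord_field_tangent[OF c, of u]
    have "dpi p (coord_field M c u p) d = 0"
      using differential_chart[OF c d t] that by (simp add: L_def coord_field_self[OF c])
    then have "dpi p (coord_field M c u p) = 0"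
      by (intro target.tangent_eqI[OF differential_tangent[OF p t] subspace_0[OF target.subspace_tangent_space] d]) simp
    then have "coord_field M c u p = 0" using t triv by (auto simp: vertical_def)
    then show ?thesis using coord_field_self[OF c, of u] by simp
  qed
  then have "inj L" using linear_injective_0[OF lin] by blast
  then have "dim (range L) = DIM('e)" using dim_image_eq[OF lin, of UNIV] by simp
  then show False using dim dim_subset_UNIV[of "range L"] by simp
qed

text \<open>A Euclidean space has a nonempty basis, so \<open>N\<close> has a nonzero tangent vector
  at \<open>\<pi> p\<close>, and surjectivity of the differential lifts it to a vector that is not
  vertical.\<close>

lemma VV_proper:
  assumes p: "p \<in> points M"
  shows "VV p \<subset> TM p"
proof -
  obtain d where d: "d \<in> charts_at N (\<pi> p)" using target.charts_at_nonempty[OF map_points[OF p]] by blast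
  obtain b :: 'f where b: "b \<in> Basis" using nonempty_Basis by blast
  obtain v where v: "v \<in> TM p" "dpi p v = coord_field N d b (\<pi> p)"
    using submersion_surj[OF p] target.coord_field_tangent[OF d, of b] by (metis imageE)
  have "v \<notin> VV p"
    using v target.coord_field_self[OF d, of b] nonzero_Basis[OF b] by (auto simp: vertical_def)
  then show ?thesis using v(1) VV_TM by blast
qed

text \<open>The vertical space is invariant: a transported vertical vector keeps
  \<open>pullback\<close>-length zero, and definiteness of \<open>h\<close> makes it vertical
  again.\<close>

lemma reduced_holonomyI:
  assumes "\<And>U X Y p. openin (topo M) U \<Longrightarrow> X \<in> vfields M U \<Longrightarrow> Y \<in> vfields M U \<Longrightarrow> p \<in> U \<Longrightarrow>
      K X Y p \<in> TM p \<and> deriv_along M (\<lambda>q. pullback q (Y q) (Y q)) p (X p) = 2 * pullback p (K X Y p) (Y p)"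
    and dim: "DIM('f) < DIM('e)"
  shows "reduced_holonomy M K"
  unfolding reduced_holonomy_def
proof (intro ballI exI[of _ "VV p" for p] conjI)
  fix p assume p: "p \<in> points M"
  show "subspace (VV p)" "VV p \<noteq> {0}" "VV p \<subset> TM p"
    using subspace_VV[OF p] VV_nontrivial[OF p dim] VV_proper[OF p] .
  fix \<tau> assume \<tau>: "\<tau> \<in> holonomy M K p"
  show "\<tau> ` VV p \<subseteq> VV p"
  proof clarify
    fix v assume v: "v \<in> VV p"
    then obtain \<gamma> s where *: "piecewise_C1_path M \<gamma>" "\<gamma> 0 = p" "\<gamma> 1 = p" "parallel_along M K \<gamma> s" "s 0 = v" "s 1 = \<tau> v"
      using \<tau> VV_TM[OF v] unfolding holonomy_def by blast
    have \<tau>v: "\<tau> v \<in> TM p" using \<tau> VV_TM[OF v] by (auto simp: holonomy_def)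
    have "pullback p (\<tau> v) (\<tau> v) = pullback p v v"
      using pullback_parallel_path[OF assms(1) *(4,1)] * by simp
    then show "\<tau> v \<in> VV p"
      using pullback_zero_iff[OF p \<tau>v] pullback_zero_iff[OF p VV_TM[OF v]] v by simp
  qed
qed

end

theorem proposition3p1:
  fixes M :: "('m, 'e::euclidean_space) manifold"
    and N :: "('n, 'f::euclidean_space) manifold"
    and g :: "('m, 'e) bilin" and h :: "('n, 'f) bilin"
    and J :: "('m, 'e) endo" and \<pi> :: "'m \<Rightarrow> 'n"
  defines "V \<equiv> vertical M N \<pi>"
    and "H \<equiv> horizontal M g N \<pi>"
    and "g_hat \<equiv> hat_metric M g N \<pi>"
    and "J_hat \<equiv> hat_structure M g J N \<pi>"
  assumes "riemannian_submersion M g N h \<pi>"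
    and "DIM('f) < DIM('e)"
    and "totally_geodesic_fibers M g N \<pi>"
    and "kaehler M g J"
    and "preserves M J V" and "preserves M J H"
  shows "nearly_kaehler M g_hat J_hat \<and>
    (\<forall>D. levi_civita M g_hat D \<longrightarrow>
       parallel_distribution M (canonical_hermitian_connection D J_hat) V \<and>
       parallel_distribution M (canonical_hermitian_connection D J_hat) H \<and>
       reduced_holonomy M (canonical_hermitian_connection D J_hat))"
proof -
  interpret riem_submersion M g N h \<pi> using assms(5) by unfold_locales
  obtain D where D: "levi_civita M g D" and "\<forall>U. openin (topo M) U \<longrightarrow>
      (\<forall>X\<in>vfields M U. \<forall>Y\<in>vfields M U. \<forall>p\<in>U. cov_endo D J X Y p = 0)"
    using assms(8) unfolding kaehler_def by blast
  then have DJ: "cov_endo D J X Y p = 0"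
    if "openin (topo M) U" "X \<in> vfields M U" "Y \<in> vfields M U" "p \<in> U" for U X Y p
    using that by simp
  \<comment> \<open>The fibers come with a connection of their own; uniqueness transfers the
    property to \<open>D\<close>.\<close>
  obtain D' where D': "levi_civita M g D'" and geo': "\<And>b. b \<in> points N \<Longrightarrow>
      let F = {p \<in> points M. \<pi> p = b} in
             \<forall>U. openin (topo M) U \<longrightarrow>
               (\<forall>X\<in>vfields M U. \<forall>Y\<in>vfields M U.
                  (\<forall>p\<in>U \<inter> F. X p \<in> VV p \<and> Y p \<in> VV p) \<longrightarrow> (\<forall>p\<in>U \<inter> F. D' X Y p \<in> VV p))"
    using assms(7) unfolding totally_geodesic_fibers_def by blast
  have geo: "D X Y p \<in> VV p" if U: "openin (topo M) U" and X: "X \<in> vfields M U" and Y: "Y \<in> vfields M U"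
    and "\<And>q. q \<in> U \<Longrightarrow> X q \<in> VV q" "\<And>q. q \<in> U \<Longrightarrow> Y q \<in> VV q" and pU: "p \<in> U" for U X Y p
  proof -
    have p: "p \<in> points M" using U pU openin_subset by blast
    \<comment> \<open>The hypothesis is stated fiber by fiber; it is applied to the fiber through
      \<open>p\<close>, along which fields vertical on \<open>U\<close> are vertical.\<close>
    have "D' X Y p \<in> VV p"
      using geo'[OF map_points[OF p], unfolded Let_def, rule_format, OF U X Y, of p] that p by simp
    then show ?thesis using levi_civita_unique[OF D D' U X Y pU] by simp
  qed
  interpret kaehler_submersion M g N h \<pi> J D
    using assms(8-10) D DJ geo by unfold_locales (auto simp: kaehler_def V_def H_def)
  have "reduced_holonomy M (canonical_hermitian_connection D' J_hat)" if "levi_civita M g_hat D'" for D'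
    unfolding J_hat_def using pullback_canonical that unfolding g_hat_def
    by (intro reduced_holonomyI assms(6) conjI) blast+
  then show ?thesis
    using nearly_kaehler_hat canonical_parallel unfolding V_def H_def g_hat_def J_hat_def by blast
qed

end
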